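(* Assume $\mathrm{char}\,k\neq2$. Let $V$ be a $2n$-dimensional $k$-vector space ($n\ge1$) with a nondegenerate alternating bilinear form. The nil-elliptic conjugacy classes $\mathcal C$ in $\mathfrak{sp}(V_F)$ obtained from almost commuting pairs $(N,f)$ with $f$ a $Q'_{Sp}$-action (i.e. containing an element $N$ that almost commutes with some $Q'_{Sp}$-action) are precisely those with $$h_{\mathcal C}(\mu)=\prod_{i=1}^r(\mu^d-b_i\pi^s),\quad s>0,\ rd=n,\ (s,2d)=1,\ (\mathrm{char}'\,k,d)=1,$$ with the $b_i$'s distinct elements of $k^*$. If $N$ is the standard matrix representative of such a class with respect to a symplectic basis $e_1,\dots,e_{2n}$ of $V$, then $N$ almost commutes with exponent $s$ with the diagonal $Q'_{Sp}$-action $f$ given by $f(\lambda)\pi^me_j=\lambda^{\nu(m,j)}\pi^me_j$, where $\nu(m,i)=2dm+is$ and $\nu(m,n+i)=2dm+(1-i)s$ for $i\in[1,n]$.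
   Context: $k$ is an algebraically closed field, $F=k((\pi))$, $A=k[[\pi]]$, $V_F=V\otimes_kF$; $\mathrm{char}'\,k$ is the characteristic exponent ($1$ if $\mathrm{char}\,k=0$, and $\mathrm{char}\,k$ otherwise). Conjugacy in $\mathfrak{sp}(V_F)$ is under $Sp(V_F)$. $N\in\mathfrak{sp}(V_F)$ is regular semisimple if its eigenvalues in an algebraic closure of $F$ are $\pm a_1,\dots,\pm a_n$ with the $a_i^2$ distinct and nonzero; $h_N\in F[\mu]$ is defined by $h_N(\mu^2)=\mathrm{char}_N(\mu)$, and $h_{\mathcal C}=h_N$ for $N\in\mathcal C$. A regular semisimple $N$ is elliptic if its centralizer in $Sp(V_F)$ is an elliptic torus, i.e. has no nontrivial cocharacter defined over $F$. An element is nil if it is conjugate to some $N'\in\mathfrak{sp}(V\otimes_kA)$ whose image in $\mathfrak{sp}(V)$ ($\pi\mapsto0$) is nilpotent. Nil-elliptic means nil, regular semisimple and elliptic. $k^*$ acts on $F$ by $k$-algebra automorphisms with $\lambda\cdot\pi^m=\lambda^m\pi^m$, hence on $V_F$, and by $N\mapsto N^\lambda$ on $\mathfrak{sp}(V_F)$. $Q'_{Sp}=PGSp(V)\times k^*$ acts on $\mathfrak{sp}(V_F)$ by $(g,\lambda)\cdot N=\mathrm{Ad}(g)N^\lambda$; a $Q'_{Sp}$-action is given by an algebraic homomorphism $f:k^*\to Q'_{Sp}$, and it almost commutes with $N$ with exponent $s$ if $s$ is a nonzero integer and $f(\lambda)\cdot N=\lambda^sN$ for all $\lambda$. An algebraic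 homomorphism $f:k^*\to GSp(V)\times k^*$ ($GSp(V)$ the group of symplectic similitudes), regarded as a $k^*$-action on $V_F$ by $k$-linear automorphisms, induces a $Q'_{Sp}$-action; the almost commuting condition then reads $f(\lambda)N=\lambda^sNf(\lambda)$. A symplectic basis satisfies: $\langle e_i,e_{n+j}\rangle=\delta_{ij}$ for $i,j\in[1,n]$ and the spans of $e_1,\dots,e_n$ and of $e_{n+1},\dots,e_{2n}$ are isotropic. Standard representative: with $q=s/d$, write $h_{\mathcal C}(\mu)=\sum_{i=0}^nc_i\pi^{qi}\mu^{n-i}$, $c_i\in k$. Then $N=(a_{ij})$ (with $Ne_j=\sum_ia_{ij}e_i$) where $a_{ij}=1$ if $i=j+1$, $j\in[1,n-1]$, or $(i,j)=(1,n+1)$; $a_{ij}=-1$ if $j=i+1$, $i\in[n+1,2n-1]$; $a_{n+j,j}=(-1)^jc_j\pi^{qj}$ for $j\in[1,n]$; and $a_{ij}=0$ otherwise. *)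

theory Defs
  imports
    "Jordan_Normal_Form.Char_Poly"
    "Jordan_Normal_Form.VS_Connect"
    "Jordan_Normal_Form.Gauss_Jordan_Elimination"
    "HOL-Algebra.Coset"
    "HOL-Algebra.Algebraic_Closure_Type"
    "HOL-Computational_Algebra.Formal_Laurent_Series"
begin


text \<open>
  Conventions. The vector space \<open>V\<close> is \<open>carrier_vec (2 * n)\<close> over \<open>k\<close>, with the arbitrary nondegenerate
  alternating form \<open>(v, w) \<mapsto> v \<bullet> B w\<close> given by its Gram matrix \<open>B\<close>. The field \<open>F = k((\<pi>))\<close> is
  \<open>'k fls\<close> and \<open>A = k[[\<pi>]]\<close> is \<open>'k fps\<close>; \<open>V\<^sub>F\<close> is \<open>carrier_vec (2 * n)\<close> over \<open>'k fls\<close>, with the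
  \<open>F\<close>-bilinear extension of the form.
\<close>

section \<open>Symplectic vector spaces and their groups\<close>

definition symplectic_form :: "nat \<Rightarrow> 'r::comm_ring_1 mat \<Rightarrow> bool" where
  "symplectic_form n B \<longleftrightarrow>
     B \<in> carrier_mat (2 * n) (2 * n) \<and>
     (\<forall>v\<in>carrier_vec (2 * n). v \<bullet> (B *\<^sub>v v) = 0) \<and>
     (\<forall>v\<in>carrier_vec (2 * n).
        (\<forall>w\<in>carrier_vec (2 * n). v \<bullet> (B *\<^sub>v w) = 0) \<longrightarrow> v = 0\<^sub>v (2 * n))"

text \<open>
  The matrix equations below express \<open>\<langle>Mv,w\<rangle> + \<langle>v,Mw\<rangle> = 0\<close>, \<open>\<langle>gv,gw\<rangle> = \<langle>v,w\<rangle>\<close> and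
  \<open>\<langle>gv,gw\<rangle> = c\<langle>v,w\<rangle>\<close>. Invertibility of \<open>g\<close> follows since \<open>B\<close> is invertible.
\<close>

definition sp :: "'r::comm_ring_1 mat \<Rightarrow> 'r mat set" where
  "sp B = {M \<in> carrier_mat (dim_row B) (dim_row B).
             transpose_mat M * B + B * M = 0\<^sub>m (dim_row B) (dim_row B)}"

definition Sp :: "'r::comm_ring_1 mat \<Rightarrow> 'r mat set" where
  "Sp B = {g \<in> carrier_mat (dim_row B) (dim_row B). transpose_mat g * B * g = B}"

definition GSp :: "'k::field mat \<Rightarrow> 'k mat monoid" where
  "GSp B = \<lparr>carrier = {g \<in> carrier_mat (dim_row B) (dim_row B).
                         \<exists>c. c \<noteq> 0 \<and> transpose_mat g * B * g = c \<cdot>\<^sub>m B},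
            monoid.mult = (*), one = 1\<^sub>m (dim_row B)\<rparr>"

definition scalars :: "'k::field mat \<Rightarrow> 'k mat set" where
  "scalars B = {c \<cdot>\<^sub>m 1\<^sub>m (dim_row B) | c. c \<noteq> 0}"

definition PGSp :: "'k::field mat \<Rightarrow> 'k mat set monoid" where
  "PGSp B = GSp B Mod scalars B"

definition Gm :: "'k::field monoid" where
  "Gm = \<lparr>carrier = {x. x \<noteq> 0}, monoid.mult = (*), one = 1\<rparr>"

definition Ad :: "'r::field mat \<Rightarrow> 'r mat \<Rightarrow> 'r mat" where
  "Ad g M = g * M * the (mat_inverse g)"

abbreviation const_mat :: "'k::zero mat \<Rightarrow> 'k fls mat" where
  "const_mat \<equiv> map_mat fls_const"

abbreviation const_vec :: "'k::zero vec \<Rightarrow> 'k fls vec" where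
  "const_vec \<equiv> map_vec fls_const"

section \<open>Conjugacy classes in the Lie algebra\<close>

text \<open>In this section and the next, \<open>B\<close> is the Gram matrix over \<open>k\<close>.\<close>

definition sp_conj :: "'k::field mat \<Rightarrow> 'k fls mat \<Rightarrow> 'k fls mat \<Rightarrow> bool" where
  "sp_conj B N N' \<longleftrightarrow> (\<exists>g\<in>Sp (const_mat B). N' = Ad g N)"

definition sp_classes :: "'k::field mat \<Rightarrow> 'k fls mat set set" where
  "sp_classes B = {{N'. sp_conj B N N'} | N. N \<in> sp (const_mat B)}"

definition h_elt :: "'k::field fls mat \<Rightarrow> 'k fls poly" where
  "h_elt N = (THE h. h \<circ>\<^sub>p Polynomial.monom 1 2 = char_poly N)"

definition h_class :: "'k::field fls mat set \<Rightarrow> 'k fls poly" where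
  "h_class C = (THE h. \<forall>N\<in>C. h_elt N = h)"

definition regular_semisimple :: "nat \<Rightarrow> 'k::field mat \<Rightarrow> 'k fls mat \<Rightarrow> bool" where
  "regular_semisimple n B N \<longleftrightarrow>
     N \<in> sp (const_mat B) \<and>
     (\<exists>a :: nat \<Rightarrow> 'k fls alg_closure.
        map_poly to_ac (char_poly N) = (\<Prod>i=1..n. [:- a i, 1:] * [:a i, 1:]) \<and>
        inj_on (\<lambda>i. a i ^ 2) {1..n} \<and> (\<forall>i\<in>{1..n}. a i ^ 2 \<noteq> 0))"

text \<open>Regular functions on \<open>\<bbbG>\<^sub>m\<close>, i.e. Laurent polynomials, as functions on the points over an
  infinite field; the value at \<open>0\<close> is irrelevant.\<close>

definition regular_on_Gm :: "('f::field \<Rightarrow> 'f) \<Rightarrow> bool" where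
  "regular_on_Gm \<phi> \<longleftrightarrow>
     (\<exists>(S :: int set) c. finite S \<and> (\<forall>t. t \<noteq> 0 \<longrightarrow> \<phi> t = (\<Sum>m\<in>S. c m * t powi m)))"

definition mat_regular_on_Gm :: "nat \<Rightarrow> ('f::field \<Rightarrow> 'f mat) \<Rightarrow> bool" where
  "mat_regular_on_Gm m \<phi> \<longleftrightarrow> (\<forall>i<m. \<forall>j<m. regular_on_Gm (\<lambda>t. \<phi> t $$ (i, j)))"

text \<open>
  Cocharacters defined over \<open>F\<close> of the centralizer of \<open>N\<close> in \<open>Sp(V\<^sub>F)\<close>. Since \<open>F\<close> is infinite,
  \<open>F\<^sup>*\<close> is Zariski dense in \<open>\<bbbG>\<^sub>m\<close>, so that a homomorphism of algebraic groups over \<open>F\<close> is determined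
  by its effect on \<open>F\<close>-points, and identities between regular maps may be tested there.
\<close>

definition centralizer_cocharacter ::
    "'k::field mat \<Rightarrow> 'k fls mat \<Rightarrow> ('k fls \<Rightarrow> 'k fls mat) \<Rightarrow> bool" where
  "centralizer_cocharacter B N \<chi> \<longleftrightarrow>
     mat_regular_on_Gm (dim_row B) \<chi> \<and>
     (\<forall>t. t \<noteq> 0 \<longrightarrow> \<chi> t \<in> Sp (const_mat B) \<and> \<chi> t * N = N * \<chi> t) \<and>
     (\<forall>t u. t \<noteq> 0 \<longrightarrow> u \<noteq> 0 \<longrightarrow> \<chi> (t * u) = \<chi> t * \<chi> u)"

definition elliptic :: "nat \<Rightarrow> 'k::field mat \<Rightarrow> 'k fls mat \<Rightarrow> bool" where
  "elliptic n B N \<longleftrightarrow>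
     regular_semisimple n B N \<and>
     (\<forall>\<chi>. centralizer_cocharacter B N \<chi> \<longrightarrow> (\<forall>t. t \<noteq> 0 \<longrightarrow> \<chi> t = 1\<^sub>m (dim_row B)))"

definition nil :: "'k::field mat \<Rightarrow> 'k fls mat \<Rightarrow> bool" where
  "nil B N \<longleftrightarrow>
     N \<in> sp (const_mat B) \<and>
     (\<exists>N' \<in> sp (map_mat fps_const B).
        sp_conj B N (map_mat fps_to_fls N') \<and>
        (\<exists>m. map_mat (\<lambda>a. fps_nth a 0) N' ^\<^sub>m m = 0\<^sub>m (dim_row B) (dim_row B)))"

definition nil_elliptic :: "nat \<Rightarrow> 'k::field mat \<Rightarrow> 'k fls mat \<Rightarrow> bool" where
  "nil_elliptic n B N \<longleftrightarrow> nil B N \<and> regular_semisimple n B N \<and> elliptic n B N"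

definition nil_elliptic_classes :: "nat \<Rightarrow> 'k::field mat \<Rightarrow> 'k fls mat set set" where
  "nil_elliptic_classes n B = {C \<in> sp_classes B. \<forall>N\<in>C. nil_elliptic n B N}"

section \<open>Actions and almost commuting pairs\<close>

definition rescale :: "'k::field \<Rightarrow> 'k fls \<Rightarrow> 'k fls" where
  "rescale l a = Abs_fls (\<lambda>m. l powi m * fls_nth a m)"

definition Q_Sp :: "'k::field mat \<Rightarrow> ('k mat set \<times> 'k) monoid" where
  "Q_Sp B = PGSp B \<times>\<times> Gm"

text \<open>The adjoint action of a coset is that of any of its elements.\<close>

definition Q_act :: "'k::field mat set \<times> 'k \<Rightarrow> 'k fls mat \<Rightarrow> 'k fls mat" where
  "Q_act q N = Ad (const_mat (SOME g. g \<in> fst q)) (map_mat (rescale (snd q)) N)"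

text \<open>
  The structure of an algebraic group on \<open>PGSp(V)\<close> is the one for which \<open>Ad\<close> is a closed embedding
  into \<open>GL(End V)\<close>: the regular functions on \<open>GSp(V)\<close> invariant under scalars are generated by the
  matrix coefficients of \<open>Ad\<close>. Hence a homomorphism into \<open>PGSp(V) \<times> k\<^sup>*\<close> is algebraic iff the
  matrix coefficients of its composition with \<open>Ad\<close>, and its second component, are Laurent polynomials.
\<close>

definition Q_Sp_action :: "'k::field mat \<Rightarrow> ('k \<Rightarrow> 'k mat set \<times> 'k) \<Rightarrow> bool" where
  "Q_Sp_action B f \<longleftrightarrow>
     f \<in> hom Gm (Q_Sp B) \<and>
     (\<forall>M \<in> carrier_mat (dim_row B) (dim_row B).
        mat_regular_on_Gm (dim_row B) (\<lambda>l. Ad (SOME g. g \<in> fst (f l)) M)) \<and>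
     regular_on_Gm (\<lambda>l. snd (f l))"

definition almost_commutes ::
    "('k::field \<Rightarrow> 'k mat set \<times> 'k) \<Rightarrow> 'k fls mat \<Rightarrow> int \<Rightarrow> bool" where
  "almost_commutes f N s \<longleftrightarrow>
     s \<noteq> 0 \<and> (\<forall>l. l \<noteq> 0 \<longrightarrow> Q_act (f l) N = fls_const (l powi s) \<cdot>\<^sub>m N)"

definition from_almost_commuting_pair :: "'k::field mat \<Rightarrow> 'k fls mat set \<Rightarrow> bool" where
  "from_almost_commuting_pair B C \<longleftrightarrow>
     (\<exists>N\<in>C. \<exists>f s. Q_Sp_action B f \<and> almost_commutes f N s)"

definition GSp_Gm_hom :: "'k::field mat \<Rightarrow> ('k \<Rightarrow> 'k mat \<times> 'k) \<Rightarrow> bool" where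
  "GSp_Gm_hom B f \<longleftrightarrow>
     f \<in> hom Gm (GSp B \<times>\<times> Gm) \<and>
     mat_regular_on_Gm (dim_row B) (\<lambda>l. fst (f l)) \<and> regular_on_Gm (\<lambda>l. snd (f l))"

text \<open>The action of \<open>GSp(V) \<times> k\<^sup>*\<close> on \<open>V\<^sub>F\<close> by \<open>k\<close>-linear automorphisms.\<close>

definition GSp_Gm_act :: "'k::field mat \<times> 'k \<Rightarrow> 'k fls vec \<Rightarrow> 'k fls vec" where
  "GSp_Gm_act q x = const_mat (fst q) *\<^sub>v map_vec (rescale (snd q)) x"

definition induced_Q_Sp ::
    "'k::field mat \<Rightarrow> ('k \<Rightarrow> 'k mat \<times> 'k) \<Rightarrow> 'k \<Rightarrow> 'k mat set \<times> 'k" where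
  "induced_Q_Sp B f l = (scalars B #>\<^bsub>GSp B\<^esub> fst (f l), snd (f l))"

section \<open>Symplectic bases and the standard representative\<close>

text \<open>The basis vectors are \<open>e 1, \<dots>, e (2 * n)\<close>.\<close>

definition symplectic_basis :: "nat \<Rightarrow> 'k::field mat \<Rightarrow> (nat \<Rightarrow> 'k vec) \<Rightarrow> bool" where
  "symplectic_basis n B e \<longleftrightarrow>
     inj_on e {1..2 * n} \<and>
     vectorspace.basis class_ring (module_vec TYPE('k) (2 * n)) (e ` {1..2 * n}) \<and>
     (\<forall>i\<in>{1..n}. \<forall>j\<in>{1..n}. e i \<bullet> (B *\<^sub>v e (n + j)) = (if i = j then 1 else 0)) \<and>
     (\<forall>I \<in> {{1..n}, {n + 1..2 * n}}.
        \<forall>v \<in> LinearCombinations.module.span class_ring (module_vec TYPE('k) (2 * n)) (e ` I).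
        \<forall>w \<in> LinearCombinations.module.span class_ring (module_vec TYPE('k) (2 * n)) (e ` I).
          v \<bullet> (B *\<^sub>v w) = 0)"

text \<open>
  The entries \<open>a\<^sub>i\<^sub>j\<close>, with indices starting from \<open>1\<close>. Since \<open>h = \<Sum>i\<le>n. c\<^sub>i \<pi>\<^bsup>qi\<^esup> \<mu>\<^bsup>n-i\<^esup>\<close>, the element
  \<open>c\<^sub>j \<pi>\<^bsup>qj\<^esup>\<close> of \<open>F\<close> is the coefficient of \<open>\<mu>\<^bsup>n-j\<^esup>\<close> in \<open>h\<close>.
\<close>

definition standard_entry :: "nat \<Rightarrow> 'k::field fls poly \<Rightarrow> nat \<Rightarrow> nat \<Rightarrow> 'k fls" where
  "standard_entry n h i j =
     (if (i = j + 1 \<and> j \<in> {1..n - 1}) \<or> (i, j) = (1, n + 1) then 1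
      else if j = i + 1 \<and> i \<in> {n + 1..2 * n - 1} then - 1
      else if j \<in> {1..n} \<and> i = n + j then (- 1) ^ j * poly.coeff h (n - j)
      else 0)"

definition standard_representative ::
    "nat \<Rightarrow> (nat \<Rightarrow> 'k::field vec) \<Rightarrow> 'k fls poly \<Rightarrow> 'k fls mat \<Rightarrow> bool" where
  "standard_representative n e h N \<longleftrightarrow>
     N \<in> carrier_mat (2 * n) (2 * n) \<and>
     (let P = const_mat (mat_of_cols (2 * n) (map e [1..<2 * n + 1])) in
      N * P = P * mat (2 * n) (2 * n) (\<lambda>(i, j). standard_entry n h (i + 1) (j + 1)))"

definition nu :: "nat \<Rightarrow> nat \<Rightarrow> nat \<Rightarrow> int \<Rightarrow> nat \<Rightarrow> int" where
  "nu n d s m j =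
     (if j \<le> n then 2 * int d * m + int j * int s
      else 2 * int d * m + (1 - int (j - n)) * int s)"

section \<open>The shape of the characteristic polynomial\<close>

definition char_exponent :: "'k::field itself \<Rightarrow> nat" where
  "char_exponent _ = (if CHAR('k) = 0 then 1 else CHAR('k))"

definition special_h :: "nat \<Rightarrow> nat \<Rightarrow> nat \<Rightarrow> nat \<Rightarrow> (nat \<Rightarrow> 'k::field) \<Rightarrow> 'k fls poly \<Rightarrow> bool" where
  "special_h n r d s b h \<longleftrightarrow>
     h = (\<Prod>i=1..r. Polynomial.monom 1 d - [:fls_const (b i) * fls_X ^ s:]) \<and>
     s > 0 \<and> r * d = n \<and> coprime s (2 * d) \<and> coprime (char_exponent TYPE('k)) d \<and>
     inj_on b {1..r} \<and> (\<forall>i\<in>{1..r}. b i \<noteq> 0)"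

end

(*
  A nil-elliptic element N that almost commutes with an action satisfies
  rescaling identities which force every coefficient of h_N to be a monomial in pi, all of them on one
  line; hence h_N is a product of factors mu^d - b pi^s. Nilpotency of the reduction gives s > 0, and
  regularity gives distinct b's and d prime to char' k. If s were even, mu^(2d) - b pi^s would split
  over F into two factors exchanged by mu -> -mu, whose kernels are dual isotropic subspaces, and a
  cocharacter acting on them by t and 1/t contradicts ellipticity.

  Conversely, let char_N be the product of P_i = mu^(2d) - b_i pi^s. The field F[mu]/(P_i) is k((t)) with
  pi = t^(2d) and mu = beta_i t^s, and mu -> -mu is t -> -t. Its fixed field has norm group everything,
  as even unit series have even square roots. So N has a vector v with <v, N^j v> = 0 for j < 2n - 1 and
  = 1 for j = 2n - 1, and the Krylov basis of such a vector shows that char_N determines the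
  conjugacy class. A cocharacter of the centralizer becomes z -> z^e in each k((t)), with norm 1, so e = 0.
  The standard matrix is integral with nilpotent reduction, and the diagonal action is checked on entries.
*)

theory Submission
  imports Defs "HOL-Number_Theory.Cong"
begin

section \<open>Polynomials in a square matrix\<close>

text \<open>No field extension, torus or cohomology set is built. Once a cyclic vector is known,
  statements about the centralizer become congruences in F[mu] modulo the characteristic polynomial,
  and each factor is studied by evaluation into k((t)), where order and parity of exponents can be
  read off coefficients. The obstacle is that equal characteristic polynomials do not in general
  imply conjugacy in the symplectic group over F: the form in a Krylov basis is known only up to a
  factor invariant under mu -> -mu, and a change of the vector alters this factor by a norm x(mu)
  x(-mu). The normal vector removes the ambiguity. Its condition singles out the exponent 2n - 1
  because N is skew-adjoint, so that <v, N^j v> vanishes for even j anyway. Conjugacy matters for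
  the converse because it puts the standard matrix into the class, which then inherits nilness and
  the torus action from it. The line carrying the monomials of h comes from the second component of
  the action, a character l^w; the nonzero constant coefficient of h fixes its slope.\<close>

definition poly_mat :: "'a::comm_ring_1 mat \<Rightarrow> 'a poly \<Rightarrow> 'a mat" where
  "poly_mat A p =
     fold_coeffs (\<lambda>a M. a \<cdot>\<^sub>m 1\<^sub>m (dim_row A) + A * M) p (0\<^sub>m (dim_row A) (dim_row A))"

lemma poly_mat_0 [simp]: "poly_mat A 0 = 0\<^sub>m (dim_row A) (dim_row A)"
  by (simp add: poly_mat_def)

lemma poly_mat_pCons:
  assumes "A \<in> carrier_mat m m"
  shows "poly_mat A (pCons a p) = a \<cdot>\<^sub>m 1\<^sub>m m + A * poly_mat A p"
\<comment> \<open>\<open>fold_coeffs\<close> works on the coefficient list, in which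
  \<open>pCons 0 0\<close> has no entry; this one case is treated separately.\<close>
proof (cases "p = 0 \<and> a = 0")
  case True
  have "(0 :: 'a) \<cdot>\<^sub>m 1\<^sub>m m = 0\<^sub>m m m" by auto
  then show ?thesis using True assms by simp
next
  case False
  then have "pCons a p \<noteq> 0" by auto
  then show ?thesis using assms by (cases "p = 0") (auto simp: poly_mat_def fold_coeffs_def cCons_def)
qed

lemma poly_mat_carrier [simp, intro]:
  assumes "A \<in> carrier_mat m m"
  shows "poly_mat A p \<in> carrier_mat m m"
  using assms by (induction p) (auto simp: poly_mat_pCons[OF assms])

lemma dim_poly_mat [simp]:
  assumes "A \<in> carrier_mat m m"
  shows "dim_row (poly_mat A p) = m" "dim_col (poly_mat A p) = m"
  using poly_mat_carrier[OF assms, of p] by auto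

lemma poly_mat_add:
  assumes A: "A \<in> carrier_mat m m"
  shows "poly_mat A (p + q) = poly_mat A p + poly_mat A q"
proof (induction p q rule: poly_induct2)
  case 0
  then show ?case using A by auto
next
  case (pCons a p b q)
  have C: "poly_mat A p \<in> carrier_mat m m" "poly_mat A q \<in> carrier_mat m m" using A by auto
  have "poly_mat A (pCons a p + pCons b q) = (a + b) \<cdot>\<^sub>m 1\<^sub>m m + A * (poly_mat A p + poly_mat A q)"
    using pCons by (simp add: poly_mat_pCons[OF A])
  also have "A * (poly_mat A p + poly_mat A q) = A * poly_mat A p + A * poly_mat A q"
    using mult_add_distrib_mat[OF A C] .
  also have "(a + b) \<cdot>\<^sub>m 1\<^sub>m m + \<dots> =
      (a \<cdot>\<^sub>m 1\<^sub>m m + A * poly_mat A p) + (b \<cdot>\<^sub>m 1\<^sub>m m + A * poly_mat A q)"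
    using A C by (intro eq_matI) (auto simp: algebra_simps)
  finally show ?case by (simp add: poly_mat_pCons[OF A])
qed

lemma poly_mat_smult:
  assumes A: "A \<in> carrier_mat m m"
  shows "poly_mat A (Polynomial.smult c p) = c \<cdot>\<^sub>m poly_mat A p"
proof (induction p)
  case 0
  then show ?case using A by auto
next
  case (pCons a p)
  have C: "poly_mat A p \<in> carrier_mat m m" using A by auto
  have "A * (c \<cdot>\<^sub>m poly_mat A p) = c \<cdot>\<^sub>m (A * poly_mat A p)"
    using mult_smult_distrib[OF A C] .
  then show ?case using A C pCons by (auto simp: poly_mat_pCons[OF A] algebra_simps)
qed

lemma poly_mat_mult:
  assumes A: "A \<in> carrier_mat m m"
  shows "poly_mat A (p * q) = poly_mat A p * poly_mat A q"
proof (induction p)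
  case 0
  then show ?case using A by auto
next
  case (pCons a p)
  have C: "poly_mat A p \<in> carrier_mat m m" "poly_mat A q \<in> carrier_mat m m"
    and D: "A * poly_mat A p \<in> carrier_mat m m" using A by auto
  have E: "0\<^sub>m m m + A * (poly_mat A p * poly_mat A q) = A * (poly_mat A p * poly_mat A q)"
    using A C by (intro left_add_zero_mat mult_carrier_mat)
  have z: "(0 :: 'a) \<cdot>\<^sub>m 1\<^sub>m m = 0\<^sub>m m m" by auto
  have "poly_mat A (pCons a p * q) = a \<cdot>\<^sub>m poly_mat A q + A * (poly_mat A p * poly_mat A q)"
    using pCons A C E by (simp add: poly_mat_add[OF A] poly_mat_smult[OF A] poly_mat_pCons[OF A] z)
  also have "\<dots> = (a \<cdot>\<^sub>m 1\<^sub>m m + A * poly_mat A p) * poly_mat A q"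
    using A C D by (simp add: add_mult_distrib_mat[of _ m m _ _ m] assoc_mult_mat[of _ m m _ m _ m]
        mult_smult_assoc_mat[of _ m m _ m])
  finally show ?case by (simp add: poly_mat_pCons[OF A])
qed

lemma poly_mat_const:
  assumes A: "A \<in> carrier_mat m m"
  shows "poly_mat A [:c:] = c \<cdot>\<^sub>m 1\<^sub>m m"
  using A by (simp add: poly_mat_pCons[OF A])

lemma poly_mat_1 [simp]:
  assumes A: "A \<in> carrier_mat m m"
  shows "poly_mat A 1 = 1\<^sub>m m"
proof -
  have "(1 :: 'a) \<cdot>\<^sub>m 1\<^sub>m m = 1\<^sub>m m" by auto
  then show ?thesis using poly_mat_const[OF A, of 1] by (simp add: one_pCons)
qed

lemma poly_mat_uminus:
  assumes A: "A \<in> carrier_mat m m"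
  shows "poly_mat A (- p) = - poly_mat A p"
  using poly_mat_smult[OF A, of "-1" p] A by auto

lemma poly_mat_diff:
  assumes A: "A \<in> carrier_mat m m"
  shows "poly_mat A (p - q) = poly_mat A p - poly_mat A q"
  using poly_mat_add[OF A, of p "- q"] poly_mat_uminus[OF A, of q] A by auto

lemma poly_mat_X:
  assumes A: "A \<in> carrier_mat m m"
  shows "poly_mat A [:0, 1:] = A"
proof -
  have z: "(0 :: 'a) \<cdot>\<^sub>m 1\<^sub>m m = 0\<^sub>m m m" by auto
  have o: "(1 :: 'a) \<cdot>\<^sub>m 1\<^sub>m m = 1\<^sub>m m" by auto
  show ?thesis using A by (simp add: poly_mat_pCons[OF A] z o)
qed

lemma poly_mat_commute:
  assumes A: "A \<in> carrier_mat m m"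
  shows "poly_mat A p * poly_mat A q = poly_mat A q * poly_mat A p"
  using poly_mat_mult[OF A, of p q] poly_mat_mult[OF A, of q p] by (simp add: mult.commute)

text \<open>Serves three purposes: \<open>S = A\<close> gives commutation, a matrix \<open>S\<close>
  commuting with \<open>A\<close> leads to the description of the centralizer, and the Gram matrix
  as \<open>S\<close> turns skew-adjointness of M into a formula for the adjoint of p(M).\<close>

lemma poly_mat_intertwine:
  assumes A: "A \<in> carrier_mat m m" and S: "S \<in> carrier_mat m m" and B: "B \<in> carrier_mat m m"
    and eq: "A * S = S * B"
  shows "poly_mat A p * S = S * poly_mat B p"
proof (induction p)
  case 0
  then show ?case using A B S by auto
next
  case (pCons a p)
  have D: "poly_mat A p \<in> carrier_mat m m" "poly_mat B p \<in> carrier_mat m m"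
    using A B by auto
  have "(a \<cdot>\<^sub>m 1\<^sub>m m + A * poly_mat A p) * S = a \<cdot>\<^sub>m S + A * (poly_mat A p * S)"
    using A D S by (simp add: add_mult_distrib_mat[of _ m m _ _ m] assoc_mult_mat[of _ m m _ m _ m]
        mult_smult_assoc_mat[of _ m m _ m])
  also have "A * (poly_mat A p * S) = A * S * poly_mat B p"
    using A D S by (simp add: pCons assoc_mult_mat[of _ m m _ m _ m])
  also have "\<dots> = S * (B * poly_mat B p)"
    using eq D S B by (simp add: assoc_mult_mat[of _ m m _ m _ m])
  also have "a \<cdot>\<^sub>m S + \<dots> = S * (a \<cdot>\<^sub>m 1\<^sub>m m + B * poly_mat B p)"
    using B D S by (simp add: mult_add_distrib_mat[of _ m m _ m _] mult_smult_distrib[of _ m m _ m])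
  finally show ?case by (simp add: poly_mat_pCons[OF A] poly_mat_pCons[OF B])
qed

lemma poly_mat_transpose:
  assumes A: "A \<in> carrier_mat m m"
  shows "transpose_mat (poly_mat A p) = poly_mat (transpose_mat A) p"
proof (induction p)
  case 0
  then show ?case using A by auto
next
  case (pCons a p)
  have T: "transpose_mat A \<in> carrier_mat m m" using A by auto
  have D: "poly_mat A p \<in> carrier_mat m m" "poly_mat (transpose_mat A) p \<in> carrier_mat m m"
    using A T by auto
  have "A * poly_mat A p = poly_mat A p * A"
    using poly_mat_intertwine[OF A A A refl, of p] by simp
  then have "transpose_mat (A * poly_mat A p) = transpose_mat A * poly_mat (transpose_mat A) p"
    using A D pCons by (simp add: transpose_mult[of _ m m _ m])
  moreover have "transpose_mat (a \<cdot>\<^sub>m 1\<^sub>m m + A * poly_mat A p) =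
     a \<cdot>\<^sub>m 1\<^sub>m m + transpose_mat (A * poly_mat A p)"
    using A D by (intro eq_matI) auto
  ultimately show ?case by (simp add: poly_mat_pCons[OF A] poly_mat_pCons[OF T])
qed

lemma poly_mat_neg:
  assumes A: "A \<in> carrier_mat m m"
  shows "poly_mat (- A) p = poly_mat A (p \<circ>\<^sub>p [:0, - 1:])"
proof (induction p)
  case 0
  then show ?case using A by auto
next
  case (pCons a p)
  have A': "- A \<in> carrier_mat m m" using A by auto
  have e: "[:0, - 1:] = - [:0, 1 :: 'a:]" by simp
  have "poly_mat A (pCons a p \<circ>\<^sub>p [:0, - 1:]) = a \<cdot>\<^sub>m 1\<^sub>m m + - A * poly_mat A (p \<circ>\<^sub>p [:0, - 1:])"
    unfolding pcompose_pCons poly_mat_add[OF A] poly_mat_const[OF A] poly_mat_mult[OF A]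
    by (subst e, subst poly_mat_uminus[OF A], subst poly_mat_X[OF A]) simp
  then show ?case by (simp add: poly_mat_pCons[OF A'] pCons)
qed

lemma scalar_mat_mult_vec:
  fixes v :: "'a::comm_ring_1 vec"
  assumes "v \<in> carrier_vec m"
  shows "(a \<cdot>\<^sub>m 1\<^sub>m m) *\<^sub>v v = a \<cdot>\<^sub>v v"
  using assms by (intro eq_vecI) auto

lemma mult_mat_smult_vec:
  fixes A :: "'a::comm_ring_1 mat"
  assumes "A \<in> carrier_mat m l" "v \<in> carrier_vec l"
  shows "A *\<^sub>v (a \<cdot>\<^sub>v v) = a \<cdot>\<^sub>v (A *\<^sub>v v)"
  using assms by (intro eq_vecI) auto

lemma poly_mat_eigenvector:
  assumes A: "A \<in> carrier_mat m m" and v: "v \<in> carrier_vec m" and eig: "A *\<^sub>v v = x \<cdot>\<^sub>v v"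
  shows "poly_mat A p *\<^sub>v v = poly p x \<cdot>\<^sub>v v"
proof (induction p)
  case 0
  then show ?case using A v by auto
next
  case (pCons a p)
  have D: "poly_mat A p \<in> carrier_mat m m" using A by auto
  have "(a \<cdot>\<^sub>m 1\<^sub>m m + A * poly_mat A p) *\<^sub>v v = a \<cdot>\<^sub>v v + A *\<^sub>v (poly_mat A p *\<^sub>v v)"
    using A D v by (simp add: add_mult_distrib_mat_vec[of _ m m] assoc_mult_mat_vec[of _ m m _ m]
        scalar_mat_mult_vec)
  also have "\<dots> = a \<cdot>\<^sub>v v + poly p x \<cdot>\<^sub>v (x \<cdot>\<^sub>v v)"
    using eig by (simp add: pCons mult_mat_smult_vec[OF A v])
  also have "\<dots> = poly (pCons a p) x \<cdot>\<^sub>v v"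
    using v by (intro eq_vecI) (auto simp: algebra_simps)
  finally show ?case by (simp add: poly_mat_pCons[OF A])
qed

lemma (in comm_ring_hom) poly_mat_hom:
  assumes A: "A \<in> carrier_mat m m"
  shows "map_mat hom (poly_mat A p) = poly_mat (map_mat hom A) (map_poly hom p)"
proof (induction p)
  case 0
  then show ?case using A by auto
next
  case (pCons a p)
  have hA: "map_mat hom A \<in> carrier_mat m m" using A by auto
  have D: "poly_mat A p \<in> carrier_mat m m" "A * poly_mat A p \<in> carrier_mat m m" using A by auto
  have "map_mat hom (a \<cdot>\<^sub>m 1\<^sub>m m + M) = hom a \<cdot>\<^sub>m 1\<^sub>m m + map_mat hom M"
    if "M \<in> carrier_mat m m" for M
    using that by (intro eq_matI) (auto simp: hom_add)
  then have "map_mat hom (a \<cdot>\<^sub>m 1\<^sub>m m + A * poly_mat A p) =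
      hom a \<cdot>\<^sub>m 1\<^sub>m m + map_mat hom (A * poly_mat A p)"
    using D(2) by blast
  also have "map_mat hom (A * poly_mat A p) = map_mat hom A * map_mat hom (poly_mat A p)"
    using mat_hom_mult[OF A D(1)] .
  finally show ?case
    by (simp add: poly_mat_pCons[OF A] poly_mat_pCons[OF hA] map_poly_pCons_hom pCons)
qed

text \<open>The free \<open>R[X]\<close>-module maps to \<open>R\<^sup>m\<close>, with \<open>X\<close> acting as \<open>A\<close>, by evaluation. The rows of the transposed
  characteristic matrix are relations, hence so are their combinations by the adjugate.\<close>

theorem cayley_hamilton:
  fixes A :: "'a::comm_ring_1 mat"
  assumes A: "A \<in> carrier_mat m m"
  shows "poly_mat A (char_poly A) = 0\<^sub>m m m"
proof -
  define M where "M = char_poly_matrix (transpose_mat A)"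
  define Adj where "Adj = adj_mat M"
  have T: "transpose_mat A \<in> carrier_mat m m" using A by auto
  have M: "M \<in> carrier_mat m m" using T unfolding M_def by simp
  note adj = adj_mat[OF M, folded Adj_def]
  have det: "det M = char_poly A" using A unfolding M_def by (simp flip: char_poly_def)
  have rel: "(\<Sum>j<m. poly_mat A (M $$ (i, j)) $$ (k, j)) = 0" if i: "i < m" and k: "k < m" for i k
  proof -
    have Mij: "poly_mat A (M $$ (i, j)) $$ (k, j) = (if i = j then A $$ (k, j) else 0) -
         A $$ (j, i) * (if k = j then 1 else 0)" if j: "j < m" for j
    proof -
      have "M $$ (i, j) = (if i = j then [:0, 1:] else 0) + - [: A $$ (j, i) :]"
        using i j A unfolding M_def char_poly_matrix_def by auto
      then have "poly_mat A (M $$ (i, j)) = poly_mat A (if i = j then [:0, 1:] else 0) +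
           - (A $$ (j, i) \<cdot>\<^sub>m 1\<^sub>m m)"
        by (simp only: poly_mat_add[OF A] poly_mat_uminus[OF A] poly_mat_const[OF A])
      then show ?thesis using A k j by (auto simp: poly_mat_X[OF A])
    qed
    have "(\<Sum>j<m. poly_mat A (M $$ (i, j)) $$ (k, j)) =
        (\<Sum>j<m. (if i = j then A $$ (k, j) else 0) - A $$ (j, i) * (if k = j then 1 else 0))"
      by (rule sum.cong) (auto simp: Mij)
    also have "\<dots> = 0"
      using i k by (simp add: sum_subtractf sum.delta' if_distrib[of "(*) _"] cong: if_cong)
    finally show ?thesis .
  qed
  have "poly_mat A (char_poly A) $$ (k, l) = 0" if k: "k < m" and l: "l < m" for k l
  proof -
    \<comment> \<open>Row \<open>l\<close> of Adj * M = det M: the combination of the relations that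
      isolates the basis vector of index \<open>l\<close>.\<close>
    have id: "(\<Sum>i<m. Adj $$ (l, i) * M $$ (i, j)) = (if l = j then char_poly A else 0)"
      if j: "j < m" for j
    proof -
      have "(Adj * M) $$ (l, j) = (\<Sum>i<m. Adj $$ (l, i) * M $$ (i, j))"
        using adj(1) M l j by (simp add: scalar_prod_def atLeast0LessThan)
      then show ?thesis using adj(3) l j by (simp add: det split: if_splits)
    qed
    have add: "poly_mat A (\<Sum>i\<in>I. f i) $$ (k, j) = (\<Sum>i\<in>I. poly_mat A (f i) $$ (k, j))"
      if "finite I" "j < m" for I :: "nat set" and f j
      using that(1) that(2) k A
    proof (induction I rule: finite_induct)
      case (insert x F)
      have "poly_mat A (sum f F) \<in> carrier_mat m m" using A by simp
      then show ?case using insert by (simp add: poly_mat_add[OF A])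
    qed simp
    have "poly_mat A (char_poly A) $$ (k, l) =
        (\<Sum>j<m. poly_mat A (if l = j then char_poly A else 0) $$ (k, j))"
      using l k A by (subst sum.remove[of _ l]) (auto intro!: sum.neutral)
    also have "\<dots> = (\<Sum>j<m. poly_mat A (\<Sum>i<m. Adj $$ (l, i) * M $$ (i, j)) $$ (k, j))"
      by (rule sum.cong) (auto simp: id)
    also have "\<dots> = (\<Sum>j<m. \<Sum>i<m. poly_mat A (Adj $$ (l, i) * M $$ (i, j)) $$ (k, j))"
      by (rule sum.cong) (auto simp: add)
    also have "\<dots> = (\<Sum>j<m. \<Sum>i<m. \<Sum>h<m. poly_mat A (Adj $$ (l, i)) $$ (k, h) *
        poly_mat A (M $$ (i, j)) $$ (h, j))"
      using A k by (auto intro!: sum.cong simp: poly_mat_mult[OF A] scalar_prod_def atLeast0LessThan)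
    also have "\<dots> = (\<Sum>i<m. \<Sum>h<m. \<Sum>j<m. poly_mat A (Adj $$ (l, i)) $$ (k, h) *
        poly_mat A (M $$ (i, j)) $$ (h, j))"
      by (subst sum.swap, rule sum.cong[OF refl], rule sum.swap)
    also have "\<dots> = (\<Sum>i<m. \<Sum>h<m. poly_mat A (Adj $$ (l, i)) $$ (k, h) *
        (\<Sum>j<m. poly_mat A (M $$ (i, j)) $$ (h, j)))"
      by (simp add: sum_distrib_left)
    also have "\<dots> = 0" by (simp add: rel)
    finally show ?thesis .
  qed
  then show ?thesis using A by (intro eq_matI) auto
qed

section \<open>Laurent polynomials as functions\<close>

text \<open>Multiplying by a power of z gives a polynomial with infinitely many zeros; the shift
  keeps the exponents distinct, so each \<open>c m\<close> is one of its coefficients.\<close>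

lemma laurent_polynomial_zero:
  fixes Z :: "'l::field set"
  assumes inf: "infinite Z" and S: "finite S"
    and zero: "\<And>z. z \<in> Z \<Longrightarrow> z \<noteq> 0 \<and> (\<Sum>m\<in>S. c m * z powi m) = 0"
    and m: "m \<in> S"
  shows "c m = 0"
proof -
  obtain M where M: "\<And>m. m \<in> S \<Longrightarrow> m + M \<ge> 0"
  proof
    fix m assume "m \<in> S"
    then have "\<bar>m\<bar> \<le> (\<Sum>m\<in>S. \<bar>m\<bar>)" using S by (intro member_le_sum) auto
    then show "m + (\<Sum>m\<in>S. \<bar>m\<bar>) \<ge> 0" by linarith
  qed
  define p where "p = (\<Sum>m\<in>S. Polynomial.monom (c m) (nat (m + M)))"
  have "poly p z = 0" if "z \<in> Z" for z
  proof -
    have z: "z \<noteq> 0" using zero that by auto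
    have "poly p z = (\<Sum>m\<in>S. z powi M * (c m * z powi m))"
      unfolding p_def poly_sum
    proof (rule sum.cong[OF refl])
      fix m assume "m \<in> S"
      then have "z ^ nat (m + M) = z powi (m + M)" using M by (simp add: power_int_def)
      then show "poly (Polynomial.monom (c m) (nat (m + M))) z = z powi M * (c m * z powi m)"
        using z by (simp add: poly_monom power_int_add)
    qed
    then show ?thesis using zero[OF that] by (simp flip: sum_distrib_left)
  qed
  then have "Z \<subseteq> {z. poly p z = 0}" by auto
  then have "p = 0" using inf poly_roots_finite finite_subset by blast
  have "Polynomial.coeff p (nat (m + M)) = (\<Sum>l\<in>S. if l = m then c l else 0)"
    unfolding p_def coeff_sum
  proof (rule sum.cong[OF refl])
    fix l assume "l \<in> S"
    then show "Polynomial.coeff (Polynomial.monom (c l) (nat (l + M))) (nat (m + M)) =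
        (if l = m then c l else 0)"
      using M[of l] M[OF m] by auto
  qed
  then show ?thesis using \<open>p = 0\<close> S m by simp
qed

text \<open>For fixed w both sides of \<theta>(z w) = \<theta>(z) \<theta>(w) are Laurent
  polynomials in \<iota>(z). Comparing them at an exponent m with \<open>c m\<close> nonzero gives
  \<theta>(w) = \<iota>(w)^m. The target field differs from the source because the characters of
  interest take values in k((t)) while z runs over F.\<close>

lemma multiplicative_laurent_polynomial:
  fixes \<iota> :: "'f::field \<Rightarrow> 'l::field" and \<theta> :: "'f \<Rightarrow> 'l"
  assumes inf: "infinite (UNIV :: 'f set)" and "inj_comm_ring_hom \<iota>"
    and mult: "\<And>z w. z \<noteq> 0 \<Longrightarrow> w \<noteq> 0 \<Longrightarrow> \<theta> (z * w) = \<theta> z * \<theta> w"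
    and S: "finite S" and eq: "\<And>z. z \<noteq> 0 \<Longrightarrow> \<theta> z = (\<Sum>m\<in>S. c m * \<iota> z powi m)"
    and nz: "\<theta> 1 \<noteq> 0"
  shows "\<exists>m. \<forall>z. z \<noteq> 0 \<longrightarrow> \<theta> z = \<iota> z powi m"
proof -
  interpret h: inj_comm_ring_hom \<iota> by fact
  have infZ: "infinite (\<iota> ` (UNIV - {0}))"
    using inf by (simp add: finite_image_iff[OF inj_on_subset[OF h.inj_f]])
  have "\<exists>m\<in>S. c m \<noteq> 0"
  proof (rule ccontr)
    assume "\<not> (\<exists>m\<in>S. c m \<noteq> 0)"
    then have "\<theta> 1 = 0" using eq[of 1] by simp
    then show False using nz by simp
  qed
  then obtain m where m: "m \<in> S" "c m \<noteq> 0" by blast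
  have "\<theta> w = \<iota> w powi m" if w: "w \<noteq> 0" for w
  proof -
    have "c m * (\<iota> w powi m - \<theta> w) = 0"
    proof (rule laurent_polynomial_zero[OF infZ S _ m(1)])
      fix y assume "y \<in> \<iota> ` (UNIV - {0})"
      then obtain z where z: "y = \<iota> z" "z \<noteq> 0" by auto
      have "(\<Sum>m\<in>S. c m * \<iota> (z * w) powi m) = (\<Sum>m\<in>S. c m * \<iota> z powi m) * \<theta> w"
        using mult[OF z(2) w] eq[of "z * w"] eq[of z] z w by simp
      then have "(\<Sum>m\<in>S. c m * (\<iota> w powi m - \<theta> w) * \<iota> z powi m) = 0"
        by (simp add: h.hom_mult power_int_mult_distrib algebra_simps sum_distrib_left sum_distrib_right
              sum_subtractf)
      then show "y \<noteq> 0 \<and> (\<Sum>m\<in>S. c m * (\<iota> w powi m - \<theta> w) * y powi m) = 0"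
        using z by (simp add: h.hom_0_iff)
    qed
    then show ?thesis using m by simp
  qed
  then show ?thesis by auto
qed

text \<open>Over a finite field, 1 plus the product of all X - a is a nonconstant polynomial without
  roots.\<close>

lemma infinite_alg_closed: "infinite (UNIV :: 'a::alg_closed_field set)"
proof
  assume fin: "finite (UNIV :: 'a set)"
  define p where "p = (\<Prod>a\<in>(UNIV :: 'a set). [:- a, 1:])"
  have "Polynomial.degree p = (\<Sum>a\<in>(UNIV :: 'a set). 1)"
    unfolding p_def by (subst degree_prod_eq_sum_degree) auto
  then have "Polynomial.degree p > 0" using fin by (simp add: card_gt_0_iff)
  then have "Polynomial.degree (p + 1) > 0" by (subst degree_add_eq_left) auto
  then obtain x where "poly (p + 1) x = 0" using alg_closed_imp_poly_has_root by blast
  moreover have "poly p x = 0" unfolding p_def poly_prod using fin by (intro prod_zero) auto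
  ultimately show False by simp
qed

lemma infinite_fls: "infinite (UNIV :: 'a::field fls set)"
proof -
  have "inj (fls_X_intpow :: int \<Rightarrow> 'a fls)"
  proof (rule injI)
    fix i j
    assume "fls_X_intpow i = (fls_X_intpow j :: 'a fls)"
    then have "fls_subdegree (fls_X_intpow i :: 'a fls) = fls_subdegree (fls_X_intpow j :: 'a fls)"
      by (rule arg_cong)
    then show "i = j" by (simp only: fls_subdegree_fls_X_intpow)
  qed
  then show ?thesis by (meson finite_imageD finite_subset infinite_UNIV_int subset_UNIV)
qed

section \<open>Closure properties of regular functions on the multiplicative group\<close>

lemma regular_on_GmI:
  "finite S \<Longrightarrow> (\<And>t. t \<noteq> 0 \<Longrightarrow> \<phi> t = (\<Sum>m\<in>S. c m * t powi m)) \<Longrightarrow> regular_on_Gm \<phi>"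
  unfolding regular_on_Gm_def by blast

lemma regular_on_Gm_cong:
  assumes "\<And>t. t \<noteq> 0 \<Longrightarrow> \<phi> t = \<psi> t"
  shows "regular_on_Gm \<phi> \<longleftrightarrow> regular_on_Gm \<psi>"
  using assms unfolding regular_on_Gm_def by simp

lemma regular_on_Gm_monomial: "regular_on_Gm (\<lambda>t. c * t powi m)"
  by (rule regular_on_GmI[of "{m}" _ "\<lambda>_. c"]) auto

lemma regular_on_Gm_powi: "regular_on_Gm (\<lambda>t. t powi m)"
  using regular_on_Gm_monomial[of 1 m] by simp

lemma regular_on_Gm_const: "regular_on_Gm (\<lambda>t. c)"
  using regular_on_Gm_monomial[of c 0] by simp

lemma regular_on_Gm_add:
  assumes "regular_on_Gm \<phi>" "regular_on_Gm \<psi>"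
  shows "regular_on_Gm (\<lambda>t. \<phi> t + \<psi> t)"
proof -
  obtain S c T d where S: "finite S" "\<And>t. t \<noteq> 0 \<Longrightarrow> \<phi> t = (\<Sum>m\<in>S. c m * t powi m)"
    and T: "finite T" "\<And>t. t \<noteq> 0 \<Longrightarrow> \<psi> t = (\<Sum>m\<in>T. d m * t powi m)"
    using assms unfolding regular_on_Gm_def by blast
  show ?thesis
  proof (rule regular_on_GmI[of "S \<union> T" _ "\<lambda>m. (if m \<in> S then c m else 0) + (if m \<in> T then d m else 0)"])
    show "finite (S \<union> T)" using S T by simp
    fix t :: 'a assume t: "t \<noteq> 0"
    have "(\<Sum>m\<in>S. c m * t powi m) = (\<Sum>m\<in>S \<union> T. (if m \<in> S then c m else 0) * t powi m)"
      using S T by (intro sum.mono_neutral_cong_left) auto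
    moreover have "(\<Sum>m\<in>T. d m * t powi m) = (\<Sum>m\<in>S \<union> T. (if m \<in> T then d m else 0) * t powi m)"
      using S T by (intro sum.mono_neutral_cong_left) auto
    ultimately show "\<phi> t + \<psi> t =
      (\<Sum>m\<in>S \<union> T. ((if m \<in> S then c m else 0) + (if m \<in> T then d m else 0)) * t powi m)"
      using S T t by (simp add: ring_distribs sum.distrib)
  qed
qed

lemma regular_on_Gm_sum:
  "(\<And>i. i \<in> I \<Longrightarrow> regular_on_Gm (\<phi> i)) \<Longrightarrow> regular_on_Gm (\<lambda>t. \<Sum>i\<in>I. \<phi> i t)"
  by (induction I rule: infinite_finite_induct)
    (auto simp: regular_on_Gm_const regular_on_Gm_add)

lemma regular_on_Gm_mult:
  assumes "regular_on_Gm \<phi>" "regular_on_Gm \<psi>"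
  shows "regular_on_Gm (\<lambda>t. \<phi> t * \<psi> t)"
proof -
  obtain S c T d where S: "\<And>t. t \<noteq> 0 \<Longrightarrow> \<phi> t = (\<Sum>m\<in>S. c m * t powi m)"
    and T: "\<And>t. t \<noteq> 0 \<Longrightarrow> \<psi> t = (\<Sum>m\<in>T. d m * t powi m)"
    using assms unfolding regular_on_Gm_def by blast
  have "\<phi> t * \<psi> t = (\<Sum>m\<in>S. \<Sum>l\<in>T. (c m * d l) * t powi (m + l))" if "t \<noteq> 0" for t
    using that S T by (simp add: sum_product power_int_add mult_ac)
  then have "regular_on_Gm (\<lambda>t. \<phi> t * \<psi> t) \<longleftrightarrow>
      regular_on_Gm (\<lambda>t. \<Sum>m\<in>S. \<Sum>l\<in>T. (c m * d l) * t powi (m + l))"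
    by (rule regular_on_Gm_cong)
  also have "\<dots>" by (intro regular_on_Gm_sum regular_on_Gm_monomial)
  finally show ?thesis .
qed

section \<open>Laurent series\<close>

text \<open>\<open>rescale\<close> is given through \<open>Abs_fls\<close>, so the new coefficients
  have to vanish far to the left; they do, since the support does not grow.\<close>

lemma rescale_nth [simp]: "fls_nth (rescale l f) m = l powi m * fls_nth f m"
proof -
  have "\<forall>\<^sub>\<infinity>n. l powi (- int n) * fls_nth f (- int n) = 0"
  proof -
    have "\<forall>\<^sub>\<infinity>n. fls_nth f (- int n) = 0" using fls_nth[of f] by simp
    then show ?thesis by (rule eventually_mono) simp
  qed
  then show ?thesis unfolding rescale_def by (subst nth_Abs_fls) auto
qed

lemma fls_subdegree_rescale:
  assumes "l \<noteq> 0"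
  shows "fls_subdegree (rescale l f) = fls_subdegree f"
proof (cases "f = 0")
  case True
  then have "rescale l f = 0" by (intro fls_eqI) simp
  then show ?thesis using True by simp
next
  case False
  then show ?thesis using assms by (intro fls_subdegree_eqI) auto
qed

lemma inj_comm_ring_hom_rescale:
  assumes l: "l \<noteq> 0"
  shows "inj_comm_ring_hom (rescale l)"
proof
  show "rescale l (f * g) = rescale l f * rescale l g" for f g
  proof (rule fls_eqI)
    fix n
    have "l powi n = l powi i * l powi (n - i)" for i
      using l by (simp flip: power_int_add)
    then show "fls_nth (rescale l (f * g)) n = fls_nth (rescale l f * rescale l g) n"
      by (auto simp: fls_times_nth(2) fls_subdegree_rescale[OF l] sum_distrib_left mult_ac
          intro!: sum.cong)
  qed
  show "f = 0" if "rescale l f = 0" for f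
  proof (rule fls_eqI)
    fix n
    have "fls_nth (rescale l f) n = 0" using that by simp
    then show "fls_nth f n = fls_nth 0 n" using l by simp
  qed
qed (auto intro!: fls_eqI simp: algebra_simps)

lemma rescale_X_intpow: "rescale l (fls_X_intpow m) = fls_const (l powi m) * fls_X_intpow m"
  by (rule fls_eqI) auto

lemma rescale_const [simp]: "rescale l (fls_const a) = fls_const a"
  by (rule fls_eqI) auto

lemma inj_comm_ring_hom_fls_const: "inj_comm_ring_hom (fls_const :: 'a::field \<Rightarrow> _)"
  by unfold_locales (auto simp: fls_plus_const fls_const_mult_const fls_const_nonzero)

lemma inj_comm_ring_hom_compose_power:
  assumes "d > 0"
  shows "inj_comm_ring_hom (\<lambda>f :: 'a::field fls. fls_compose_power f d)"
proof
  show "f = 0" if "fls_compose_power f d = 0" for f :: "'a fls"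
  proof (rule fls_eqI)
    fix n
    have "fls_nth (fls_compose_power f d) (int d * n) = 0" using that by simp
    then show "fls_nth f n = fls_nth 0 n" using assms by (simp add: fls_nth_compose_power)
  qed
qed (use assms in auto)

lemma inj_comm_ring_hom_to_ac: "inj_comm_ring_hom (to_ac :: 'a::field \<Rightarrow> _)"
  by unfold_locales auto

text \<open>Obtained by solving the coefficient of index n in y * y = u for y_n, with y_0 = 1: the
  terms i = 0 and i = n contribute 2 y_n, hence the division by 2.\<close>

fun sqrt_coeff :: "(nat \<Rightarrow> 'a::field) \<Rightarrow> nat \<Rightarrow> 'a" where
  "sqrt_coeff u n = (if n = 0 then 1
     else (u n - (\<Sum>i\<in>{1..<n}. sqrt_coeff u i * sqrt_coeff u (n - i))) / 2)"

declare sqrt_coeff.simps [simp del]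

lemma two_neq_zero:
  assumes "CHAR('a::field) \<noteq> 2"
  shows "(2 :: 'a) \<noteq> 0"
proof
  assume "(2 :: 'a) = 0"
  then have "CHAR('a) dvd 2"
    using of_nat_eq_0_iff_char_dvd[of 2, where 'a = 'a] by simp
  then show False
    using assms CHAR_not_1'[where 'a = 'a] by (auto simp: prime_nat_iff dest: two_is_prime_nat[unfolded prime_nat_iff, THEN conjunct2, rule_format])
qed

lemma fps_square_root:
  fixes u :: "'a::field fps"
  assumes "CHAR('a) \<noteq> 2" and "fps_nth u 0 = 1"
  shows "\<exists>y. fps_nth y 0 = 1 \<and> y * y = u"
proof -
  define y where "y = Abs_fps (sqrt_coeff (fps_nth u))"
  have y: "fps_nth y n = sqrt_coeff (fps_nth u) n" for n by (simp add: y_def)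
  have y0: "fps_nth y 0 = 1" by (simp add: y sqrt_coeff.simps)
  have "fps_nth (y * y) n = fps_nth u n" for n
  proof (cases "n = 0")
    case True
    then show ?thesis using y0 assms by simp
  next
    case False
    have s: "{0..n} = insert 0 (insert n {1..<n})" by auto
    have "fps_nth (y * y) n = 2 * fps_nth y n + (\<Sum>i\<in>{1..<n}. fps_nth y i * fps_nth y (n - i))"
      unfolding fps_mult_nth s using False by (simp add: y0)
    also have "2 * fps_nth y n =
        fps_nth u n - (\<Sum>i\<in>{1..<n}. fps_nth y i * fps_nth y (n - i))"
      using False two_neq_zero[OF assms(1)] by (subst y, subst sqrt_coeff.simps) (simp flip: y)
    finally show ?thesis by simp
  qed
  then show ?thesis using y0 by (intro exI[of _ y]) (auto simp: fps_eq_iff)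
qed

text \<open>The norm of \<open>k((t))\<close> over \<open>k((t\<^sup>2))\<close> is \<open>g(t) g(-t)\<close>; it is surjective.\<close>

lemma even_laurent_series_is_norm:
  fixes f :: "'a::alg_closed_field fls"
  assumes ch: "CHAR('a) \<noteq> 2" and even: "rescale (- 1) f = f"
  shows "\<exists>g. g * rescale (- 1) g = f"
proof (cases "f = 0")
  case True
  then show ?thesis by (intro exI[of _ 0]) simp
next
  case False
  interpret r: inj_comm_ring_hom "rescale (- 1 :: 'a)" by (rule inj_comm_ring_hom_rescale) simp
  have two: "(2 :: 'a) \<noteq> 0" using ch by (rule two_neq_zero)
  then have neg: "(- 1 :: 'a) \<noteq> 1" by (metis add.right_inverse one_add_one)
  define e where "e = fls_subdegree f"
  define a where "a = fls_nth f e"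
  have a: "a \<noteq> 0" using False unfolding a_def e_def by simp
  \<comment> \<open>The leading coefficient is fixed under t -> -t, so the order of f is even; this
    uses that -1 and 1 differ in k.\<close>
  have "(- 1) powi e * a = a" using even rescale_nth[of "- 1" f e] by (simp add: a_def)
  then have sgn: "(- 1 :: 'a) powi e = 1" using a by simp
  have "Parity.even e"
    using sgn neg by (cases "Parity.even e") (auto simp: power_int_minus_left_odd)
  then obtain l where l: "e = 2 * l" by auto
  define U where "U = fls_const (inverse a) * fls_X_intpow (- e) * f"
  have fU: "f = fls_const a * fls_X_intpow e * U"
  proof -
    have "fls_const a * fls_const (inverse a) = 1"
      using a by (simp add: fls_const_mult_const)
    moreover have "fls_X_intpow e * fls_X_intpow (- e) = (1 :: 'a fls)"
      using fls_X_intpow_times_fls_X_intpow[of e "- e", where 'a = 'a] by simp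
    ultimately show ?thesis unfolding U_def by (metis (no_types, lifting) mult.assoc mult.commute mult_1)
  qed
  have evU: "rescale (- 1) U = U"
  proof -
    have "rescale (- 1) (fls_X_intpow (- e)) = (fls_X_intpow (- e) :: 'a fls)"
      using rescale_X_intpow[of "- 1 :: 'a" "- e"] sgn by (simp add: power_int_minus)
    then show ?thesis unfolding U_def r.hom_mult even by (simp only: rescale_const)
  qed
  have Unth: "fls_nth U m = inverse a * fls_nth f (m + e)" for m
    unfolding U_def mult.assoc fls_X_intpow_times_conv_shift(1) by simp
  have "fls_subdegree U \<ge> 0"
  proof (cases "U = 0")
    case False
    then show ?thesis by (rule fls_subdegree_geI) (simp add: Unth e_def)
  qed simp
  then obtain u where u: "U = fps_to_fls u"
    by (metis fls_regpart_to_fls_trivial)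
  have "fps_nth u 0 = fls_nth U 0" unfolding u by simp
  then have "fps_nth u 0 = 1" using Unth[of 0] a by (simp add: a_def)
  then obtain y where y: "fps_nth y 0 = 1" "y * y = u" using fps_square_root[OF ch] by blast
  define Y where "Y = fps_to_fls y"
  have Y: "Y * Y = U" "fls_nth Y 0 = 1"
    unfolding Y_def u using y by (auto simp flip: fls_times_fps_to_fls)
  \<comment> \<open>The square of Y is even, so Y(-t) is Y or -Y, and the constant term 1 excludes
    -Y.\<close>
  have "rescale (- 1) Y * rescale (- 1) Y = Y * Y"
    using Y evU by (simp flip: r.hom_mult)
  then have "rescale (- 1) Y = Y \<or> rescale (- 1) Y = - Y"
    by (simp add: square_eq_iff)
  moreover have "rescale (- 1) Y \<noteq> - Y"
    using Y(2) neg rescale_nth[of "- 1" Y 0] by (metis fls_uminus_nth mult_1 power_int_0_right)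
  ultimately have evY: "rescale (- 1) Y = Y" by blast
  \<comment> \<open>Since t^l (-t)^l = (-1)^l t^e, the constant of g has to satisfy c^2 = (-1)^l
    a.\<close>
  obtain c where c: "c ^ 2 = a * (- 1) powi l" using nth_root_exists[of 2] by auto
  define g where "g = fls_const c * fls_X_intpow l * Y"
  have "rescale (- 1) g = fls_const c * (fls_const ((- 1) powi l) * fls_X_intpow l) * Y"
    unfolding g_def r.hom_mult rescale_X_intpow rescale_const evY ..
  then have "g * rescale (- 1) g =
      (fls_const c * fls_const c * fls_const ((- 1) powi l)) * (fls_X_intpow l * fls_X_intpow l) * (Y * Y)"
    unfolding g_def by (simp only: mult_ac)
  also have "fls_const c * fls_const c * fls_const ((- 1) powi l) = fls_const (c ^ 2 * (- 1) powi l)"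
    by (simp only: fls_const_mult_const power2_eq_square)
  also have "c ^ 2 * (- 1) powi l = a"
    unfolding c by (simp flip: power_int_mult_distrib)
  also have "fls_X_intpow l * fls_X_intpow l = (fls_X_intpow e :: 'a fls)"
    unfolding fls_X_intpow_times_fls_X_intpow using l by simp
  finally show ?thesis using fU Y by (intro exI[of _ g]) (simp only:)
qed

section \<open>The polynomials \<open>\<mu>\<^sup>D - b\<^sup>D \<pi>\<^sup>s\<close> with \<open>(D, s) = 1\<close>\<close>

text \<open>The adjoint involution on F[mu]: for M in the symplectic Lie algebra the adjoint of p(M)
  is obtained by evaluating \<open>neg_arg p\<close> at M.\<close>

abbreviation neg_arg :: "'a::comm_ring_1 poly \<Rightarrow> 'a poly" where
  "neg_arg p \<equiv> p \<circ>\<^sub>p [:0, - 1:]"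

lemma neg_arg_neg_arg [simp]: "neg_arg (neg_arg p) = p"
  by (induction p) (simp_all add: pcompose_pCons pcompose_add pcompose_uminus)

lemma neg_arg_monom: "neg_arg (Polynomial.monom a j) = Polynomial.monom (a * (- 1) ^ j) j"
  by (induction j) (simp_all add: monom_0 monom_Suc pcompose_pCons minus_monom)

text \<open>
  The field \<open>F[\<mu>]/(\<mu>\<^sup>D - b\<^sup>D \<pi>\<^sup>s)\<close> is identified with \<open>k((t))\<close> by \<open>\<pi> = t\<^sup>D\<close> and \<open>\<mu> = b t\<^sup>s\<close>.
\<close>

locale kummer =
  fixes D s :: nat and b :: "'k::field"
  assumes D_pos: "D > 0" and coprime: "coprime D s" and b_nz: "b \<noteq> 0"
begin

text \<open>The constant is written as a D-th power so that \<open>root\<close> is explicit: its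
  D-th power is b^D t^(sD), the image of b^D pi^s.\<close>

definition P :: "'k fls poly" where
  "P = Polynomial.monom 1 D - [:fls_const (b ^ D) * fls_X ^ s:]"

definition root :: "'k fls" where
  "root = fls_const b * fls_X ^ s"

definition \<phi> :: "'k fls poly \<Rightarrow> 'k fls" where
  "\<phi> p = poly (map_poly (\<lambda>f. fls_compose_power f D) p) root"

sublocale cp: inj_comm_ring_hom "\<lambda>f :: 'k fls. fls_compose_power f D"
  by (rule inj_comm_ring_hom_compose_power[OF D_pos])

sublocale cpp: map_poly_inj_comm_ring_hom "\<lambda>f :: 'k fls. fls_compose_power f D" ..

lemma \<phi>_add: "\<phi> (p + q) = \<phi> p + \<phi> q"
  and \<phi>_mult: "\<phi> (p * q) = \<phi> p * \<phi> q"
  and \<phi>_diff: "\<phi> (p - q) = \<phi> p - \<phi> q"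
  and \<phi>_uminus: "\<phi> (- p) = - \<phi> p"
  and \<phi>_0 [simp]: "\<phi> 0 = 0"
  and \<phi>_1 [simp]: "\<phi> 1 = 1"
  and \<phi>_pCons: "\<phi> (pCons a p) = fls_compose_power a D + root * \<phi> p"
  unfolding \<phi>_def
  by (simp_all add: cpp.hom_add cpp.hom_mult cpp.hom_minus cpp.hom_uminus cp.map_poly_pCons_hom)

lemma \<phi>_const: "\<phi> [:a:] = fls_compose_power a D"
  by (simp add: \<phi>_pCons)

lemma \<phi>_monom: "\<phi> (Polynomial.monom a j) = fls_compose_power a D * root ^ j"
  unfolding \<phi>_def by (simp add: map_poly_monom poly_monom)

lemma \<phi>_sum: "\<phi> (\<Sum>i\<in>I. f i) = (\<Sum>i\<in>I. \<phi> (f i))"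
  by (induction I rule: infinite_finite_induct) (auto simp: \<phi>_add)

lemma \<phi>_prod: "\<phi> (\<Prod>i\<in>I. f i) = (\<Prod>i\<in>I. \<phi> (f i))"
  by (induction I rule: infinite_finite_induct) (auto simp: \<phi>_mult)

lemma root_power: "root ^ j = fls_const (b ^ j) * fls_X_intpow (int (s * j))"
  unfolding root_def power_mult_distrib power_mult[symmetric]
  by (simp only: fls_const_power fls_X_power_conv_shift_1)

lemma \<phi>_P [simp]: "\<phi> P = 0"
proof -
  have "fls_X_intpow (int D) ^ s = (fls_X_intpow (int (s * D)) :: 'k fls)"
    using fls_X_intpow_power[of "int D" s, where 'a = 'k] by simp
  then have c: "fls_compose_power (fls_const (b ^ D) * fls_X ^ s) D =
      fls_const (b ^ D) * fls_X_intpow (int (s * D))"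
    using D_pos
    by (simp only: cp.hom_mult cp.hom_power fls_compose_power_X fls_compose_power_const_left)
  have "\<phi> P = root ^ D - fls_compose_power (fls_const (b ^ D) * fls_X ^ s) D"
    unfolding P_def \<phi>_diff \<phi>_monom \<phi>_const cp.hom_one by simp
  then show ?thesis by (simp only: c root_power diff_self)
qed

lemma degree_P: "Polynomial.degree P = D" and lead_coeff_P: "Polynomial.coeff P D = 1"
proof -
  show lc: "Polynomial.coeff P D = 1"
    using D_pos unfolding P_def by (simp add: coeff_pCons split: nat.split)
  have "Polynomial.degree P \<le> D"
    unfolding P_def by (intro degree_diff_le) (auto simp: degree_monom_eq)
  moreover have "D \<le> Polynomial.degree P" by (rule le_degree) (simp add: lc)
  ultimately show "Polynomial.degree P = D" by simp
qed

lemma P_nz: "P \<noteq> 0"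
  using lead_coeff_P by auto

text \<open>As s is invertible modulo D, each integer is s j + D m for exactly one j below D. So the
  monomials pi^m mu^j with j < D correspond, up to scalars, bijectively to the powers of t; kernel
  and image of \<open>\<phi>\<close> are read off from this.\<close>

lemma residue_unique:
  fixes n :: int
  shows "\<exists>!j. j < D \<and> int D dvd n - int s * int j"
proof -
  have cop: "Rings.coprime (int s) (int D)" using coprime by (simp add: coprime_commute)
  obtain x where x: "[int s * x = 1] (mod int D)"
    using cong_solve_coprime_int[OF cop] by blast
  define j where "j = nat ((n * x) mod int D)"
  have j: "int j = (n * x) mod int D" "j < D"
    using D_pos unfolding j_def by (auto simp: nat_less_iff)
  have "[int s * int j = int s * (n * x)] (mod int D)"
    unfolding j by (rule cong_scalar_left) (simp add: cong_def)
  also have "int s * (n * x) = n * (int s * x)" by simp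
  also have "[n * (int s * x) = n * 1] (mod int D)" by (rule cong_scalar_left[OF x])
  finally have ex: "int D dvd n - int s * int j" by (simp add: cong_iff_dvd_diff dvd_diff_commute)
  show ?thesis
  proof (rule ex1I[of _ j])
    fix i assume i: "i < D \<and> int D dvd n - int s * int i"
    then have "int D dvd (n - int s * int i) - (n - int s * int j)" using i ex dvd_diff by blast
    then have "int D dvd int s * (int j - int i)" by (simp add: algebra_simps)
    then have "int D dvd int j - int i"
      using cop by (simp add: coprime_dvd_mult_right_iff coprime_commute)
    then show "i = j"
      using j i dvd_imp_le_int[of "int j - int i" "int D"] by (cases "i = j") auto
  qed (use ex j in auto)
qed

lemma \<phi>_nth:
  assumes deg: "Polynomial.degree p < D" and j: "j < D" "int D dvd n - int s * int j"
  shows "fls_nth (\<phi> p) n =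
     b ^ j * fls_nth (Polynomial.coeff p j) ((n - int s * int j) div int D)"
proof -
  have "p = (\<Sum>i<D. Polynomial.monom (Polynomial.coeff p i) i)"
    using deg by (intro poly_eqI) (auto simp: coeff_sum coeff_eq_0 not_less)
  then have "\<phi> p = (\<Sum>i<D. fls_compose_power (Polynomial.coeff p i) D * root ^ i)"
    by (metis (no_types, lifting) \<phi>_monom \<phi>_sum sum.cong)
  then have "fls_nth (\<phi> p) n = (\<Sum>i<D. fls_nth (fls_compose_power (Polynomial.coeff p i) D * root ^ i) n)"
    by (simp add: fls_nth_sum)
  also have "\<dots> = (\<Sum>i<D. if i = j then
      b ^ j * fls_nth (Polynomial.coeff p j) ((n - int s * int j) div int D) else 0)"
  \<comment> \<open>The exponents in the D summands lie in pairwise different residue classes modulo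
    D, so only \<open>i = j\<close> contributes.\<close>
  proof (rule sum.cong[OF refl])
    fix i assume "i \<in> {..<D}"
    then have dvd: "int D dvd n - int s * int i \<longleftrightarrow> i = j"
      using residue_unique[of n] j by blast
    have "fls_compose_power (Polynomial.coeff p i) D * root ^ i =
        fls_X_intpow (int (s * i)) * (fls_const (b ^ i) * fls_compose_power (Polynomial.coeff p i) D)"
      by (simp add: root_power mult_ac)
    then show "fls_nth (fls_compose_power (Polynomial.coeff p i) D * root ^ i) n =
      (if i = j then b ^ j * fls_nth (Polynomial.coeff p j) ((n - int s * int j) div int D) else 0)"
      using dvd D_pos by (simp add: fls_X_intpow_times_conv_shift fls_nth_compose_power)
  qed
  also have "\<dots> = b ^ j * fls_nth (Polynomial.coeff p j) ((n - int s * int j) div int D)"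
    using j by simp
  finally show ?thesis .
qed

text \<open>Multiples of P die because \<open>root\<close> is a zero of P. Conversely, the remainder
  modulo P has degree below D, and by \<open>\<phi>_nth\<close> its coefficients cannot cancel each
  other.\<close>

lemma \<phi>_eq_0_iff: "\<phi> p = 0 \<longleftrightarrow> P dvd p"
proof
  assume "P dvd p"
  then show "\<phi> p = 0" by (auto simp: \<phi>_mult)
next
  assume p: "\<phi> p = 0"
  define q r where "q = p div P" and "r = p mod P"
  have pqr: "p = q * P + r" unfolding q_def r_def by simp
  then have r0: "\<phi> r = 0" using p by (simp add: \<phi>_add \<phi>_mult)
  have deg: "Polynomial.degree r < D"
    using degree_mod_less'[OF P_nz, of p] D_pos degree_P unfolding r_def by (cases "p mod P = 0") auto
  have "Polynomial.coeff r j = 0" for j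
  proof (cases "j < D")
    case True
    show ?thesis
    proof (rule fls_eqI)
      fix m
      have "fls_nth (\<phi> r) (int D * m + int s * int j) = b ^ j * fls_nth (Polynomial.coeff r j) m"
        using \<phi>_nth[OF deg True, of "int D * m + int s * int j"] D_pos by simp
      then show "fls_nth (Polynomial.coeff r j) m = fls_nth 0 m" using r0 b_nz by simp
    qed
  next
    case False
    then show ?thesis using deg by (intro coeff_eq_0) simp
  qed
  then have "r = 0" by (simp add: poly_eq_iff)
  then show "P dvd p" using pqr by simp
qed

lemma \<phi>_surj: "\<exists>p. \<phi> p = f"
proof -
  define a where "a j = Abs_fls (\<lambda>m. fls_nth f (int D * m + int s * int j) / b ^ j)" for j
  have a: "fls_nth (a j) m = fls_nth f (int D * m + int s * int j) / b ^ j" for j m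
  proof -
    \<comment> \<open>For m < N one has m < 0 and hence D m <= m, which puts the exponent D m + s j
      below the order of f.\<close>
    define N where "N = - \<bar>fls_subdegree f\<bar> - int s * int j"
    have "fls_nth f (int D * m + int s * int j) / b ^ j = 0" if "m < N" for m
    proof -
      have "0 \<le> int s * int j" by simp
      then have "N \<le> 0" unfolding N_def by linarith
      then have "int D * m \<le> 1 * m" using that D_pos by (intro mult_right_mono_neg) auto
      then have "int D * m + int s * int j < fls_subdegree f" using that unfolding N_def by linarith
      then show ?thesis by simp
    qed
    then show ?thesis unfolding a_def by (intro nth_Abs_fls_lower_bound[of N]) auto
  qed
  define p where "p = (\<Sum>j<D. Polynomial.monom (a j) j)"
  have coeff: "Polynomial.coeff p j = (if j < D then a j else 0)" for j
    unfolding p_def coeff_sum by simp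
  then have deg: "Polynomial.degree p < D" using D_pos by (intro degree_lessI) auto
  have "\<phi> p = f"
  proof (rule fls_eqI)
    fix n
    obtain j where j: "j < D" "int D dvd n - int s * int j" using residue_unique[of n] by blast
    then show "fls_nth (\<phi> p) n = fls_nth f n"
      using \<phi>_nth[OF deg j] b_nz by (simp add: coeff a)
  qed
  then show ?thesis by blast
qed

text \<open>Primality of P: the target of \<open>\<phi>\<close> is a field.\<close>

lemma P_dvd_mult: "P dvd p * q \<longleftrightarrow> P dvd p \<or> P dvd q"
  by (simp flip: \<phi>_eq_0_iff add: \<phi>_mult)

lemma P_dvd_prod: "finite I \<Longrightarrow> P dvd (\<Prod>i\<in>I. f i) \<longleftrightarrow> (\<exists>i\<in>I. P dvd f i)"
  by (simp flip: \<phi>_eq_0_iff add: \<phi>_prod)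

lemma inverse_mod_P:
  assumes "\<not> P dvd p"
  shows "\<exists>q. P dvd 1 - q * p"
proof -
  obtain q where "\<phi> q = inverse (\<phi> p)" using \<phi>_surj by blast
  then have "\<phi> (1 - q * p) = 0" using assms by (simp add: \<phi>_diff \<phi>_mult \<phi>_eq_0_iff)
  then show ?thesis using \<phi>_eq_0_iff by blast
qed

text \<open>If D is even, s is odd by coprimality; then t -> -t fixes pi = t^D and negates mu = b
  t^s.\<close>

lemma \<phi>_neg_arg:
  assumes "Parity.even D"
  shows "\<phi> (neg_arg p) = rescale (- 1) (\<phi> p)"
proof -
  interpret r: inj_comm_ring_hom "rescale (- 1 :: 'k)" by (rule inj_comm_ring_hom_rescale) simp
  have s: "odd s" using assms coprime by (meson coprime_common_divisor odd_one)
  have "rescale (- 1 :: 'k) (fls_X_intpow (int s)) = fls_const ((- 1) powi int s) * fls_X_intpow (int s)"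
    by (rule rescale_X_intpow)
  then have root: "rescale (- 1) root = - root"
    unfolding root_def using s by (simp add: r.hom_mult fls_X_power_conv_shift_1)
  have cp: "rescale (- 1) (fls_compose_power a D) = fls_compose_power a D" for a :: "'k fls"
  proof (rule fls_eqI)
    fix n
    have "(- 1 :: 'k) powi n = 1" if "int D dvd n"
      using that assms by (metis dvd_trans even_of_nat_iff power_int_minus_left_even power_int_1_left)
    then show "fls_nth (rescale (- 1) (fls_compose_power a D)) n = fls_nth (fls_compose_power a D) n"
      using D_pos by (simp add: fls_nth_compose_power)
  qed
  show ?thesis
    by (induction p)
      (simp_all add: pcompose_pCons \<phi>_add \<phi>_mult \<phi>_const \<phi>_pCons \<phi>_uminus r.hom_add r.hom_mult root cp)
qed

lemma P_even: "Parity.even D \<Longrightarrow> neg_arg P = P"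
  unfolding P_def
  by (simp add: pcompose_diff neg_arg_monom)

end

text \<open>The divisibility hypothesis says that \<open>\<phi> c\<close> is an even series. Such a
  series is a norm g(t) g(-t), and surjectivity lifts g back to a polynomial.\<close>

lemma kummer_norm:
  fixes b :: "'k::alg_closed_field"
  assumes "kummer D s b" and even: "Parity.even D" and ch: "CHAR('k) \<noteq> 2"
    and c: "kummer.P D s b dvd neg_arg c - c"
  shows "\<exists>x. kummer.P D s b dvd x * neg_arg x - c"
proof -
  interpret kummer D s b by fact
  have "rescale (- 1) (\<phi> c) = \<phi> c"
    using c by (simp flip: \<phi>_eq_0_iff \<phi>_neg_arg[OF even] add: \<phi>_diff)
  then obtain g where g: "g * rescale (- 1) g = \<phi> c"
    using even_laurent_series_is_norm[OF ch] by blast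
  obtain x where "\<phi> x = g" using \<phi>_surj by blast
  then have "\<phi> (x * neg_arg x - c) = 0"
    using g by (simp add: \<phi>_diff \<phi>_mult \<phi>_neg_arg[OF even])
  then show ?thesis using \<phi>_eq_0_iff by blast
qed

section \<open>Cyclic vectors\<close>

lemma det_nz_inverse:
  fixes A :: "'a::field mat"
  assumes A: "A \<in> carrier_mat m m" and det: "det A \<noteq> 0"
  shows "\<exists>C \<in> carrier_mat m m. A * C = 1\<^sub>m m \<and> C * A = 1\<^sub>m m"
proof -
  have "A \<in> Units (ring_mat TYPE('a) m ())" by (rule det_non_zero_imp_unit[OF A det])
  then show ?thesis by (auto simp: Units_def ring_mat_simps)
qed

lemma inverse_det_nz:
  fixes A :: "'a::field mat"
  assumes "A \<in> carrier_mat m m" "C \<in> carrier_mat m m" "A * C = 1\<^sub>m m"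
  shows "det A \<noteq> 0"
  using det_mult[OF assms(1,2)] assms(3) by auto

lemma mult_mat_zero_vec:
  fixes A :: "'a::comm_ring_1 mat"
  shows "A \<in> carrier_mat m l \<Longrightarrow> A *\<^sub>v 0\<^sub>v l = 0\<^sub>v m"
  by (intro eq_vecI) auto

lemma zero_mat_mult_vec:
  fixes v :: "'a::comm_ring_1 vec"
  shows "v \<in> carrier_vec l \<Longrightarrow> 0\<^sub>m m l *\<^sub>v v = 0\<^sub>v m"
  by (intro eq_vecI) auto

lemma zero_smult_vec:
  fixes v :: "'a::comm_ring_1 vec"
  shows "v \<in> carrier_vec l \<Longrightarrow> 0 \<cdot>\<^sub>v v = 0\<^sub>v l"
  by (intro eq_vecI) auto

lemma mat_eq_by_vec:
  fixes A :: "'a::comm_ring_1 mat"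
  assumes A: "A \<in> carrier_mat m l" "C \<in> carrier_mat m l"
    and eq: "\<And>x. x \<in> carrier_vec l \<Longrightarrow> A *\<^sub>v x = C *\<^sub>v x"
  shows "A = C"
proof (rule eq_matI)
  fix i j assume "i < dim_row C" "j < dim_col C"
  then have ij: "i < m" "j < l" using A by auto
  have "(A *\<^sub>v unit_vec l j) $ i = (C *\<^sub>v unit_vec l j) $ i" using eq by simp
  then show "A $$ (i, j) = C $$ (i, j)" using A ij by simp
qed (use A in auto)

lemma poly_mat_mult_vec:
  assumes A: "A \<in> carrier_mat m m" and u: "u \<in> carrier_vec m"
  shows "poly_mat A (p * q) *\<^sub>v u = poly_mat A p *\<^sub>v (poly_mat A q *\<^sub>v u)"
  using assms by (simp add: poly_mat_mult[OF A] assoc_mult_mat_vec[of _ m m _ m])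

lemma poly_mat_add_vec:
  assumes A: "A \<in> carrier_mat m m" and u: "u \<in> carrier_vec m"
  shows "poly_mat A (p + q) *\<^sub>v u = poly_mat A p *\<^sub>v u + poly_mat A q *\<^sub>v u"
  using assms by (simp add: poly_mat_add[OF A] add_mult_distrib_mat_vec[of _ m m])

lemma poly_mat_diff_vec:
  assumes A: "A \<in> carrier_mat m m" and u: "u \<in> carrier_vec m"
  shows "poly_mat A (p - q) *\<^sub>v u = poly_mat A p *\<^sub>v u - poly_mat A q *\<^sub>v u"
  using assms by (simp add: poly_mat_diff[OF A] minus_mult_distrib_mat_vec[of _ m m])

lemma poly_mat_smult_vec:
  assumes A: "A \<in> carrier_mat m m" and u: "u \<in> carrier_vec m"
  shows "poly_mat A (Polynomial.smult a p) *\<^sub>v u = a \<cdot>\<^sub>v (poly_mat A p *\<^sub>v u)"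
  using assms by (intro eq_vecI) (auto simp: poly_mat_smult[OF A])

lemma poly_mat_sum_vec_index:
  assumes A: "A \<in> carrier_mat m m" and u: "u \<in> carrier_vec m" and i: "i < m" and fin: "finite I"
  shows "(poly_mat A (\<Sum>j\<in>I. f j) *\<^sub>v u) $ i = (\<Sum>j\<in>I. (poly_mat A (f j) *\<^sub>v u) $ i)"
  using fin
proof (induction I rule: finite_induct)
  case empty
  then show ?case using A u i by simp
next
  case (insert j I)
  have "poly_mat A (sum f I) *\<^sub>v u \<in> carrier_vec m" "poly_mat A (f j) *\<^sub>v u \<in> carrier_vec m"
    using A u by (auto intro!: mult_mat_vec_carrier[of _ m m])
  then have "(poly_mat A (f j) *\<^sub>v u + poly_mat A (sum f I) *\<^sub>v u) $ i =
      (poly_mat A (f j) *\<^sub>v u) $ i + (poly_mat A (sum f I) *\<^sub>v u) $ i"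
    using i A by (intro index_add_vec(1)) auto
  then show ?case using insert by (simp add: poly_mat_add_vec[OF A u] del: index_mult_mat_vec)
qed

lemma poly_mat_dvd_vec:
  fixes A :: "'a::comm_ring_1 mat"
  assumes A: "A \<in> carrier_mat m m" and u: "u \<in> carrier_vec m"
    and "q dvd p" "poly_mat A q *\<^sub>v u = 0\<^sub>v m"
  shows "poly_mat A p *\<^sub>v u = 0\<^sub>v m"
proof -
  obtain r where "p = r * q" using assms(3) by (metis dvdE mult.commute)
  then show ?thesis
    using assms(4) A by (simp add: poly_mat_mult_vec[OF A u] mult_mat_zero_vec[of _ m m])
qed

definition poly_of_vec :: "'a::comm_ring_1 vec \<Rightarrow> 'a poly" where
  "poly_of_vec c = (\<Sum>j<dim_vec c. Polynomial.monom (c $ j) j)"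

lemma coeff_poly_of_vec: "Polynomial.coeff (poly_of_vec c) j = (if j < dim_vec c then c $ j else 0)"
  unfolding poly_of_vec_def coeff_sum by simp

lemma degree_poly_of_vec:
  assumes "dim_vec c > 0"
  shows "Polynomial.degree (poly_of_vec c) < dim_vec c"
  using assms by (intro degree_lessI) (auto simp: coeff_poly_of_vec)

definition krylov :: "'a::comm_ring_1 mat \<Rightarrow> 'a vec \<Rightarrow> 'a mat" where
  "krylov A u = Matrix.mat (dim_row A) (dim_row A) (\<lambda>(i, j). (poly_mat A (Polynomial.monom 1 j) *\<^sub>v u) $ i)"

lemma krylov_carrier [simp]: "A \<in> carrier_mat m m \<Longrightarrow> krylov A u \<in> carrier_mat m m"
  unfolding krylov_def by simp

lemma krylov_mult_vec:
  assumes A: "A \<in> carrier_mat m m" and u: "u \<in> carrier_vec m" and c: "c \<in> carrier_vec m"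
  shows "krylov A u *\<^sub>v c = poly_mat A (poly_of_vec c) *\<^sub>v u"
proof (rule eq_vecI)
  fix i assume "i < dim_vec (poly_mat A (poly_of_vec c) *\<^sub>v u)"
  then have i: "i < m" using A by simp
  have "(krylov A u *\<^sub>v c) $ i = (\<Sum>j<m. (poly_mat A (Polynomial.monom 1 j) *\<^sub>v u) $ i * c $ j)"
    using A c i unfolding krylov_def by (simp add: scalar_prod_def atLeast0LessThan)
  also have "\<dots> = (\<Sum>j<m. (poly_mat A (Polynomial.monom (c $ j) j) *\<^sub>v u) $ i)"
  proof (rule sum.cong[OF refl])
    fix j assume "j \<in> {..<m}"
    have "Polynomial.monom (c $ j) j = Polynomial.smult (c $ j) (Polynomial.monom 1 j)"
      by (simp add: smult_monom)
    then have "poly_mat A (Polynomial.monom (c $ j) j) *\<^sub>v u =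
        c $ j \<cdot>\<^sub>v (poly_mat A (Polynomial.monom 1 j) *\<^sub>v u)"
      by (simp only: poly_mat_smult_vec[OF A u])
    then show "(poly_mat A (Polynomial.monom 1 j) *\<^sub>v u) $ i * c $ j =
        (poly_mat A (Polynomial.monom (c $ j) j) *\<^sub>v u) $ i"
      using A i by (simp add: mult.commute)
  qed
  also have "\<dots> = (poly_mat A (poly_of_vec c) *\<^sub>v u) $ i"
    unfolding poly_of_vec_def using c by (simp only: poly_mat_sum_vec_index[OF A u i] carrier_vecD finite_lessThan)
  finally show "(krylov A u *\<^sub>v c) $ i = (poly_mat A (poly_of_vec c) *\<^sub>v u) $ i" .
qed (use A in \<open>simp add: krylov_def\<close>)

text \<open>Phrased by annihilating polynomials of small degree, the form in which it is
  established; invertibility of the Krylov matrix and the spanning property are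
  consequences.\<close>

definition cyclic_vec :: "'a::field mat \<Rightarrow> 'a vec \<Rightarrow> bool" where
  "cyclic_vec A u \<longleftrightarrow> u \<in> carrier_vec (dim_row A) \<and>
     (\<forall>p. Polynomial.degree p < dim_row A \<longrightarrow> poly_mat A p *\<^sub>v u = 0\<^sub>v (dim_row A) \<longrightarrow> p = 0)"

lemma det_krylov_nz:
  assumes A: "A \<in> carrier_mat m m" and m: "m > 0" and cyc: "cyclic_vec A u"
  shows "det (krylov A u) \<noteq> 0"
proof
  assume "det (krylov A u) = 0"
  then obtain c where c: "c \<in> carrier_vec m" "c \<noteq> 0\<^sub>v m" "krylov A u *\<^sub>v c = 0\<^sub>v m"
    using det_0_iff_vec_prod_zero[of "krylov A u" m] A by auto
  have u: "u \<in> carrier_vec m" using cyc A unfolding cyclic_vec_def by simp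
  have "poly_of_vec c = 0"
    using cyc c A degree_poly_of_vec[of c] m krylov_mult_vec[OF A u c(1)]
    unfolding cyclic_vec_def by auto
  then have "c $ j = 0" if "j < m" for j
    using coeff_poly_of_vec[of c j] c that by simp
  then show False using c by (auto simp: vec_eq_iff)
qed

text \<open>The inverse Krylov matrix provides coordinates. That they depend linearly on the vector
  matters twice: it makes an intertwining map a matrix, and it makes the coefficients attached to a
  cocharacter regular functions.\<close>

lemma cyclic_coordinates:
  assumes A: "A \<in> carrier_mat m m" and m: "m > 0" and cyc: "cyclic_vec A u"
  shows "\<exists>C\<in>carrier_mat m m. \<forall>w\<in>carrier_vec m.
    w = poly_mat A (poly_of_vec (C *\<^sub>v w)) *\<^sub>v u \<and> Polynomial.degree (poly_of_vec (C *\<^sub>v w)) < m"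
proof -
  have K: "krylov A u \<in> carrier_mat m m" using A by simp
  have u: "u \<in> carrier_vec m" using cyc A unfolding cyclic_vec_def by simp
  obtain C where C: "C \<in> carrier_mat m m" "krylov A u * C = 1\<^sub>m m"
    using det_nz_inverse[OF K det_krylov_nz[OF A m cyc]] by blast
  show ?thesis
  proof (intro bexI[of _ C] ballI conjI)
    fix w :: "'a vec" assume w: "w \<in> carrier_vec m"
    then have Cw: "C *\<^sub>v w \<in> carrier_vec m" using C by simp
    have "w = krylov A u *\<^sub>v (C *\<^sub>v w)"
      using C w K by (simp flip: assoc_mult_mat_vec[of _ m m _ m])
    then show "w = poly_mat A (poly_of_vec (C *\<^sub>v w)) *\<^sub>v u"
      using krylov_mult_vec[OF A u Cw] by simp
    show "Polynomial.degree (poly_of_vec (C *\<^sub>v w)) < m"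
      using degree_poly_of_vec[of "C *\<^sub>v w"] Cw m by (metis carrier_vecD)
  qed (rule C)
qed

lemma cyclic_span:
  assumes A: "A \<in> carrier_mat m m" and m: "m > 0" and cyc: "cyclic_vec A u" and w: "w \<in> carrier_vec m"
  obtains p where "w = poly_mat A p *\<^sub>v u" "Polynomial.degree p < m"
  using cyclic_coordinates[OF A m cyc] w by blast

text \<open>One direction is Cayley-Hamilton. In the other, the remainder modulo the characteristic
  polynomial also annihilates the vector and is too short to be nonzero.\<close>

lemma cyclic_annihilator:
  assumes A: "A \<in> carrier_mat m m" and m: "m > 0" and cyc: "cyclic_vec A u"
  shows "poly_mat A p *\<^sub>v u = 0\<^sub>v m \<longleftrightarrow> char_poly A dvd p"
proof -
  have u: "u \<in> carrier_vec m" using cyc A unfolding cyclic_vec_def by simp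
  have chi: "poly_mat A (char_poly A) *\<^sub>v u = 0\<^sub>v m" using cayley_hamilton[OF A] u by (simp add: zero_mat_mult_vec)
  have nz: "char_poly A \<noteq> 0" using degree_monic_char_poly[OF A] by auto
  show ?thesis
  proof
    assume "char_poly A dvd p"
    then show "poly_mat A p *\<^sub>v u = 0\<^sub>v m" using poly_mat_dvd_vec[OF A u _ chi] by simp
  next
    assume p: "poly_mat A p *\<^sub>v u = 0\<^sub>v m"
    define q where "q = p div char_poly A * char_poly A"
    have "char_poly A dvd q" unfolding q_def by simp
    then have "poly_mat A q *\<^sub>v u = 0\<^sub>v m" using poly_mat_dvd_vec[OF A u _ chi] by simp
    moreover have "p mod char_poly A = p - q" unfolding q_def by (simp add: minus_div_mult_eq_mod)
    ultimately have "poly_mat A (p mod char_poly A) *\<^sub>v u = 0\<^sub>v m"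
      using p by (simp add: poly_mat_diff_vec[OF A u])
    moreover have "Polynomial.degree (p mod char_poly A) < m"
      using degree_mod_less'[OF nz, of p] degree_monic_char_poly[OF A] m
      by (cases "p mod char_poly A = 0") auto
    ultimately have "p mod char_poly A = 0" using cyc A unfolding cyclic_vec_def by auto
    then show "char_poly A dvd p" by auto
  qed
qed

lemma cyclic_eqI:
  assumes A: "A \<in> carrier_mat m m" and m: "m > 0" and cyc: "cyclic_vec A u"
    and S: "S \<in> carrier_mat l m" and T: "T \<in> carrier_mat l m"
    and eq: "\<And>p. Polynomial.degree p < m \<Longrightarrow> S *\<^sub>v (poly_mat A p *\<^sub>v u) = T *\<^sub>v (poly_mat A p *\<^sub>v u)"
  shows "S = T"
  using cyclic_span[OF A m cyc] eq by (intro mat_eq_by_vec[OF S T]) metis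

text \<open>A matrix commuting with A is determined by its value on a cyclic vector, and that value
  is some q(A) u. Hence the centralizer consists of polynomials in A.\<close>

lemma commuting_eq_poly_mat:
  assumes A: "A \<in> carrier_mat m m" and m: "m > 0" and cyc: "cyclic_vec A u"
    and S: "S \<in> carrier_mat m m" and comm: "S * A = A * S" and Su: "S *\<^sub>v u = poly_mat A q *\<^sub>v u"
  shows "S = poly_mat A q"
proof (rule cyclic_eqI[OF A m cyc S])
  show "poly_mat A q \<in> carrier_mat m m" using A by simp
  fix p
  have u: "u \<in> carrier_vec m" using cyc A unfolding cyclic_vec_def by simp
  have "S *\<^sub>v (poly_mat A p *\<^sub>v u) = S * poly_mat A p *\<^sub>v u"
    using S A u by (simp add: assoc_mult_mat_vec[of _ m m _ m])
  also have "S * poly_mat A p = poly_mat A p * S"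
    using poly_mat_intertwine[OF A S A] comm by simp
  also have "\<dots> *\<^sub>v u = poly_mat A p *\<^sub>v (poly_mat A q *\<^sub>v u)"
    using S A u Su by (simp add: assoc_mult_mat_vec[of _ m m _ m])
  also have "\<dots> = poly_mat A q *\<^sub>v (poly_mat A p *\<^sub>v u)"
    using A u by (simp flip: poly_mat_mult_vec add: mult.commute)
  finally show "S *\<^sub>v (poly_mat A p *\<^sub>v u) = poly_mat A q *\<^sub>v (poly_mat A p *\<^sub>v u)" .
qed

text \<open>A common root x is an eigenvalue of A over the larger field, and p(A) kills the
  eigenvector; vanishing of the determinant descends because \<open>\<iota>\<close> is injective. It
  is applied with \<open>\<iota>\<close> the substitution pi = t^D and x =
  \<open>root\<close>.\<close>

lemma det_poly_mat_eq_0: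
  fixes A :: "'a::field mat" and \<iota> :: "'a \<Rightarrow> 'l::field"
  assumes A: "A \<in> carrier_mat m m" and "inj_comm_ring_hom \<iota>"
    and x: "poly (map_poly \<iota> (char_poly A)) x = 0" "poly (map_poly \<iota> p) x = 0"
  shows "det (poly_mat A p) = 0"
proof -
  interpret h: inj_comm_ring_hom \<iota> by fact
  have hA: "map_mat \<iota> A \<in> carrier_mat m m" using A by simp
  have "eigenvalue (map_mat \<iota> A) x"
    using x(1) by (simp add: eigenvalue_root_char_poly[OF hA] h.char_poly_hom[OF A])
  then obtain y where y: "y \<in> carrier_vec m" "y \<noteq> 0\<^sub>v m" "map_mat \<iota> A *\<^sub>v y = x \<cdot>\<^sub>v y"
    using A unfolding eigenvalue_def eigenvector_def by auto
  have "map_mat \<iota> (poly_mat A p) *\<^sub>v y = 0\<^sub>v m"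
    using poly_mat_eigenvector[OF hA y(1,3), of "map_poly \<iota> p"] x(2) y(1)
    by (simp add: h.poly_mat_hom[OF A] zero_smult_vec)
  then have "det (map_mat \<iota> (poly_mat A p)) = 0"
    using det_0_iff_vec_prod_zero[of "map_mat \<iota> (poly_mat A p)" m] y A by auto
  then show ?thesis by simp
qed

section \<open>Products of distinct Kummer polynomials\<close>

locale kummer_family =
  fixes D s r :: nat and \<beta> :: "nat \<Rightarrow> 'k::field"
  assumes kummer: "i \<in> {1..r} \<Longrightarrow> kummer D s (\<beta> i)"
    and inj: "inj_on (\<lambda>i. \<beta> i ^ D) {1..r}"
begin

definition Q :: "nat \<Rightarrow> 'k fls poly" where
  "Q i = kummer.P D s (\<beta> i)"

definition \<chi> :: "'k fls poly" where
  "\<chi> = (\<Prod>i=1..r. Q i)"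

lemma Q_eq: "i \<in> {1..r} \<Longrightarrow> Q i = Polynomial.monom 1 D - [:fls_const (\<beta> i ^ D) * fls_X ^ s:]"
  unfolding Q_def kummer.P_def[OF kummer] ..

text \<open>The difference of two distinct factors is a nonzero constant of F[mu], which no
  polynomial of degree D > 0 divides.\<close>

lemma Q_not_dvd:
  assumes "i \<in> {1..r}" "j \<in> {1..r}" "i \<noteq> j"
  shows "\<not> Q i dvd Q j"
proof
  assume "Q i dvd Q j"
  then have "Q i dvd Q j - Q i" by (simp add: dvd_diff)
  also have "Q j - Q i = [:fls_const (\<beta> i ^ D - \<beta> j ^ D) * fls_X ^ s:]"
    using assms by (simp add: Q_eq fls_minus_const[symmetric] left_diff_distrib)
  finally have dvd: "Q i dvd [:fls_const (\<beta> i ^ D - \<beta> j ^ D) * fls_X ^ s:]" .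
  have "\<beta> i ^ D \<noteq> \<beta> j ^ D" using assms inj by (auto dest: inj_onD)
  then have "fls_const (\<beta> i ^ D - \<beta> j ^ D) * fls_X ^ s \<noteq> 0" by (simp add: fls_const_nonzero)
  then have "Polynomial.degree (Q i) \<le> 0" using dvd_imp_degree_le[OF dvd] by simp
  then show False
    using kummer.degree_P[OF kummer] kummer.D_pos[OF kummer] assms unfolding Q_def by auto
qed

lemma Q_not_dvd_prod:
  assumes "i \<in> {1..r}" "J \<subseteq> {1..r}" "i \<notin> J"
  shows "\<not> Q i dvd (\<Prod>j\<in>J. Q j)"
proof -
  have "finite J" using assms(2) by (rule finite_subset) simp
  then have "Q i dvd (\<Prod>j\<in>J. Q j) \<longleftrightarrow> (\<exists>j\<in>J. Q i dvd Q j)"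
    unfolding Q_def[of i] using kummer.P_dvd_prod[OF kummer[OF assms(1)]] by blast
  then show ?thesis using assms Q_not_dvd by blast
qed

lemma prod_Q_dvd:
  assumes "J \<subseteq> {1..r}" "\<And>j. j \<in> J \<Longrightarrow> Q j dvd p"
  shows "(\<Prod>j\<in>J. Q j) dvd p"
proof -
  have "finite J" using assms(1) by (rule finite_subset) simp
  then show ?thesis using assms
  proof (induction J rule: finite_induct)
    case (insert i J)
    then obtain q where q: "p = (\<Prod>j\<in>J. Q j) * q" by (metis dvdE insert_subset insertI2)
    have i: "i \<in> {1..r}" using insert by simp
    have "Q i dvd (\<Prod>j\<in>J. Q j) * q" using insert(5)[of i] q by simp
    then have "Q i dvd q"
      using Q_not_dvd_prod[OF i, of J] insert kummer.P_dvd_mult[OF kummer[OF i]]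
      unfolding Q_def[of i] by auto
    then show ?case using insert q by (simp add: mult.commute mult_dvd_mono)
  qed simp
qed

lemma chinese_remainder:
  "\<exists>x. \<forall>i\<in>{1..r}. Q i dvd x - f i"
proof -
  have "\<exists>x. \<forall>i\<in>J. Q i dvd x - f i" if "finite J" "J \<subseteq> {1..r}" for J
    using that
  proof (induction J rule: finite_induct)
    case (insert i J)
    then obtain x where x: "\<forall>j\<in>J. Q j dvd x - f j" by auto
    have i: "i \<in> {1..r}" using insert by simp
    define R where "R = (\<Prod>j\<in>J. Q j)"
    have "\<not> Q i dvd R" using Q_not_dvd_prod[OF i] insert unfolding R_def by auto
    then obtain q where q: "Q i dvd 1 - q * R"
      using kummer.inverse_mod_P[OF kummer[OF i]] unfolding Q_def by blast
    \<comment> \<open>The correction is a multiple of R, so nothing changes modulo the earlier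
      factors, and q R is 1 modulo \<open>Q i\<close>.\<close>
    define y where "y = x + (f i - x) * (q * R)"
    have "Q i dvd y - f i"
    proof -
      have "y - f i = - ((f i - x) * (1 - q * R))" unfolding y_def by (simp add: algebra_simps)
      then show ?thesis using q by (simp add: dvd_minus_iff)
    qed
    moreover have "Q j dvd y - f j" if "j \<in> J" for j
    proof -
      have "Q j dvd R" unfolding R_def using insert that by (intro dvd_prodI) auto
      moreover have "y - f j = (x - f j) + (f i - x) * q * R" unfolding y_def by (simp add: algebra_simps)
      ultimately show ?thesis using x that by (metis dvd_add dvd_mult)
    qed
    ultimately show ?case by auto
  qed simp
  then show ?thesis by blast
qed

lemma det_poly_mat_Q:
  assumes A: "A \<in> carrier_mat m m" and chi: "char_poly A = \<chi>" and i: "i \<in> {1..r}"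
  shows "det (poly_mat A (Q i)) = 0"
proof -
  interpret kummer D s "\<beta> i" by (rule kummer[OF i])
  have "Q i dvd \<chi>" unfolding \<chi>_def using i by (intro dvd_prodI) auto
  then have "\<phi> \<chi> = 0" unfolding \<phi>_eq_0_iff Q_def .
  moreover have "\<phi> (Q i) = 0" unfolding Q_def by simp
  ultimately show ?thesis
    using det_poly_mat_eq_0[OF A cp.inj_comm_ring_hom_axioms, of root "Q i"] chi unfolding \<phi>_def by simp
qed

text \<open>Each \<open>Q i\<close> has a nonzero kernel vector, whose annihilator is generated by
  \<open>Q i\<close> because this factor is prime. For a sum of such vectors over distinct factors
  the annihilator is generated by the product, which is the characteristic polynomial and has full
  degree.\<close>

lemma cyclic_vec_exists:
  assumes A: "A \<in> carrier_mat m m" and chi: "char_poly A = \<chi>"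
  shows "\<exists>u. cyclic_vec A u"
proof -
  have "\<exists>u\<in>carrier_vec m. poly_mat A (\<Prod>j\<in>J. Q j) *\<^sub>v u = 0\<^sub>v m \<and>
      (\<forall>p. poly_mat A p *\<^sub>v u = 0\<^sub>v m \<longrightarrow> (\<forall>j\<in>J. Q j dvd p))"
    if "finite J" "J \<subseteq> {1..r}" for J
    using that
  proof (induction J rule: finite_induct)
    case empty
    show ?case using A by (intro bexI[of _ "0\<^sub>v m"]) (auto simp: mult_mat_zero_vec)
  next
    case (insert i J)
    then obtain u where u: "u \<in> carrier_vec m" and Ju: "poly_mat A (\<Prod>j\<in>J. Q j) *\<^sub>v u = 0\<^sub>v m"
      and ann: "\<And>p j. poly_mat A p *\<^sub>v u = 0\<^sub>v m \<Longrightarrow> j \<in> J \<Longrightarrow> Q j dvd p" by auto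
    have i: "i \<in> {1..r}" using insert by simp
    have "poly_mat A (Q i) \<in> carrier_mat m m" using A by simp
    then obtain w where w: "w \<in> carrier_vec m" "w \<noteq> 0\<^sub>v m" "poly_mat A (Q i) *\<^sub>v w = 0\<^sub>v m"
      using det_poly_mat_Q[OF A chi i] det_0_iff_vec_prod_zero by blast
    have wann: "Q i dvd p" if p: "poly_mat A p *\<^sub>v w = 0\<^sub>v m" for p
    proof (rule ccontr)
      assume "\<not> Q i dvd p"
      then obtain q where q: "Q i dvd 1 - q * p"
        using kummer.inverse_mod_P[OF kummer[OF i]] unfolding Q_def by blast
      have "poly_mat A (1 - q * p) *\<^sub>v w = 0\<^sub>v m" by (rule poly_mat_dvd_vec[OF A w(1) q w(3)])
      moreover have "poly_mat A (q * p) *\<^sub>v w = 0\<^sub>v m"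
        by (rule poly_mat_dvd_vec[OF A w(1) _ p]) simp
      ultimately show False using w A by (simp add: poly_mat_diff_vec[OF A w(1)])
    qed
    have add: "poly_mat A p *\<^sub>v (u + w) = poly_mat A p *\<^sub>v u + poly_mat A p *\<^sub>v w" for p
      using A u w by (simp add: mult_add_distrib_mat_vec[of _ m m])
    have cl: "poly_mat A p *\<^sub>v u \<in> carrier_vec m" "poly_mat A p *\<^sub>v w \<in> carrier_vec m" for p
      using A u w by (auto intro!: mult_mat_vec_carrier[of _ m m])
    have "poly_mat A (\<Prod>j\<in>insert i J. Q j) *\<^sub>v (u + w) = 0\<^sub>v m"
    proof -
      have "poly_mat A (\<Prod>j\<in>insert i J. Q j) *\<^sub>v u = 0\<^sub>v m"
        using insert by (intro poly_mat_dvd_vec[OF A u _ Ju]) simp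
      moreover have "poly_mat A (\<Prod>j\<in>insert i J. Q j) *\<^sub>v w = 0\<^sub>v m"
        using insert by (intro poly_mat_dvd_vec[OF A w(1) _ w(3)]) simp
      ultimately show ?thesis unfolding add by simp
    qed
    moreover have "\<forall>j\<in>insert i J. Q j dvd p" if p: "poly_mat A p *\<^sub>v (u + w) = 0\<^sub>v m" for p
    proof -
      \<comment> \<open>Multiplying by \<open>Q i\<close> removes w and leaves a relation for u
        alone.\<close>
      have "poly_mat A (Q i * p) *\<^sub>v (u + w) = 0\<^sub>v m"
        using p u w by (intro poly_mat_dvd_vec[OF A _ _ p]) auto
      moreover have "poly_mat A (Q i * p) *\<^sub>v w = 0\<^sub>v m"
        by (intro poly_mat_dvd_vec[OF A w(1) _ w(3)]) simp
      ultimately have "poly_mat A (Q i * p) *\<^sub>v u = 0\<^sub>v m"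
        using cl(1)[of "Q i * p"] by (simp add: add)
      then have "Q j dvd p" if j: "j \<in> J" for j
      proof -
        have jr: "j \<in> {1..r}" "i \<noteq> j" using insert j by auto
        have "Q j dvd Q i * p" by (rule ann[OF \<open>poly_mat A (Q i * p) *\<^sub>v u = 0\<^sub>v m\<close> j])
        then have "Q j dvd Q i \<or> Q j dvd p"
          unfolding Q_def[of j] using kummer.P_dvd_mult[OF kummer[OF jr(1)]] by blast
        then show ?thesis using Q_not_dvd[of j i] i jr by blast
      qed
      note J = this
      then have "(\<Prod>j\<in>J. Q j) dvd p" using insert by (intro prod_Q_dvd) auto
      then have "poly_mat A p *\<^sub>v u = 0\<^sub>v m" by (rule poly_mat_dvd_vec[OF A u _ Ju])
      then have "poly_mat A p *\<^sub>v w = 0\<^sub>v m" using p cl(2)[of p] by (simp add: add)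
      then show ?thesis using wann J by blast
    qed
    ultimately show ?case using u w by (intro bexI[of _ "u + w"]) auto
  qed
  then obtain u where u: "u \<in> carrier_vec m"
    and ann: "\<And>p. poly_mat A p *\<^sub>v u = 0\<^sub>v m \<Longrightarrow> \<forall>j\<in>{1..r}. Q j dvd p"
    by (metis finite_atLeastAtMost subset_refl)
  have "p = 0" if "Polynomial.degree p < m" "poly_mat A p *\<^sub>v u = 0\<^sub>v m" for p
  proof (rule ccontr)
    assume "p \<noteq> 0"
    moreover have "\<chi> dvd p" unfolding \<chi>_def using ann[OF that(2)] by (intro prod_Q_dvd) auto
    ultimately have "Polynomial.degree \<chi> \<le> Polynomial.degree p" by (rule dvd_imp_degree_le[rotated])
    then show False using that degree_monic_char_poly[OF A] chi by simp
  qed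
  then show ?thesis using u A unfolding cyclic_vec_def by auto
qed

end

section \<open>Normal vectors and conjugacy in the symplectic group\<close>

lemma coeff_neg_arg: "Polynomial.coeff (neg_arg p) j = (- 1) ^ j * Polynomial.coeff p j"
proof (induction p arbitrary: j)
  case (pCons a p)
  show ?case
    by (cases j) (simp_all add: pcompose_pCons pCons coeff_pCons)
qed simp

lemma mat_eq_by_form:
  fixes S :: "'a::comm_ring_1 mat"
  assumes S: "S \<in> carrier_mat m l" and T: "T \<in> carrier_mat m l"
    and eq: "\<And>x y. x \<in> carrier_vec m \<Longrightarrow> y \<in> carrier_vec l \<Longrightarrow> x \<bullet> (S *\<^sub>v y) = x \<bullet> (T *\<^sub>v y)"
  shows "S = T"
proof (rule mat_eq_by_vec[OF S T])
  fix y :: "'a vec" assume y: "y \<in> carrier_vec l"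
  show "S *\<^sub>v y = T *\<^sub>v y"
  proof (rule eq_vecI)
    fix i assume "i < dim_vec (T *\<^sub>v y)"
    then have i: "i < m" using T by simp
    have "unit_vec m i \<bullet> (S *\<^sub>v y) = unit_vec m i \<bullet> (T *\<^sub>v y)" using eq y by simp
    then show "(S *\<^sub>v y) $ i = (T *\<^sub>v y) $ i"
      using i S T y mult_mat_vec_carrier[OF S y] mult_mat_vec_carrier[OF T y]
      by (simp del: index_mult_mat_vec)
  qed (use S T in simp)
qed

text \<open>Replaces the inverse, which \<open>mat_inverse\<close> returns as an option, by an
  intertwining equation; all later work with \<open>Ad\<close> goes through this form.\<close>

lemma Ad_eq_iff:
  fixes g :: "'a::field mat"
  assumes g: "g \<in> carrier_mat m m" and det: "det g \<noteq> 0"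
    and N: "N \<in> carrier_mat m m" and M: "M \<in> carrier_mat m m"
  shows "M = Ad g N \<longleftrightarrow> M * g = g * N"
proof -
  obtain C where C: "mat_inverse g = Some C"
    using mat_inverse(1)[OF g, of "()"] det_non_zero_imp_unit[OF g det, of "()"] by (cases "mat_inverse g") auto
  note inv = mat_inverse(2)[OF g C]
  have Ad: "Ad g N = g * N * C" unfolding Ad_def C by simp
  show ?thesis
  proof
    assume "M = Ad g N"
    then have "M * g = g * N * (C * g)" using g N inv by (simp add: Ad assoc_mult_mat[of _ m m _ m _ m])
    then show "M * g = g * N" using inv g N by simp
  next
    assume eq: "M * g = g * N"
    have "M = M * (g * C)" using inv M by simp
    also have "\<dots> = g * N * C" using eq g M inv assoc_mult_mat[of M m m g m C m] by simp
    finally show "M = Ad g N" using Ad by simp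
  qed
qed

lemma Ad_carrier:
  fixes g :: "'a::field mat"
  assumes g: "g \<in> carrier_mat m m" and det: "det g \<noteq> 0" and N: "N \<in> carrier_mat m m"
  shows "Ad g N \<in> carrier_mat m m"
proof -
  obtain C where C: "mat_inverse g = Some C"
    using mat_inverse(1)[OF g, of "()"] det_non_zero_imp_unit[OF g det, of "()"] by (cases "mat_inverse g") auto
  then show ?thesis
    using mat_inverse(2)[OF g C] g N unfolding Ad_def by (auto intro!: mult_carrier_mat[of _ m m])
qed

text \<open>Over a general field, so that it applies both to the Gram matrix over k and to its
  extension to F. Skew-symmetry and a nonzero determinant are matrix conditions that pass to the
  extension at once.\<close>

locale symplectic =
  fixes n :: nat and B :: "'f::field mat"
  assumes n_pos: "n \<ge> 1" and B: "B \<in> carrier_mat (2 * n) (2 * n)"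
    and skew: "transpose_mat B = - B" and det_B: "det B \<noteq> 0"
begin

abbreviation form :: "'f vec \<Rightarrow> 'f vec \<Rightarrow> 'f" where
  "form v w \<equiv> v \<bullet> (B *\<^sub>v w)"

lemma dim_B [simp]: "dim_row B = 2 * n" "dim_col B = 2 * n"
  using B by auto

lemma m_pos: "2 * n > 0"
  using n_pos by simp

lemma form_skew:
  assumes "v \<in> carrier_vec (2 * n)" "w \<in> carrier_vec (2 * n)"
  shows "form v w = - form w v"
proof -
  have "form v w = (transpose_mat B *\<^sub>v v) \<bullet> w"
    using transpose_vec_mult_scalar[OF B assms(2,1)] by simp
  also have "transpose_mat B *\<^sub>v v = - (B *\<^sub>v v)" unfolding skew using assms B by simp
  also have "(- (B *\<^sub>v v)) \<bullet> w = - (w \<bullet> (B *\<^sub>v v))"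
    using assms B by (simp add: comm_scalar_prod[of w "2 * n"])
  finally show ?thesis .
qed

lemma form_nondegenerate:
  assumes z: "z \<in> carrier_vec (2 * n)" and zero: "\<And>y. y \<in> carrier_vec (2 * n) \<Longrightarrow> form z y = 0"
  shows "z = 0\<^sub>v (2 * n)"
proof (rule eq_vecI)
  obtain C where C: "C \<in> carrier_mat (2 * n) (2 * n)" "B * C = 1\<^sub>m (2 * n)"
    using det_nz_inverse[OF B det_B] by blast
  fix i assume i: "i < dim_vec (0\<^sub>v (2 * n) :: 'f vec)"
  have "B *\<^sub>v (C *\<^sub>v unit_vec (2 * n) i) = unit_vec (2 * n) i"
    using C B by (simp flip: assoc_mult_mat_vec[of _ "2 * n" "2 * n" _ "2 * n"])
  then show "z $ i = 0\<^sub>v (2 * n) $ i"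
    using zero[of "C *\<^sub>v unit_vec (2 * n) i"] C z i mult_mat_vec_carrier[OF C(1)] by simp
qed (use z in simp)

text \<open>Membership rewritten as an intertwining of the transpose of M with -M by the Gram
  matrix, the form required by \<open>poly_mat_intertwine\<close>.\<close>

lemma sp_iff:
  "M \<in> sp B \<longleftrightarrow> M \<in> carrier_mat (2 * n) (2 * n) \<and> transpose_mat M * B = B * (- M)"
proof -
  have "transpose_mat M * B + B * M = 0\<^sub>m (2 * n) (2 * n) \<longleftrightarrow> transpose_mat M * B = B * (- M)"
    if M: "M \<in> carrier_mat (2 * n) (2 * n)"
  proof -
    have "B * (- M) = - (B * M)" using M by simp
    moreover have "S + T = 0\<^sub>m (2 * n) (2 * n) \<longleftrightarrow> S = - T"
      if "S \<in> carrier_mat (2 * n) (2 * n)" "T \<in> carrier_mat (2 * n) (2 * n)" for S T :: "'f mat"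
      using that by (auto simp: mat_eq_iff eq_neg_iff_add_eq_0)
    ultimately show ?thesis using M B by simp
  qed
  then show ?thesis unfolding sp_def by auto
qed

lemma Sp_carrier: "g \<in> Sp B \<Longrightarrow> g \<in> carrier_mat (2 * n) (2 * n)"
  unfolding Sp_def by simp

lemma Sp_det:
  assumes "g \<in> Sp B"
  shows "det g \<noteq> 0"
proof
  assume "det g = 0"
  have g: "g \<in> carrier_mat (2 * n) (2 * n)" "transpose_mat g * B * g = B"
    using assms unfolding Sp_def by auto
  have "transpose_mat g * B \<in> carrier_mat (2 * n) (2 * n)" using g B by simp
  then have "det B = det (transpose_mat g * B) * det g" using g det_mult by metis
  then show False using \<open>det g = 0\<close> det_B by simp
qed

lemma poly_mat_sp:
  assumes "M \<in> sp B"
  shows "transpose_mat (poly_mat M p) * B = B * poly_mat M (neg_arg p)"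
proof -
  have M: "M \<in> carrier_mat (2 * n) (2 * n)" "transpose_mat M * B = B * (- M)"
    using assms sp_iff by auto
  show ?thesis
    unfolding poly_mat_transpose[OF M(1)] poly_mat_neg[OF M(1), symmetric]
    by (rule poly_mat_intertwine[OF _ B _ M(2)]) (use M in auto)
qed

lemma form_adjoint:
  assumes M: "M \<in> sp B" and v: "v \<in> carrier_vec (2 * n)" and w: "w \<in> carrier_vec (2 * n)"
  shows "form (poly_mat M p *\<^sub>v v) w = form v (poly_mat M (neg_arg p) *\<^sub>v w)"
proof -
  have Mc: "M \<in> carrier_mat (2 * n) (2 * n)" using M sp_iff by simp
  have C: "poly_mat M q \<in> carrier_mat (2 * n) (2 * n)" for q using Mc by simp
  have "form (poly_mat M p *\<^sub>v v) w = (transpose_mat (transpose_mat (poly_mat M p)) *\<^sub>v v) \<bullet> (B *\<^sub>v w)"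
    by simp
  also have "\<dots> = v \<bullet> (transpose_mat (poly_mat M p) *\<^sub>v (B *\<^sub>v w))"
    using C[of p] v w B by (intro transpose_vec_mult_scalar[of _ "2 * n" "2 * n"]) auto
  also have "transpose_mat (poly_mat M p) *\<^sub>v (B *\<^sub>v w) = (transpose_mat (poly_mat M p) * B) *\<^sub>v w"
    using C[of p] w B by (simp add: assoc_mult_mat_vec[of _ "2 * n" "2 * n" _ "2 * n"])
  also have "\<dots> = B *\<^sub>v (poly_mat M (neg_arg p) *\<^sub>v w)"
    unfolding poly_mat_sp[OF M] using C w B
    by (simp add: assoc_mult_mat_vec[of _ "2 * n" "2 * n" _ "2 * n"])
  finally show ?thesis .
qed

text \<open>The form of a normal vector on its Krylov basis depends only on the characteristic polynomial.\<close>

definition normal_vec :: "'f mat \<Rightarrow> 'f vec \<Rightarrow> bool" where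
  "normal_vec M v \<longleftrightarrow> v \<in> carrier_vec (2 * n) \<and>
     (\<forall>p. Polynomial.degree p < 2 * n \<longrightarrow> form v (poly_mat M p *\<^sub>v v) = Polynomial.coeff p (2 * n - 1))"

lemma normal_vec_cyclic:
  assumes M: "M \<in> sp B" and v: "normal_vec M v"
  shows "cyclic_vec M v"
proof -
  have Mc: "M \<in> carrier_mat (2 * n) (2 * n)" using M sp_iff by simp
  have vc: "v \<in> carrier_vec (2 * n)" using v unfolding normal_vec_def by simp
  have "p = 0" if p: "Polynomial.degree p < 2 * n" "poly_mat M p *\<^sub>v v = 0\<^sub>v (2 * n)" for p
  proof (rule ccontr)
    assume "p \<noteq> 0"
    \<comment> \<open>Raising the degree to exactly 2n - 1 keeps the annihilation and moves the
      leading coefficient to the place where the form detects it.\<close>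
    define q where "q = Polynomial.monom 1 (2 * n - 1 - Polynomial.degree p) * p"
    have "Polynomial.degree q = 2 * n - 1 - Polynomial.degree p + Polynomial.degree p"
      unfolding q_def using \<open>p \<noteq> 0\<close> by (subst degree_mult_eq) (auto simp: degree_monom_eq)
    then have deg: "Polynomial.degree q = 2 * n - 1" using p by simp
    have "poly_mat M q *\<^sub>v v = 0\<^sub>v (2 * n)"
      unfolding q_def by (rule poly_mat_dvd_vec[OF Mc vc _ p(2)]) simp
    then have "form v (poly_mat M q *\<^sub>v v) = 0" using vc B by (simp add: mult_mat_zero_vec[OF B])
    moreover have "form v (poly_mat M q *\<^sub>v v) = Polynomial.coeff q (2 * n - 1)"
      using v deg m_pos unfolding normal_vec_def by simp
    ultimately have "Polynomial.lead_coeff q = 0" unfolding deg by simp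
    then show False using \<open>p \<noteq> 0\<close> unfolding q_def by simp
  qed
  then show ?thesis using vc Mc unfolding cyclic_vec_def by auto
qed

lemma poly_mat_mod_char_poly:
  assumes M: "M \<in> carrier_mat (2 * n) (2 * n)"
  shows "poly_mat M (p mod char_poly M) = poly_mat M p"
    and "Polynomial.degree (p mod char_poly M) < 2 * n"
proof -
  have "poly_mat M (p mod char_poly M) = poly_mat M p - poly_mat M (p div char_poly M) * poly_mat M (char_poly M)"
    by (simp add: poly_mat_diff[OF M] poly_mat_mult[OF M] flip: minus_div_mult_eq_mod)
  also have "\<dots> = poly_mat M p"
    using M by (intro eq_matI) (auto simp: cayley_hamilton[OF M])
  finally show "poly_mat M (p mod char_poly M) = poly_mat M p" .
  have nz: "char_poly M \<noteq> 0" using degree_monic_char_poly[OF M] by auto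
  show "Polynomial.degree (p mod char_poly M) < 2 * n"
    using degree_mod_less'[OF nz, of p] degree_monic_char_poly[OF M] m_pos
    by (cases "p mod char_poly M = 0") auto
qed

lemma normal_vec_form:
  assumes M: "M \<in> sp B" and v: "normal_vec M v"
  shows "form v (poly_mat M p *\<^sub>v v) = Polynomial.coeff (p mod char_poly M) (2 * n - 1)"
proof -
  have Mc: "M \<in> carrier_mat (2 * n) (2 * n)" using M sp_iff by simp
  show ?thesis
    using v poly_mat_mod_char_poly[OF Mc, of p] unfolding normal_vec_def by metis
qed

text \<open>The map p(M) v -> p(M') v' is well defined because both vectors have the common
  characteristic polynomial as annihilator. It intertwines M with M' by construction and preserves
  the form because the values on both sides are given by the same formula.\<close>

lemma normal_vec_conjugate:
  assumes M: "M \<in> sp B" "M' \<in> sp B" and chi: "char_poly M = char_poly M'"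
    and v: "normal_vec M v" "normal_vec M' v'"
  shows "\<exists>g\<in>Sp B. M' = Ad g M"
proof -
  have Mc: "M \<in> carrier_mat (2 * n) (2 * n)" "M' \<in> carrier_mat (2 * n) (2 * n)"
    using M sp_iff by auto
  have vc: "v \<in> carrier_vec (2 * n)" "v' \<in> carrier_vec (2 * n)"
    using v unfolding normal_vec_def by auto
  note cyc = normal_vec_cyclic[OF M(1) v(1)]
  obtain C where C: "C \<in> carrier_mat (2 * n) (2 * n)"
    and Cv: "\<And>w. w \<in> carrier_vec (2 * n) \<Longrightarrow> w = poly_mat M (poly_of_vec (C *\<^sub>v w)) *\<^sub>v v"
    using cyclic_coordinates[OF Mc(1) m_pos cyc] by blast
  define g where "g = krylov M' v' * C"
  have K: "krylov M' v' \<in> carrier_mat (2 * n) (2 * n)" using Mc by simp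
  then have g: "g \<in> carrier_mat (2 * n) (2 * n)" unfolding g_def using C by simp
  have Pc: "poly_mat M p *\<^sub>v v \<in> carrier_vec (2 * n)" "poly_mat M' p *\<^sub>v v' \<in> carrier_vec (2 * n)" for p
    using Mc vc by (auto intro!: mult_mat_vec_carrier[of _ "2 * n" "2 * n"])
  have gp: "g *\<^sub>v (poly_mat M p *\<^sub>v v) = poly_mat M' p *\<^sub>v v'" for p
  proof -
    define c where "c = C *\<^sub>v (poly_mat M p *\<^sub>v v)"
    have c: "c \<in> carrier_vec (2 * n)" unfolding c_def using C Pc by simp
    have "g *\<^sub>v (poly_mat M p *\<^sub>v v) = krylov M' v' *\<^sub>v c"
      unfolding g_def c_def using K C Pc by (simp add: assoc_mult_mat_vec[of _ "2 * n" "2 * n" _ "2 * n"])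
    also have "\<dots> = poly_mat M' (poly_of_vec c) *\<^sub>v v'"
      by (rule krylov_mult_vec[OF Mc(2) vc(2) c])
    also have "\<dots> = poly_mat M' p *\<^sub>v v'"
    proof -
      have "poly_mat M (poly_of_vec c) *\<^sub>v v = poly_mat M p *\<^sub>v v"
        using Cv[OF Pc(1)] unfolding c_def by simp
      then have "poly_mat M (poly_of_vec c - p) *\<^sub>v v = 0\<^sub>v (2 * n)"
        using Pc by (simp add: poly_mat_diff_vec[OF Mc(1) vc(1)])
      then have "char_poly M' dvd poly_of_vec c - p"
        using cyclic_annihilator[OF Mc(1) m_pos cyc] chi by simp
      then have "poly_of_vec c mod char_poly M' = p mod char_poly M'"
        by (simp add: mod_eq_dvd_iff)
      then show ?thesis
        using poly_mat_mod_char_poly(1)[OF Mc(2)] by metis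
    qed
    finally show ?thesis .
  qed
  have adj: "form (poly_mat M p *\<^sub>v v) (poly_mat M q *\<^sub>v v) = form (poly_mat M' p *\<^sub>v v') (poly_mat M' q *\<^sub>v v')"
    for p q
  proof -
    have "form (poly_mat M p *\<^sub>v v) (poly_mat M q *\<^sub>v v) = form v (poly_mat M (neg_arg p * q) *\<^sub>v v)"
      using form_adjoint[OF M(1) vc(1) Pc(1)] by (simp add: poly_mat_mult_vec[OF Mc(1) vc(1)])
    moreover have "form (poly_mat M' p *\<^sub>v v') (poly_mat M' q *\<^sub>v v') = form v' (poly_mat M' (neg_arg p * q) *\<^sub>v v')"
      using form_adjoint[OF M(2) vc(2) Pc(2)] by (simp add: poly_mat_mult_vec[OF Mc(2) vc(2)])
    ultimately show ?thesis
      using normal_vec_form[OF M(1) v(1)] normal_vec_form[OF M(2) v(2)] chi by simp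
  qed
  have gB: "transpose_mat g * B * g = B"
  proof (rule mat_eq_by_form[of _ "2 * n" "2 * n"])
    fix x y :: "'f vec" assume xy: "x \<in> carrier_vec (2 * n)" "y \<in> carrier_vec (2 * n)"
    obtain p q where pq: "x = poly_mat M p *\<^sub>v v" "y = poly_mat M q *\<^sub>v v"
      using cyclic_span[OF Mc(1) m_pos cyc] xy by metis
    have "x \<bullet> ((transpose_mat g * B * g) *\<^sub>v y) = x \<bullet> (transpose_mat g *\<^sub>v (B *\<^sub>v (g *\<^sub>v y)))"
      using g B xy by (simp add: assoc_mult_mat_vec[of _ "2 * n" "2 * n" _ "2 * n"])
    also have "\<dots> = (g *\<^sub>v x) \<bullet> (B *\<^sub>v (g *\<^sub>v y))"
      using transpose_vec_mult_scalar[of "transpose_mat g" "2 * n" "2 * n" "B *\<^sub>v (g *\<^sub>v y)" x] g B xy by simp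
    also have "\<dots> = form x y" unfolding pq gp by (simp add: adj)
    finally show "x \<bullet> ((transpose_mat g * B * g) *\<^sub>v y) = x \<bullet> (B *\<^sub>v y)" .
  qed (use g B in auto)
  then have gSp: "g \<in> Sp B" unfolding Sp_def using g by simp
  have "M' * g = g * M"
  proof (rule cyclic_eqI[OF Mc(1) m_pos cyc])
    fix p
    have X: "poly_mat A ([:0, 1:] * p) *\<^sub>v x = A *\<^sub>v (poly_mat A p *\<^sub>v x)"
      if "A \<in> carrier_mat (2 * n) (2 * n)" "x \<in> carrier_vec (2 * n)" for A :: "'f mat" and x
      using poly_mat_mult_vec[OF that, of "[:0, 1:]" p] by (simp only: poly_mat_X[OF that(1)])
    have "M' * g *\<^sub>v (poly_mat M p *\<^sub>v v) = M' *\<^sub>v (poly_mat M' p *\<^sub>v v')"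
      using Mc g Pc gp by (simp add: assoc_mult_mat_vec[of _ "2 * n" "2 * n" _ "2 * n"])
    also have "\<dots> = g *\<^sub>v (M *\<^sub>v (poly_mat M p *\<^sub>v v))"
      using X[OF Mc(2) vc(2)] X[OF Mc(1) vc(1)] gp by metis
    also have "\<dots> = g * M *\<^sub>v (poly_mat M p *\<^sub>v v)"
      using Mc g Pc by (simp add: assoc_mult_mat_vec[of _ "2 * n" "2 * n" _ "2 * n"])
    finally show "M' * g *\<^sub>v (poly_mat M p *\<^sub>v v) = g * M *\<^sub>v (poly_mat M p *\<^sub>v v)" .
  qed (use Mc g in auto)
  then have "M' = Ad g M" using Ad_eq_iff[OF g Sp_det[OF gSp] Mc] by simp
  then show ?thesis using gSp by blast
qed

end

text \<open>
  A functional dual to the top coefficient is represented by \<open>c(M) u\<close> with \<open>c\<close> even modulo each factor;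
  as \<open>c\<close> is then a norm \<open>x(\<mu>) x(-\<mu>)\<close>, the vector \<open>x(M) u\<close> is normal.
\<close>

locale symplectic_kummer = symplectic n B + kummer_family D s r \<beta>
  for n and B :: "'k::alg_closed_field fls mat" and D s r :: nat and \<beta> :: "nat \<Rightarrow> 'k" +
  fixes M :: "'k fls mat"
  assumes ch: "CHAR('k) \<noteq> 2" and even_D: "Parity.even D" and M_sp: "M \<in> sp B"
    and char_poly_M: "char_poly M = \<chi>"
begin

lemma M: "M \<in> carrier_mat (2 * n) (2 * n)"
  using M_sp sp_iff by simp

lemma Q_dvd_\<chi>: "i \<in> {1..r} \<Longrightarrow> Q i dvd \<chi>"
  unfolding \<chi>_def by (intro dvd_prodI) auto

lemma \<chi>_dvd: "(\<And>i. i \<in> {1..r} \<Longrightarrow> Q i dvd p) \<Longrightarrow> \<chi> dvd p"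
  unfolding \<chi>_def by (rule prod_Q_dvd) auto

lemma neg_arg_Q: "i \<in> {1..r} \<Longrightarrow> neg_arg (Q i) = Q i"
  unfolding Q_def using kummer.P_even[OF kummer even_D] .

lemma normal_vec_exists: "\<exists>v. normal_vec M v"
proof -
  obtain u where cyc: "cyclic_vec M u" using cyclic_vec_exists[OF M char_poly_M] by blast
  have u: "u \<in> carrier_vec (2 * n)" using cyc M unfolding cyclic_vec_def by simp
  have Pc: "poly_mat M p *\<^sub>v u \<in> carrier_vec (2 * n)" for p
    using M u by (auto intro!: mult_mat_vec_carrier[of _ "2 * n" "2 * n"])
  define K where "K = krylov M u"
  have K: "K \<in> carrier_mat (2 * n) (2 * n)" "det K \<noteq> 0"
    using M det_krylov_nz[OF M m_pos cyc] unfolding K_def by auto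
  \<comment> \<open>Entry j of T w is <w, M^j u>, so the solution w of T w =
    \<open>unit_vec (2 * n) (2 * n - 1)\<close> represents the top coefficient.\<close>
  define T where "T = transpose_mat (B * K)"
  have T: "T \<in> carrier_mat (2 * n) (2 * n)" unfolding T_def using B K by simp
  have "det T \<noteq> 0"
    unfolding T_def using K det_B B
    by (subst det_transpose[of _ "2 * n"]) (auto simp: det_mult[of _ "2 * n"])
  then obtain C where C: "C \<in> carrier_mat (2 * n) (2 * n)" "T * C = 1\<^sub>m (2 * n)"
    using det_nz_inverse[OF T] by blast
  define w where "w = C *\<^sub>v unit_vec (2 * n) (2 * n - 1)"
  have w: "w \<in> carrier_vec (2 * n)" unfolding w_def using C by simp
  have Tw: "T *\<^sub>v w = unit_vec (2 * n) (2 * n - 1)"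
    unfolding w_def using C T by (simp flip: assoc_mult_mat_vec[of _ "2 * n" "2 * n" _ "2 * n"])
  have top: "form w (poly_mat M p *\<^sub>v u) = Polynomial.coeff p (2 * n - 1)"
    if deg: "Polynomial.degree p < 2 * n" for p
  proof -
    define c where "c = vec (2 * n) (Polynomial.coeff p)"
    have c: "c \<in> carrier_vec (2 * n)" unfolding c_def by simp
    have "poly_of_vec c = p"
      unfolding c_def using deg by (auto simp: poly_eq_iff coeff_poly_of_vec coeff_eq_0)
    then have "form w (poly_mat M p *\<^sub>v u) = w \<bullet> (B *\<^sub>v (K *\<^sub>v c))"
      using krylov_mult_vec[OF M u c] unfolding K_def by simp
    also have "\<dots> = w \<bullet> ((B * K) *\<^sub>v c)"
      using B K c by (simp add: assoc_mult_mat_vec[of _ "2 * n" "2 * n" _ "2 * n"])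
    also have "\<dots> = (T *\<^sub>v w) \<bullet> c"
      unfolding T_def using transpose_vec_mult_scalar[of "B * K" "2 * n" "2 * n" c w] B K c w by simp
    also have "\<dots> = Polynomial.coeff p (2 * n - 1)"
      unfolding Tw using c m_pos by (simp add: c_def)
    finally show ?thesis .
  qed
  obtain c where c: "w = poly_mat M c *\<^sub>v u" using cyclic_span[OF M m_pos cyc w] by blast
  \<comment> \<open>Two signs cancel: one from skew-symmetry of the form, one from the odd index 2n
    - 1 at which the coefficient of p(-mu) is read.\<close>
  have even_c: "poly_mat M (neg_arg c) *\<^sub>v u = w"
  proof -
    define z where "z = poly_mat M (neg_arg c) *\<^sub>v u - w"
    have z: "z \<in> carrier_vec (2 * n)" unfolding z_def using Pc w by simp
    have "form z y = 0" if y: "y \<in> carrier_vec (2 * n)" for y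
    proof -
      obtain p where p: "y = poly_mat M p *\<^sub>v u" "Polynomial.degree p < 2 * n"
        using cyclic_span[OF M m_pos cyc y] by blast
      have "form (poly_mat M (neg_arg c) *\<^sub>v u) y = form u (poly_mat M (c * p) *\<^sub>v u)"
        unfolding p using form_adjoint[OF M_sp u Pc, of "neg_arg c"]
        by (simp add: poly_mat_mult_vec[OF M u])
      also have "\<dots> = form (poly_mat M (neg_arg p) *\<^sub>v u) w"
        unfolding c using form_adjoint[OF M_sp u Pc, of "neg_arg p"]
        by (simp add: poly_mat_mult_vec[OF M u, symmetric] mult.commute)
      also have "\<dots> = - form w (poly_mat M (neg_arg p) *\<^sub>v u)"
        by (rule form_skew[OF Pc w])
      also have "\<dots> = - Polynomial.coeff (neg_arg p) (2 * n - 1)"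
        using p by (subst top) auto
      also have "\<dots> = Polynomial.coeff p (2 * n - 1)"
        using n_pos by (simp add: coeff_neg_arg)
      also have "\<dots> = form w y" unfolding p(1) using top p(2) by simp
      finally show ?thesis
        unfolding z_def using y w Pc[of "neg_arg c"] B
        by (simp add: minus_scalar_prod_distrib[of _ "2 * n"])
    qed
    then have "z = 0\<^sub>v (2 * n)" by (rule form_nondegenerate[OF z])
    then have "(poly_mat M (neg_arg c) *\<^sub>v u - w) $ i = 0" if "i < 2 * n" for i
      using that unfolding z_def by simp
    then show ?thesis using w M by (intro eq_vecI) auto
  qed
  have "poly_mat M (neg_arg c - c) *\<^sub>v u = 0\<^sub>v (2 * n)"
    using even_c c w by (simp add: poly_mat_diff_vec[OF M u])
  then have "\<chi> dvd neg_arg c - c"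
    using cyclic_annihilator[OF M m_pos cyc] char_poly_M by simp
  then have "\<exists>x. Q i dvd x * neg_arg x - c" if "i \<in> {1..r}" for i
    unfolding Q_def
    using kummer_norm[OF kummer[OF that] even_D ch] Q_dvd_\<chi>[OF that, unfolded Q_def] dvd_trans by blast
  then obtain f where f: "\<And>i. i \<in> {1..r} \<Longrightarrow> Q i dvd f i * neg_arg (f i) - c" by metis
  obtain x where x: "\<And>i. i \<in> {1..r} \<Longrightarrow> Q i dvd x - f i" using chinese_remainder[of f] by blast
  \<comment> \<open>The factors are even, so a congruence between x and f_i modulo
    \<open>Q i\<close> implies the one between x(-mu) and f_i(-mu); the separate norm equations thus
    glue to one modulo \<open>\<chi>\<close>.\<close>
  have "Q i dvd x * neg_arg x - c" if i: "i \<in> {1..r}" for i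
  proof -
    obtain q where "x - f i = Q i * q" using x[OF i] by (elim dvdE)
    then have "neg_arg x - neg_arg (f i) = Q i * neg_arg q"
      using neg_arg_Q[OF i] by (metis pcompose_diff pcompose_mult)
    then have "Q i dvd neg_arg x - neg_arg (f i)" by simp
    moreover have "x * neg_arg x - c =
      (x - f i) * neg_arg x + f i * (neg_arg x - neg_arg (f i)) + (f i * neg_arg (f i) - c)"
      by (simp add: algebra_simps)
    ultimately show ?thesis using x[OF i] f[OF i] by (metis dvd_add dvd_mult dvd_mult2)
  qed
  then have "\<chi> dvd x * neg_arg x - c" by (rule \<chi>_dvd)
  then have "poly_mat M (x * neg_arg x - c) *\<^sub>v u = 0\<^sub>v (2 * n)"
    using cyclic_annihilator[OF M m_pos cyc] char_poly_M by simp
  then have "(poly_mat M (x * neg_arg x) *\<^sub>v u - w) $ i = 0" if "i < 2 * n" for i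
    using that unfolding c by (simp add: poly_mat_diff_vec[OF M u])
  then have xw: "poly_mat M (x * neg_arg x) *\<^sub>v u = w"
    using w M by (intro eq_vecI) auto
  \<comment> \<open>Moving x across the form gives <v, p(M) v> = <w, p(M) u>, the top coefficient of
    p.\<close>
  define v where "v = poly_mat M x *\<^sub>v u"
  have v: "v \<in> carrier_vec (2 * n)" unfolding v_def by (rule Pc)
  have "form v (poly_mat M p *\<^sub>v v) = form w (poly_mat M p *\<^sub>v u)" for p
  proof -
    have "form v (poly_mat M p *\<^sub>v v) = form u (poly_mat M (neg_arg x * (p * x)) *\<^sub>v u)"
      unfolding v_def using form_adjoint[OF M_sp u Pc, of x "p * x"] by (simp add: poly_mat_mult_vec[OF M u])
    also have "\<dots> = form u (poly_mat M (neg_arg (x * neg_arg x)) *\<^sub>v (poly_mat M p *\<^sub>v u))"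
      by (simp add: pcompose_mult poly_mat_mult_vec[OF M u, symmetric] mult_ac)
    also have "\<dots> = form w (poly_mat M p *\<^sub>v u)"
      unfolding xw[symmetric] by (rule form_adjoint[OF M_sp u Pc, symmetric])
    finally show ?thesis .
  qed
  then have "normal_vec M v" unfolding normal_vec_def using v top by simp
  then show ?thesis by blast
qed

end

section \<open>Ellipticity\<close>

text \<open>
  A cocharacter of the centralizer has values \<open>p\<^sub>z(M)\<close>. The image of \<open>p\<^sub>z\<close> in each field \<open>k((t))\<close> is a
  multiplicative Laurent polynomial in \<open>z\<close>, hence a power \<open>z\<^sup>e\<close>, and \<open>e = 0\<close> since its norm is \<open>1\<close>.
\<close>

lemma (in symplectic_kummer) cocharacter_trivial:
  assumes reg: "mat_regular_on_Gm (2 * n) \<psi>"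
    and Sp: "\<And>z. z \<noteq> 0 \<Longrightarrow> \<psi> z \<in> Sp B" and comm: "\<And>z. z \<noteq> 0 \<Longrightarrow> \<psi> z * M = M * \<psi> z"
    and mult: "\<And>z w. z \<noteq> 0 \<Longrightarrow> w \<noteq> 0 \<Longrightarrow> \<psi> (z * w) = \<psi> z * \<psi> w"
    and t: "t \<noteq> 0"
  shows "\<psi> t = 1\<^sub>m (2 * n)"
proof -
  obtain u where cyc: "cyclic_vec M u" using cyclic_vec_exists[OF M char_poly_M] by blast
  have u: "u \<in> carrier_vec (2 * n)" using cyc M unfolding cyclic_vec_def by simp
  obtain C where C: "C \<in> carrier_mat (2 * n) (2 * n)"
    and coord: "\<And>w. w \<in> carrier_vec (2 * n) \<Longrightarrow> w = poly_mat M (poly_of_vec (C *\<^sub>v w)) *\<^sub>v u"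
      "\<And>w. w \<in> carrier_vec (2 * n) \<Longrightarrow> Polynomial.degree (poly_of_vec (C *\<^sub>v w)) < 2 * n"
    using cyclic_coordinates[OF M m_pos cyc] by blast
  \<comment> \<open>The coefficients of p_z are linear in the entries of \<psi>(z), hence regular in
    z.\<close>
  define p where "p z = poly_of_vec (C *\<^sub>v (\<psi> z *\<^sub>v u))" for z
  have psi_c: "\<psi> z \<in> carrier_mat (2 * n) (2 * n)" if "z \<noteq> 0" for z
    using Sp_carrier[OF Sp[OF that]] .
  have psi_u: "\<psi> z *\<^sub>v u \<in> carrier_vec (2 * n)" if "z \<noteq> 0" for z
    using mult_mat_vec_carrier[OF psi_c[OF that] u] .
  have psi: "\<psi> z = poly_mat M (p z)" if z: "z \<noteq> 0" for z
    using commuting_eq_poly_mat[OF M m_pos cyc psi_c[OF z] comm[OF z]] coord(1)[OF psi_u[OF z]]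
    unfolding p_def by blast
  have deg: "Polynomial.degree (p z) < 2 * n" if "z \<noteq> 0" for z
    unfolding p_def using coord(2)[OF psi_u[OF that]] .
  have dvdI: "\<chi> dvd q - q'" if "poly_mat M q = poly_mat M q'" for q q'
    using that cyclic_annihilator[OF M m_pos cyc, of "q - q'"] M u char_poly_M
    by (simp add: poly_mat_diff_vec[OF M u] mult_mat_vec_carrier[of _ "2 * n" "2 * n"])
  \<comment> \<open>The adjoint of p_z(M) is p_z(-M), so preservation of the form is the norm
    equation p_z(-mu) p_z = 1 modulo \<open>\<chi>\<close>.\<close>
  have norm: "\<chi> dvd neg_arg (p z) * p z - 1" if z: "z \<noteq> 0" for z
  proof (rule dvdI)
    have pc: "poly_mat M q \<in> carrier_mat (2 * n) (2 * n)" for q using M by simp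
    have "B = transpose_mat (\<psi> z) * B * \<psi> z" using Sp[OF z] unfolding Sp_def by simp
    also have "\<dots> = B * (poly_mat M (neg_arg (p z)) * poly_mat M (p z))"
      unfolding psi[OF z] poly_mat_sp[OF M_sp] by (rule assoc_mult_mat[OF B pc pc])
    also have "\<dots> = B * poly_mat M (neg_arg (p z) * p z)" by (simp add: poly_mat_mult[OF M])
    finally have eq: "B * poly_mat M (neg_arg (p z) * p z) = B" by simp
    obtain E where E: "E \<in> carrier_mat (2 * n) (2 * n)" "E * B = 1\<^sub>m (2 * n)"
      using det_nz_inverse[OF B det_B] by blast
    have "poly_mat M (neg_arg (p z) * p z) = E * B * poly_mat M (neg_arg (p z) * p z)"
      using E M by simp
    also have "\<dots> = E * (B * poly_mat M (neg_arg (p z) * p z))"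
      by (rule assoc_mult_mat[OF E(1) B pc])
    also have "\<dots> = poly_mat M 1" unfolding eq using E M by simp
    finally show "poly_mat M (neg_arg (p z) * p z) = poly_mat M 1" .
  qed
  have mult_p: "\<chi> dvd p (z * w) - p z * p w" if "z \<noteq> 0" "w \<noteq> 0" for z w
    using that psi[of z] psi[of w] psi[of "z * w"] mult[of z w] by (intro dvdI) (simp add: poly_mat_mult[OF M])
  have "regular_on_Gm (\<lambda>z. Polynomial.coeff (p z) j)" if j: "j < 2 * n" for j
  proof -
    have "Polynomial.coeff (p z) j = (\<Sum>a<2 * n. \<Sum>c<2 * n. (C $$ (j, a) * u $ c) * \<psi> z $$ (a, c))"
      if z: "z \<noteq> 0" for z
    proof -
      have "(\<psi> z *\<^sub>v u) $ a = (\<Sum>c<2 * n. \<psi> z $$ (a, c) * u $ c)" if "a < 2 * n" for a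
        using that psi_c[OF z] u by (simp add: scalar_prod_def atLeast0LessThan)
      moreover have "(C *\<^sub>v x) $ j = (\<Sum>a<2 * n. C $$ (j, a) * x $ a)"
        if "x \<in> carrier_vec (2 * n)" for x
        using that C j by (simp add: scalar_prod_def atLeast0LessThan)
      ultimately have "(C *\<^sub>v (\<psi> z *\<^sub>v u)) $ j = (\<Sum>a<2 * n. C $$ (j, a) * (\<Sum>c<2 * n. \<psi> z $$ (a, c) * u $ c))"
        using psi_u[OF z] by simp
      then show ?thesis
        unfolding p_def coeff_poly_of_vec using C j by (simp add: sum_distrib_left mult_ac)
    qed
    then have "regular_on_Gm (\<lambda>z. Polynomial.coeff (p z) j) \<longleftrightarrow>
       regular_on_Gm (\<lambda>z. \<Sum>a<2 * n. \<Sum>c<2 * n. (C $$ (j, a) * u $ c) * \<psi> z $$ (a, c))"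
      by (rule regular_on_Gm_cong)
    also have "\<dots>"
      using reg unfolding mat_regular_on_Gm_def
      by (intro regular_on_Gm_sum regular_on_Gm_mult regular_on_Gm_const) auto
    finally show ?thesis .
  qed
  then have "\<exists>S c. finite S \<and> (\<forall>z. z \<noteq> 0 \<longrightarrow> Polynomial.coeff (p z) j = (\<Sum>l\<in>S. c l * z powi l))"
    if "j < 2 * n" for j
    using that unfolding regular_on_Gm_def by blast
  then obtain S c where S: "\<And>j. j < 2 * n \<Longrightarrow> finite (S j)"
    and c: "\<And>j z. j < 2 * n \<Longrightarrow> z \<noteq> 0 \<Longrightarrow> Polynomial.coeff (p z) j = (\<Sum>l\<in>S j. c j l * z powi l)"
    by metis
  have "Q i dvd p z - 1" if i: "i \<in> {1..r}" and z: "z \<noteq> 0" for i z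
  proof -
    interpret kummer D s "\<beta> i" by (rule kummer[OF i])
    interpret rs: inj_comm_ring_hom "rescale (- 1 :: 'k)" by (rule inj_comm_ring_hom_rescale) simp
    define \<iota> where "\<iota> f = fls_compose_power f D" for f :: "'k fls"
    have \<iota>: "inj_comm_ring_hom \<iota>" unfolding \<iota>_def by (rule cp.inj_comm_ring_hom_axioms)
    interpret \<iota>: inj_comm_ring_hom \<iota> by (rule \<iota>)
    have \<phi>\<chi>: "\<phi> q = \<phi> q'" if "\<chi> dvd q - q'" for q q'
    proof -
      have "P dvd q - q'" using Q_dvd_\<chi>[OF i] that unfolding Q_def by (rule dvd_trans)
      then show ?thesis using \<phi>_eq_0_iff[of "q - q'"] by (simp add: \<phi>_diff)
    qed
    define \<theta> where "\<theta> z = \<phi> (p z)" for z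
    have nrm: "rescale (- 1) (\<theta> z) * \<theta> z = 1" if "z \<noteq> 0" for z
      using \<phi>\<chi>[OF norm[OF that]] unfolding \<theta>_def by (simp add: \<phi>_mult \<phi>_neg_arg[OF even_D])
    have \<theta>_mult: "\<theta> (z * w) = \<theta> z * \<theta> w" if "z \<noteq> 0" "w \<noteq> 0" for z w
      using \<phi>\<chi>[OF mult_p[OF that]] unfolding \<theta>_def by (simp add: \<phi>_mult)
    have fin: "finite (\<Union>j<2 * n. S j)" using S by simp
    have \<theta>_laurent: "\<theta> z = (\<Sum>l\<in>(\<Union>j<2 * n. S j). (\<Sum>j<2 * n. if l \<in> S j then \<iota> (c j l) * root ^ j else 0) * \<iota> z powi l)"
      if z: "z \<noteq> 0" for z
    proof -
      have \<iota>_inverse: "\<iota> (inverse f) = inverse (\<iota> f)" for f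
      proof (cases "f = 0")
        case False
        then have "\<iota> f * \<iota> (inverse f) = 1" by (simp flip: \<iota>.hom_mult)
        then show ?thesis by (metis inverse_unique)
      qed simp
      have powi: "\<iota> (z powi l) = \<iota> z powi l" for l
        by (cases "l \<ge> 0") (simp_all add: power_int_def \<iota>.hom_power \<iota>_inverse)
      have "p z = (\<Sum>j<2 * n. Polynomial.monom (Polynomial.coeff (p z) j) j)"
        using deg[OF z] by (intro poly_eqI) (auto simp: coeff_sum coeff_eq_0 not_less)
      then have "\<theta> z = (\<Sum>j<2 * n. \<iota> (Polynomial.coeff (p z) j) * root ^ j)"
        unfolding \<theta>_def \<iota>_def by (metis (no_types, lifting) \<phi>_monom \<phi>_sum sum.cong)
      also have "\<dots> = (\<Sum>j<2 * n. \<Sum>l\<in>S j. \<iota> (c j l) * root ^ j * \<iota> z powi l)"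
        using c[OF _ z] by (intro sum.cong refl)
          (simp add: \<iota>.hom_sum \<iota>.hom_mult powi sum_distrib_left sum_distrib_right mult_ac)
      also have "\<dots> = (\<Sum>j<2 * n. \<Sum>l\<in>(\<Union>j<2 * n. S j).
          (if l \<in> S j then \<iota> (c j l) * root ^ j else 0) * \<iota> z powi l)"
        using fin by (intro sum.cong refl sum.mono_neutral_cong_left) auto
      also have "\<dots> = (\<Sum>l\<in>(\<Union>j<2 * n. S j). \<Sum>j<2 * n.
          (if l \<in> S j then \<iota> (c j l) * root ^ j else 0) * \<iota> z powi l)"
        by (rule sum.swap)
      finally show ?thesis by (simp only: sum_distrib_right)
    qed
    have "\<theta> 1 \<noteq> 0" using nrm[of 1] by auto
    then obtain e where e: "\<And>z. z \<noteq> 0 \<Longrightarrow> \<theta> z = \<iota> z powi e"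
      using multiplicative_laurent_polynomial[OF infinite_fls \<iota> \<theta>_mult fin \<theta>_laurent] by blast
    \<comment> \<open>At z = pi the power has order D e in t. The substitution t -> -t preserves
      orders, so the norm equation gives 2 D e = 0.\<close>
    have "\<iota> fls_X = (fls_X :: 'k fls) powi int D"
      unfolding \<iota>_def fls_compose_power_X[OF D_pos] fls_X_power_int ..
    then have "\<theta> fls_X = fls_X powi (int D * e)" using e[of fls_X] by (simp only: power_int_mult fls_X_nonzero not_False_eq_True)
    then have sd: "fls_subdegree (\<theta> fls_X) = int D * e" by simp
    have "\<theta> fls_X \<noteq> 0" "rescale (- 1) (\<theta> fls_X) \<noteq> 0" using nrm[of fls_X] by auto
    then have "fls_subdegree (\<theta> fls_X) + fls_subdegree (\<theta> fls_X) = 0"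
      using nrm[of fls_X] fls_subdegree_mult[of "rescale (- 1) (\<theta> fls_X)" "\<theta> fls_X"]
      by (simp add: fls_subdegree_rescale)
    then have "e = 0" using sd D_pos by simp
    then have "\<phi> (p z - 1) = 0" using e[OF z] unfolding \<theta>_def by (simp add: \<phi>_diff)
    then show ?thesis unfolding \<phi>_eq_0_iff Q_def .
  qed
  then have "\<chi> dvd p t - 1" using t by (intro \<chi>_dvd) auto
  then have "poly_mat M (p t - 1) *\<^sub>v u = 0\<^sub>v (2 * n)"
    using cyclic_annihilator[OF M m_pos cyc] char_poly_M by simp
  then have "p t mod \<chi> = 1 mod \<chi>" using \<open>\<chi> dvd p t - 1\<close> by (simp add: mod_eq_dvd_iff)
  then have "poly_mat M (p t) = poly_mat M 1"
    using poly_mat_mod_char_poly(1)[OF M] char_poly_M by metis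
  then show ?thesis using psi[OF t] M by simp
qed

section \<open>Characteristic polynomials of elements of the symplectic Lie algebra\<close>

abbreviation sq :: "'a::comm_ring_1 poly \<Rightarrow> 'a poly" where
  "sq h \<equiv> h \<circ>\<^sub>p Polynomial.monom 1 2"

lemma coeff_sq: "Polynomial.coeff (sq h) i = (if Parity.even i then Polynomial.coeff h (i div 2) else 0)"
proof (induction h arbitrary: i)
  case (pCons a h)
  show ?case
  proof (cases "i < 2")
    case True
    then have "i = 0 \<or> i = 1" by auto
    then show ?thesis by (auto simp: pcompose_pCons coeff_monom_mult)
  next
    case False
    then obtain j where "i = Suc (Suc j)" by (metis add_2_eq_Suc le_Suc_ex not_less)
    then show ?thesis by (simp add: pcompose_pCons coeff_monom_mult pCons)
  qed
qed simp

lemma sq_inject [simp]: "sq h = sq h' \<longleftrightarrow> h = h'"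
proof
  assume eq: "sq h = sq h'"
  have "Polynomial.coeff h i = Polynomial.coeff h' i" for i
    using arg_cong[OF eq, of "\<lambda>p. Polynomial.coeff p (2 * i)"] by (simp add: coeff_sq)
  then show "h = h'" by (simp add: poly_eq_iff)
qed simp

lemma h_elt_eqI: "sq h = char_poly N \<Longrightarrow> h_elt N = h"
  unfolding h_elt_def
proof (rule the_equality)
  fix h' assume "sq h = char_poly N" "sq h' = char_poly N"
  then have "sq h' = sq h" by simp
  then show "h' = h" by (simp only: sq_inject)
qed

text \<open>Odd coefficients equal their negatives and vanish since 2 is nonzero.\<close>

lemma even_poly_is_sq:
  fixes p :: "'a::field poly"
  assumes two: "(2 :: 'a) \<noteq> 0" and even: "neg_arg p = p"
  shows "\<exists>h. sq h = p"
proof -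
  define h where "h = (\<Sum>i\<le>Polynomial.degree p. Polynomial.monom (Polynomial.coeff p (2 * i)) i)"
  have h: "Polynomial.coeff h i = Polynomial.coeff p (2 * i)" for i
    unfolding h_def coeff_sum by (simp add: coeff_eq_0)
  have "Polynomial.coeff (sq h) i = Polynomial.coeff p i" for i
  proof (cases "Parity.even i")
    case True
    then show ?thesis by (simp add: coeff_sq h)
  next
    case False
    then have "- Polynomial.coeff p i = Polynomial.coeff p i"
      using coeff_neg_arg[of p i] even by simp
    then have "2 * Polynomial.coeff p i = 0" by (metis add.right_inverse mult_2)
    then show ?thesis using False two by (simp add: coeff_sq)
  qed
  then show ?thesis by (metis poly_eqI)
qed

text \<open>Substituting a X into the characteristic matrix of a M gives a times that of M. With a =
  -1 this yields evenness on the symplectic Lie algebra, with a = l^s the weights of the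
  coefficients under an action.\<close>

lemma char_poly_smult:
  fixes M :: "'a::comm_ring_1 mat"
  assumes M: "M \<in> carrier_mat m m"
  shows "char_poly (a \<cdot>\<^sub>m M) \<circ>\<^sub>p [:0, a:] = Polynomial.smult (a ^ m) (char_poly M)"
proof -
  have "map_mat (\<lambda>p. p \<circ>\<^sub>p [:0, a:]) (char_poly_matrix (a \<cdot>\<^sub>m M)) = [:a:] \<cdot>\<^sub>m char_poly_matrix M"
    using M unfolding char_poly_matrix_def
    by (intro eq_matI) (auto simp: pcompose_add pcompose_pCons pcompose_mult pcompose_uminus)
  then have "char_poly (a \<cdot>\<^sub>m M) \<circ>\<^sub>p [:0, a:] = det ([:a:] \<cdot>\<^sub>m char_poly_matrix M)"
    unfolding char_poly_def by (simp flip: comm_ring_hom.hom_det[OF pcompose_hom.comm_ring_hom_axioms])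
  also have "\<dots> = [:a:] ^ m * char_poly M"
    using carrier_matD(2)[OF char_poly_matrix_closed[OF M]] by (simp add: char_poly_def)
  also have "[:a:] ^ m = [:a ^ m:]"
    by (simp add: poly_const_pow)
  finally show ?thesis by simp
qed

lemma char_poly_conjugate:
  fixes g :: "'a::field mat"
  assumes g: "g \<in> carrier_mat m m" and det: "det g \<noteq> 0"
    and N: "N \<in> carrier_mat m m" and M: "M \<in> carrier_mat m m" and eq: "M * g = g * N"
  shows "char_poly M = char_poly N"
proof -
  obtain C where C: "C \<in> carrier_mat m m" "g * C = 1\<^sub>m m" "C * g = 1\<^sub>m m"
    using det_nz_inverse[OF g det] by blast
  have "M * (g * C) = g * N * C" using eq g M C assoc_mult_mat[of M m m g m C m] by simp
  then have "M = g * N * C" using C M by simp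
  then have "similar_mat M N"
    using C g M N by (intro similar_matI[of _ _ g C m]) auto
  then show ?thesis by (rule char_poly_similar)
qed

context symplectic
begin

text \<open>The Gram matrix conjugates the transpose of M to -M, and transposition does not change
  the characteristic polynomial.\<close>

lemma char_poly_sp_even:
  assumes M: "M \<in> sp B"
  shows "neg_arg (char_poly M) = char_poly M"
proof -
  have Mc: "M \<in> carrier_mat (2 * n) (2 * n)" "transpose_mat M * B = B * (- M)"
    using M sp_iff by auto
  have "char_poly (transpose_mat M) = char_poly (- M)"
    by (rule char_poly_conjugate[OF B det_B]) (use Mc in auto)
  then have "char_poly (- M) = char_poly M" using Mc by simp
  moreover have "- M = - 1 \<cdot>\<^sub>m M" by auto
  ultimately show ?thesis using char_poly_smult[OF Mc(1), of "- 1"] by simp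
qed

lemma Ad_in_sp:
  assumes g: "g \<in> Sp B" and N: "N \<in> sp B"
  shows "Ad g N \<in> sp B" "char_poly (Ad g N) = char_poly N"
proof -
  have gc: "g \<in> carrier_mat (2 * n) (2 * n)" and gB: "transpose_mat g * B * g = B"
    using g unfolding Sp_def by auto
  have Nc: "N \<in> carrier_mat (2 * n) (2 * n)" and NB: "transpose_mat N * B = B * (- N)"
    using N sp_iff by auto
  define M where "M = Ad g N"
  have Mc: "M \<in> carrier_mat (2 * n) (2 * n)" unfolding M_def by (rule Ad_carrier[OF gc Sp_det[OF g] Nc])
  have Mg: "M * g = g * N" using Ad_eq_iff[OF gc Sp_det[OF g] Nc Mc] unfolding M_def by simp
  show "char_poly (Ad g N) = char_poly N"
    using char_poly_conjugate[OF gc Sp_det[OF g] Nc Mc Mg] unfolding M_def .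
  note assoc = assoc_mult_mat[of _ "2 * n" "2 * n" _ "2 * n" _ "2 * n"]
  have tg: "transpose_mat g \<in> carrier_mat (2 * n) (2 * n)" "transpose_mat M \<in> carrier_mat (2 * n) (2 * n)"
    "transpose_mat N \<in> carrier_mat (2 * n) (2 * n)" "- M \<in> carrier_mat (2 * n) (2 * n)"
    "- N \<in> carrier_mat (2 * n) (2 * n)"
    using gc Mc Nc by auto
  \<comment> \<open>The condition for M = Ad g N is verified after the congruence by g, where M g =
    g N and g preserves the form; g is cancelled afterwards.\<close>
  have "transpose_mat g * (transpose_mat M * B) * g = transpose_mat (M * g) * B * g"
    using gc Mc B tg by (simp add: transpose_mult[OF Mc gc] assoc)
  also have "\<dots> = transpose_mat N * (transpose_mat g * B * g)"
    unfolding Mg using gc Nc B tg by (simp add: transpose_mult[OF gc Nc] assoc)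
  also have "\<dots> = transpose_mat g * B * g * (- N)" unfolding gB NB ..
  also have "\<dots> = transpose_mat g * B * (- (g * N))"
    using gc Nc B tg by (simp add: assoc)
  also have "- (g * N) = - M * g" using Mg Mc gc by simp
  also have "transpose_mat g * B * (- M * g) = transpose_mat g * (B * (- M)) * g"
    using gc Mc B tg by (simp add: assoc)
  finally have eq: "transpose_mat g * (transpose_mat M * B) * g = transpose_mat g * (B * (- M)) * g" .
  obtain C where C: "C \<in> carrier_mat (2 * n) (2 * n)" "g * C = 1\<^sub>m (2 * n)"
    using det_nz_inverse[OF gc Sp_det[OF g]] by blast
  have tC: "transpose_mat C * transpose_mat g = 1\<^sub>m (2 * n)" "transpose_mat C \<in> carrier_mat (2 * n) (2 * n)"
    using C transpose_mult[OF gc C(1)] by auto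
  have cancel: "Y = transpose_mat C * (transpose_mat g * Y * g) * C"
    if Y: "Y \<in> carrier_mat (2 * n) (2 * n)" for Y
  proof -
    have "transpose_mat C * (transpose_mat g * Y * g) * C = (transpose_mat C * transpose_mat g) * Y * (g * C)"
      using C tC(2) tg gc Y by (simp add: assoc)
    then show ?thesis using C tC Y by simp
  qed
  have "transpose_mat M * B \<in> carrier_mat (2 * n) (2 * n)" "B * (- M) \<in> carrier_mat (2 * n) (2 * n)"
    using tg B by auto
  then have "transpose_mat M * B = B * (- M)" using cancel eq by metis
  then show "Ad g N \<in> sp B" using Mc sp_iff unfolding M_def by simp
qed

lemma one_in_Sp: "1\<^sub>m (2 * n) \<in> Sp B"
  unfolding Sp_def using B by simp

end

section \<open>From the bilinear form to its Gram matrix over k and over F\<close>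

lemma symplectic_of_form:
  assumes "n \<ge> 1" and form: "symplectic_form n B"
  shows "symplectic n B"
proof
  have B: "B \<in> carrier_mat (2 * n) (2 * n)" using form unfolding symplectic_form_def by simp
  have alt: "v \<bullet> (B *\<^sub>v v) = 0" if "v \<in> carrier_vec (2 * n)" for v
    using form that unfolding symplectic_form_def by simp
  show "n \<ge> 1" "B \<in> carrier_mat (2 * n) (2 * n)" by fact+
  let ?e = "unit_vec (2 * n) :: nat \<Rightarrow> 'a vec"
  have ent: "?e i \<bullet> (B *\<^sub>v ?e j) = B $$ (i, j)" if "i < 2 * n" "j < 2 * n" for i j
    using that B by simp
  have "B $$ (i, j) + B $$ (j, i) = 0" if ij: "i < 2 * n" "j < 2 * n" for i j
  proof -
    have c: "?e i \<in> carrier_vec (2 * n)" "?e j \<in> carrier_vec (2 * n)"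
      "B *\<^sub>v ?e i \<in> carrier_vec (2 * n)" "B *\<^sub>v ?e j \<in> carrier_vec (2 * n)"
      using B by (auto intro!: mult_mat_vec_carrier[of _ "2 * n" "2 * n"])
    \<comment> \<open>Polarization: alternation at e_i + e_j gives skew-symmetry of the
      entries.\<close>
    have "(?e i + ?e j) \<bullet> (B *\<^sub>v (?e i + ?e j)) =
       ?e i \<bullet> (B *\<^sub>v ?e i) + ?e i \<bullet> (B *\<^sub>v ?e j) + (?e j \<bullet> (B *\<^sub>v ?e i) + ?e j \<bullet> (B *\<^sub>v ?e j))"
      using c B by (simp add: mult_add_distrib_mat_vec[of _ "2 * n" "2 * n"]
          add_scalar_prod_distrib[of _ "2 * n"] scalar_prod_add_distrib[of _ "2 * n"])
    then show ?thesis using alt[of "?e i + ?e j"] alt[of "?e i"] alt[of "?e j"] ent ij by simp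
  qed
  then show "transpose_mat B = - B"
    using B by (intro eq_matI) (auto simp: eq_neg_iff_add_eq_0 add.commute)
  show "det B \<noteq> 0"
  proof
    assume "det B = 0"
    then have "det (transpose_mat B) = 0" using det_transpose[OF B] by simp
    then obtain v where v: "v \<in> carrier_vec (2 * n)" "v \<noteq> 0\<^sub>v (2 * n)" "transpose_mat B *\<^sub>v v = 0\<^sub>v (2 * n)"
      using det_0_iff_vec_prod_zero[of "transpose_mat B" "2 * n"] B by auto
    have "v \<bullet> (B *\<^sub>v w) = 0" if w: "w \<in> carrier_vec (2 * n)" for w
      using transpose_vec_mult_scalar[OF B w v(1)] v(3) w by simp
    then show False using form v unfolding symplectic_form_def by blast
  qed
qed

lemma symplectic_const_mat:
  assumes "symplectic n B"
  shows "symplectic n (const_mat B)"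
proof -
  interpret symplectic n B by fact
  interpret c: inj_comm_ring_hom "fls_const :: 'a \<Rightarrow> 'a fls" by (rule inj_comm_ring_hom_fls_const)
  show ?thesis
  proof
    show "transpose_mat (const_mat B) = - const_mat B"
    proof -
      have "transpose_mat (const_mat B) = const_mat (transpose_mat B)" by (simp add: map_mat_transpose)
      also have "\<dots> = - const_mat B" unfolding skew using B by (intro eq_matI) (auto simp: c.hom_uminus)
      finally show ?thesis .
    qed
  qed (use n_pos B det_B in simp_all)
qed

section \<open>Standard representatives\<close>

text \<open>Gram matrix of a symplectic basis. Indices run from 0 here and in
  \<open>std_mat\<close>, whereas \<open>standard_entry\<close> counts from 1.\<close>

definition std_form :: "nat \<Rightarrow> 'a::comm_ring_1 mat" where
  "std_form n = Matrix.mat (2 * n) (2 * n) (\<lambda>(i, j). if j = i + n then 1 else if i = j + n then - 1 else 0)"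

definition std_mat :: "nat \<Rightarrow> 'k::field fls poly \<Rightarrow> 'k fls mat" where
  "std_mat n h = Matrix.mat (2 * n) (2 * n) (\<lambda>(i, j). standard_entry n h (i + 1) (j + 1))"

lemma std_mat_carrier [simp]: "std_mat n h \<in> carrier_mat (2 * n) (2 * n)"
  unfolding std_mat_def by simp

lemma std_form_carrier [simp]: "std_form n \<in> carrier_mat (2 * n) (2 * n)"
  unfolding std_form_def by simp

lemma sum_single:
  fixes f :: "nat \<Rightarrow> 'a::comm_monoid_add"
  assumes "a < m" "\<And>k. k < m \<Longrightarrow> k \<noteq> a \<Longrightarrow> f k = 0"
  shows "(\<Sum>k<m. f k) = f a"
  using assms by (subst sum.remove[of _ a]) (auto intro!: sum.neutral)

text \<open>In n by n blocks the standard matrix has a lower shift at the upper left, a single 1 in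
  the corner of the upper right block, a diagonal block carrying the coefficients of h, and the
  negative transpose of the shift at the lower right.\<close>

lemma standard_entry_blocks:
  assumes "a < n" "c < n"
  shows "standard_entry n h (Suc a) (Suc c) = (if a = Suc c then 1 else 0)"
    and "standard_entry n h (Suc a) (Suc (n + c)) = (if a = 0 \<and> c = 0 then 1 else 0)"
    and "standard_entry n h (Suc (n + a)) (Suc c) =
      (if a = c then (- 1) ^ Suc c * Polynomial.coeff h (n - Suc c) else 0)"
    and "standard_entry n h (Suc (n + a)) (Suc (n + c)) = (if c = Suc a then - 1 else 0)"
  using assms unfolding standard_entry_def by auto

text \<open>The diagonal blocks are negative transposes of each other and the off-diagonal blocks
  are symmetric. Multiplication by \<open>std_form\<close> only permutes entries with signs, so each
  product entry is a single entry of the standard matrix up to sign.\<close>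

lemma std_mat_sp:
  "transpose_mat (std_mat n h) * std_form n + std_form n * std_mat n h = 0\<^sub>m (2 * n) (2 * n)"
proof (rule eq_matI)
  fix i j assume "i < dim_row (0\<^sub>m (2 * n) (2 * n) :: 'a fls mat)" "j < dim_col (0\<^sub>m (2 * n) (2 * n) :: 'a fls mat)"
  then have ij: "i < 2 * n" "j < 2 * n" by auto
  define A where "A = std_mat n h"
  define J where "J = (std_form n :: 'a fls mat)"
  have AC: "A \<in> carrier_mat (2 * n) (2 * n)" "J \<in> carrier_mat (2 * n) (2 * n)"
    unfolding A_def J_def by auto
  have A: "A $$ (a, c) = standard_entry n h (a + 1) (c + 1)" if "a < 2 * n" "c < 2 * n" for a c
    using that unfolding A_def std_mat_def by simp
  have J: "J $$ (a, c) = (if c = a + n then 1 else if a = c + n then - 1 else 0)" if "a < 2 * n" "c < 2 * n" for a c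
    using that unfolding J_def std_form_def by simp
  have l: "(transpose_mat A * J) $$ (i, j) = (if j < n then - A $$ (n + j, i) else A $$ (j - n, i))"
  proof -
    have "(transpose_mat A * J) $$ (i, j) = (\<Sum>k<2 * n. A $$ (k, i) * J $$ (k, j))"
      using AC ij by (simp add: scalar_prod_def atLeast0LessThan)
    also have "\<dots> = A $$ (if j < n then n + j else j - n, i) * J $$ (if j < n then n + j else j - n, j)"
      by (rule sum_single) (use ij J in auto)
    finally show ?thesis using ij J by auto
  qed
  have r: "(J * A) $$ (i, j) = (if i < n then A $$ (n + i, j) else - A $$ (i - n, j))"
  proof -
    have "(J * A) $$ (i, j) = (\<Sum>k<2 * n. J $$ (i, k) * A $$ (k, j))"
      using AC ij by (simp add: scalar_prod_def atLeast0LessThan)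
    also have "\<dots> = J $$ (i, if i < n then n + i else i - n) * A $$ (if i < n then n + i else i - n, j)"
      by (rule sum_single) (use ij J in auto)
    finally show ?thesis using ij J by auto
  qed
  have "(transpose_mat A * J) $$ (i, j) + (J * A) $$ (i, j) = 0"
  proof (cases "i < n")
    case i: True
    show ?thesis
    proof (cases "j < n")
      case True
      then show ?thesis unfolding l r using ij i by (simp add: A standard_entry_blocks)
    next
      case False
      then obtain c where "j = n + c" "c < n" using ij by (metis add_less_cancel_left le_Suc_ex mult_2 not_less)
      then show ?thesis unfolding l r using ij i by (simp add: A standard_entry_blocks)
    qed
  next
    case False
    then obtain a where i: "i = n + a" "a < n" using ij by (metis add_less_cancel_left le_Suc_ex mult_2 not_less)
    show ?thesis
    proof (cases "j < n")
      case True
      then show ?thesis unfolding l r using ij i by (simp add: A standard_entry_blocks)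
    next
      case False
      then obtain c where "j = n + c" "c < n" using ij by (metis add_less_cancel_left le_Suc_ex mult_2 not_less)
      then show ?thesis unfolding l r using ij i by (simp add: A standard_entry_blocks)
    qed
  qed
  then show "(transpose_mat (std_mat n h) * std_form n + std_form n * std_mat n h) $$ (i, j) = 0\<^sub>m (2 * n) (2 * n) $$ (i, j)"
    using AC ij unfolding A_def[symmetric] J_def[symmetric] by (simp del: index_mult_mat(1))
qed (simp_all add: std_mat_def std_form_def)

text \<open>Counted from 1 and up to signs, the matrix moves e_2n down to e_(n+1), then to e_1, then
  up to e_n; from each of e_1, ..., e_n it also sends a multiple by a coefficient of h back to the
  second half.\<close>

lemma std_mat_col:
  assumes j: "j < 2 * n" and n: "n \<ge> 1"
  shows "std_mat n h *\<^sub>v unit_vec (2 * n) j =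
    (if j < n then (if j + 1 < n then unit_vec (2 * n) (j + 1) else 0\<^sub>v (2 * n)) +
         ((- 1) ^ (j + 1) * Polynomial.coeff h (n - (j + 1))) \<cdot>\<^sub>v unit_vec (2 * n) (j + n)
     else if j = n then unit_vec (2 * n) 0 else - unit_vec (2 * n) (j - 1))"
proof (rule eq_vecI)
  fix i assume "i < dim_vec (if j < n then (if j + 1 < n then unit_vec (2 * n) (j + 1) else 0\<^sub>v (2 * n)) +
         ((- 1) ^ (j + 1) * Polynomial.coeff h (n - (j + 1))) \<cdot>\<^sub>v unit_vec (2 * n) (j + n)
     else if j = n then unit_vec (2 * n) 0 else - unit_vec (2 * n) (j - 1))"
  then have i: "i < 2 * n" by (auto split: if_splits)
  have "(std_mat n h *\<^sub>v unit_vec (2 * n) j) $ i = standard_entry n h (i + 1) (j + 1)"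
    using i j by (simp add: std_mat_def)
  then show "(std_mat n h *\<^sub>v unit_vec (2 * n) j) $ i =
    (if j < n then (if j + 1 < n then unit_vec (2 * n) (j + 1) else 0\<^sub>v (2 * n)) +
         ((- 1) ^ (j + 1) * Polynomial.coeff h (n - (j + 1))) \<cdot>\<^sub>v unit_vec (2 * n) (j + n)
     else if j = n then unit_vec (2 * n) 0 else - unit_vec (2 * n) (j - 1)) $ i"
    using i j n by (auto simp: standard_entry_def unit_vec_def)
qed (simp add: std_mat_def)

text \<open>
  The last basis vector is cyclic for the standard matrix: the basis consists of
  \<open>\<plusminus> A\<^sup>j e\<^bsub>2n\<^esub>\<close> for \<open>j < n\<close> and of \<open>\<plusminus> f\<^sub>i(A) e\<^bsub>2n\<^esub>\<close>, where \<open>f\<^sub>0 = \<mu>\<^sup>n\<close>, \<open>f\<^sub>i = \<mu> f\<^bsub>i-1\<^esub> + h\<^bsub>n-i\<^esub> \<mu>\<^bsup>n-i\<^esup>\<close> and \<open>f\<^sub>n = h(\<mu>\<^sup>2)\<close>.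
\<close>

lemma char_poly_std_mat:
  fixes h :: "'k::field fls poly"
  assumes n: "n \<ge> 1" and deg: "Polynomial.degree h = n" and monic: "Polynomial.coeff h n = 1"
  shows "char_poly (std_mat n h) = sq h"
proof -
  define A where "A = std_mat n h"
  define x :: "'k fls vec" where "x = unit_vec (2 * n) (2 * n - 1)"
  define ev where "ev p = poly_mat A p *\<^sub>v x" for p
  have A: "A \<in> carrier_mat (2 * n) (2 * n)" unfolding A_def by simp
  have x: "x \<in> carrier_vec (2 * n)" unfolding x_def by simp
  have ev: "ev p \<in> carrier_vec (2 * n)" for p
    unfolding ev_def using A x by (auto intro!: mult_mat_vec_carrier[of _ "2 * n" "2 * n"])
  have ev_step: "ev ([:0, 1:] * p) = A *\<^sub>v ev p" for p
    unfolding ev_def using poly_mat_mult_vec[OF A x, of "[:0, 1:]" p] by (simp only: poly_mat_X[OF A])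
  have ev_add: "ev (p + q) = ev p + ev q" for p q
    unfolding ev_def by (rule poly_mat_add_vec[OF A x])
  have ev_smult: "ev (Polynomial.smult c p) = c \<cdot>\<^sub>v ev p" for c p
    unfolding ev_def by (rule poly_mat_smult_vec[OF A x])
  note col = std_mat_col[OF _ n, of _ h, folded A_def]
  let ?e = "unit_vec (2 * n) :: nat \<Rightarrow> 'k fls vec"
  let ?c = "Polynomial.coeff h"
  have pow: "ev (Polynomial.monom 1 j) = (- 1) ^ j \<cdot>\<^sub>v ?e (2 * n - 1 - j)" if "j < n" for j
    using that
  proof (induction j)
    case 0
    show ?case using A x unfolding ev_def x_def by (simp add: monom_0 poly_mat_1[OF A, unfolded one_pCons])
  next
    case (Suc j)
    have "ev (Polynomial.monom 1 (Suc j)) = A *\<^sub>v ev (Polynomial.monom 1 j)"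
      using ev_step[of "Polynomial.monom 1 j"] by (simp add: monom_Suc)
    also have "\<dots> = (- 1) ^ j \<cdot>\<^sub>v (A *\<^sub>v ?e (2 * n - 1 - j))"
      using Suc by (simp add: mult_mat_smult_vec[OF A])
    also have "A *\<^sub>v ?e (2 * n - 1 - j) = - ?e (2 * n - 1 - Suc j)"
    proof -
      have "\<not> 2 * n - 1 - j < n" "2 * n - 1 - j \<noteq> n" "2 * n - 1 - j < 2 * n" using Suc(2) by auto
      then show ?thesis using col[of "2 * n - 1 - j"] by simp
    qed
    finally show ?case by auto
  qed
  have pow_n: "ev (Polynomial.monom 1 n) = (- 1) ^ (n - 1) \<cdot>\<^sub>v ?e 0"
  proof -
    obtain l where l: "n = Suc l" using n by (cases n) auto
    have "ev (Polynomial.monom 1 n) = A *\<^sub>v ev (Polynomial.monom 1 l)"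
      using ev_step[of "Polynomial.monom 1 l"] by (simp add: monom_Suc l)
    also have "\<dots> = (- 1) ^ l \<cdot>\<^sub>v (A *\<^sub>v ?e n)"
      using pow[of l] l by (simp add: mult_mat_smult_vec[OF A])
    also have "A *\<^sub>v ?e n = ?e 0" using col[of n] n by simp
    finally show ?thesis using l by simp
  qed
  \<comment> \<open>Closed form of the recursion. The natural subtraction is harmless for i <= n,
    where l <= i gives 2 l <= n + i.\<close>
  define f where "f i = (\<Sum>l\<le>i. Polynomial.monom (?c (n - l)) (n + i - 2 * l))" for i
  have f0: "f 0 = Polynomial.monom 1 n" unfolding f_def using monic by simp
  have f_Suc: "f (Suc i) = [:0, 1:] * f i + Polynomial.smult (?c (n - Suc i)) (Polynomial.monom 1 (n - Suc i))"
    if "i < n" for i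
  proof -
    have "[:0, 1:] * f i = (\<Sum>l\<le>i. Polynomial.monom (?c (n - l)) (n + Suc i - 2 * l))"
      unfolding f_def sum_distrib_left
    proof (rule sum.cong[OF refl])
      fix l assume "l \<in> {..i}"
      then have "n + Suc i - 2 * l = Suc (n + i - 2 * l)" using that by auto
      then show "[:0, 1:] * Polynomial.monom (?c (n - l)) (n + i - 2 * l) =
          Polynomial.monom (?c (n - l)) (n + Suc i - 2 * l)" by (simp add: monom_Suc)
    qed
    moreover have "n + Suc i - 2 * Suc i = n - Suc i" by simp
    ultimately show ?thesis unfolding f_def by (simp add: smult_monom)
  qed
  have f_n: "f n = sq h"
  proof -
    have "Polynomial.coeff (f n) j = Polynomial.coeff (sq h) j" for j
    proof -
      have "Polynomial.coeff (f n) j = (\<Sum>l\<le>n. if 2 * (n - l) = j then ?c (n - l) else 0)"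
        unfolding f_def coeff_sum by (intro sum.cong refl) (auto simp: diff_mult_distrib2)
      also have "\<dots> = (\<Sum>l\<le>n. if 2 * l = j then ?c l else 0)"
        by (rule sum.reindex_bij_witness[of _ "\<lambda>l. n - l" "\<lambda>l. n - l"]) auto
      also have "\<dots> = (if Parity.even j \<and> j div 2 \<le> n then ?c (j div 2) else 0)"
      proof (cases "Parity.even j")
        case True
        then obtain a where "j = 2 * a" by auto
        then show ?thesis by simp
      qed (auto intro!: sum.neutral)
      also have "\<dots> = Polynomial.coeff (sq h) j"
        unfolding coeff_sq using deg by (auto simp: coeff_eq_0)
      finally show ?thesis .
    qed
    then show ?thesis by (simp add: poly_eq_iff)
  qed
  \<comment> \<open>The component of A e_i along \<open>?e (i + n)\<close> is a multiple of A^(n - 1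
    - i) x; the monomial added in \<open>f (Suc i)\<close> is the one that cancels it.\<close>
  have step: "A *\<^sub>v ((- 1) ^ (n - 1) \<cdot>\<^sub>v ?e i) + ?c (n - Suc i) \<cdot>\<^sub>v ev (Polynomial.monom 1 (n - Suc i)) =
      (if i + 1 < n then (- 1) ^ (n - 1) \<cdot>\<^sub>v ?e (Suc i) else 0\<^sub>v (2 * n))" if i: "i < n" for i
  proof (rule eq_vecI)
    have idx: "2 * n - 1 - (n - Suc i) = i + n" using i by simp
    have sgn: "(- 1 :: 'k fls) ^ (n - 1) * (- 1) ^ (i + 1) = - ((- 1) ^ (n - Suc i))"
    proof -
      have "n - 1 + (i + 1) = n - Suc i + (2 * i + 1)" using i by simp
      then have "(- 1 :: 'k fls) ^ (n - 1) * (- 1) ^ (i + 1) = (- 1) ^ (n - Suc i) * (- 1) ^ (2 * i + 1)"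
        by (metis power_add)
      then show ?thesis by simp
    qed
    fix a assume "a < dim_vec (if i + 1 < n then (- 1) ^ (n - 1) \<cdot>\<^sub>v ?e (Suc i) else 0\<^sub>v (2 * n))"
    then have a: "a < 2 * n" by (auto split: if_splits)
    have "(A *\<^sub>v ((- 1) ^ (n - 1) \<cdot>\<^sub>v ?e i)) $ a = (- 1) ^ (n - 1) * (A *\<^sub>v ?e i) $ a"
      using A a by (simp add: mult_mat_smult_vec[OF A] del: index_mult_mat_vec)
    also have "\<dots> = (- 1) ^ (n - 1) * (if i + 1 < n then ?e (i + 1) $ a else 0) +
        ((- 1) ^ (n - 1) * (- 1) ^ (i + 1)) * ?c (n - Suc i) * ?e (i + n) $ a"
      using i a col[of i] by (simp add: algebra_simps)
    finally show "(A *\<^sub>v ((- 1) ^ (n - 1) \<cdot>\<^sub>v ?e i) + ?c (n - Suc i) \<cdot>\<^sub>v ev (Polynomial.monom 1 (n - Suc i))) $ a =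
      (if i + 1 < n then (- 1) ^ (n - 1) \<cdot>\<^sub>v ?e (Suc i) else 0\<^sub>v (2 * n)) $ a"
      using a i A pow[of "n - Suc i"] unfolding sgn idx by (simp add: algebra_simps del: index_mult_mat_vec)
  qed (use A ev in \<open>auto simp: ev_def\<close>)
  have ev_f_Suc: "ev (f (Suc i)) = A *\<^sub>v ev (f i) + ?c (n - Suc i) \<cdot>\<^sub>v ev (Polynomial.monom 1 (n - Suc i))"
    if "i < n" for i
    using f_Suc[OF that] by (simp only: ev_add ev_smult ev_step)
  have ev_f: "ev (f i) = (- 1) ^ (n - 1) \<cdot>\<^sub>v ?e i" if "i < n" for i
    using that
  proof (induction i)
    case 0
    show ?case unfolding f0 by (rule pow_n)
  next
    case (Suc i)
    then show ?case using step[of i] by (simp add: ev_f_Suc)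
  qed
  have ev_h: "ev (sq h) = 0\<^sub>v (2 * n)"
  proof -
    obtain l where l: "n = Suc l" using n by (cases n) auto
    have "ev (f (Suc l)) = 0\<^sub>v (2 * n)"
      using ev_f_Suc[of l] step[of l] ev_f[of l] l by (simp only: lessI) simp
    then show ?thesis using f_n l by simp
  qed
  have deg_f: "Polynomial.degree (f i) \<le> n + i" for i
    unfolding f_def by (rule degree_sum_le) (auto intro!: order.trans[OF degree_monom_le])
  \<comment> \<open>Each basis vector is a polynomial of degree below 2n applied to x. The
    coefficients of these polynomials form a right inverse of the Krylov matrix, so x is
    cyclic.\<close>
  have ex: "\<exists>g. Polynomial.degree g < 2 * n \<and> ev g = ?e j" if j: "j < 2 * n" for j
  proof (cases "j < n")
    case True
    have "ev (Polynomial.smult ((- 1) ^ (n - 1)) (f j)) = ?e j"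
      unfolding ev_smult ev_f[OF True] by (simp add: smult_smult_assoc flip: power_mult_distrib)
    moreover have "Polynomial.degree (Polynomial.smult ((- 1) ^ (n - 1)) (f j)) < 2 * n"
      using deg_f[of j] True by (intro le_less_trans[OF degree_smult_le]) simp
    ultimately show ?thesis by blast
  next
    case False
    define i where "i = 2 * n - 1 - j"
    have i: "i < n" "j = 2 * n - 1 - i" using False j unfolding i_def by auto
    have "ev (Polynomial.smult ((- 1) ^ i) (Polynomial.monom 1 i)) = ?e j"
      unfolding ev_smult pow[OF i(1)] i(2) by (simp add: smult_smult_assoc flip: power_mult_distrib)
    moreover have "Polynomial.degree (Polynomial.smult ((- 1) ^ i) (Polynomial.monom 1 i) :: 'k fls poly) < 2 * n"
      using i by (intro le_less_trans[OF degree_smult_le] le_less_trans[OF degree_monom_le]) simp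
    ultimately show ?thesis by blast
  qed
  then obtain g where g: "\<And>j. j < 2 * n \<Longrightarrow> Polynomial.degree (g j) < 2 * n"
    "\<And>j. j < 2 * n \<Longrightarrow> ev (g j) = ?e j" by metis
  define G where "G = Matrix.mat (2 * n) (2 * n) (\<lambda>(i, j). Polynomial.coeff (g j) i)"
  have G: "G \<in> carrier_mat (2 * n) (2 * n)" unfolding G_def by simp
  have K: "krylov A x \<in> carrier_mat (2 * n) (2 * n)" using A by simp
  have "krylov A x * G = 1\<^sub>m (2 * n)"
  proof (rule mat_col_eqI)
    fix j assume "j < dim_col (1\<^sub>m (2 * n) :: 'k fls mat)"
    then have j: "j < 2 * n" by simp
    have c: "col G j \<in> carrier_vec (2 * n)" using G by (simp add: carrier_vecI)
    have "poly_of_vec (col G j) = g j"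
      using g(1)[OF j] j unfolding G_def by (auto simp: poly_eq_iff coeff_poly_of_vec coeff_eq_0)
    then have "krylov A x *\<^sub>v col G j = ?e j"
      using krylov_mult_vec[OF A x c] g(2)[OF j] unfolding ev_def by simp
    then show "col (krylov A x * G) j = col (1\<^sub>m (2 * n)) j"
      using j by (simp only: col_mult2[OF K G] col_one)
  qed (use K G in auto)
  then have det: "det (krylov A x) \<noteq> 0" using inverse_det_nz[OF K G] by blast
  have zero: "p = 0" if p: "Polynomial.degree p < 2 * n" "ev p = 0\<^sub>v (2 * n)" for p
  proof -
    define c where "c = vec (2 * n) (Polynomial.coeff p)"
    have c: "c \<in> carrier_vec (2 * n)" unfolding c_def by simp
    have pc: "poly_of_vec c = p"
      unfolding c_def using p by (auto simp: poly_eq_iff coeff_poly_of_vec coeff_eq_0)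
    then have "krylov A x *\<^sub>v c = 0\<^sub>v (2 * n)"
      using krylov_mult_vec[OF A x c] p unfolding ev_def by simp
    then have "c = 0\<^sub>v (2 * n)" using det det_0_iff_vec_prod_zero[OF K] c by blast
    then show ?thesis using pc by (simp add: poly_of_vec_def)
  qed
  \<comment> \<open>Both polynomials are monic of degree 2n and annihilate the cyclic vector x, so
    their difference is too short to be nonzero.\<close>
  have "ev (char_poly A - sq h) = 0\<^sub>v (2 * n)"
    using ev_h cayley_hamilton[OF A] x unfolding ev_def
    by (simp add: poly_mat_diff_vec[OF A x] zero_mat_mult_vec)
  moreover have "Polynomial.degree (char_poly A - sq h) < 2 * n"
  proof (rule degree_lessI)
    show "char_poly A - sq h \<noteq> 0 \<or> 2 * n > 0" using n by simp
    show "\<forall>j\<ge>2 * n. Polynomial.coeff (char_poly A - sq h) j = 0"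
    proof (intro allI impI)
      fix j assume j: "2 * n \<le> j"
      have "Polynomial.coeff (sq h) j = (if j = 2 * n then 1 else 0)"
        using j deg monic unfolding coeff_sq by (auto intro!: coeff_eq_0)
      then show "Polynomial.coeff (char_poly A - sq h) j = 0"
        using degree_monic_char_poly[OF A] j by (auto simp: coeff_eq_0)
    qed
  qed
  ultimately have "char_poly A - sq h = 0" by (intro zero)
  then show ?thesis unfolding A_def by simp
qed

section \<open>Symplectic bases\<close>

lemma std_form_square: "std_form n * std_form n = (- 1\<^sub>m (2 * n) :: 'a::comm_ring_1 mat)"
proof (rule eq_matI)
  fix i j assume "i < dim_row (- 1\<^sub>m (2 * n) :: 'a mat)" "j < dim_col (- 1\<^sub>m (2 * n) :: 'a mat)"
  then have ij: "i < 2 * n" "j < 2 * n" by auto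
  define J where "J = (std_form n :: 'a mat)"
  have J: "J $$ (a, c) = (if c = a + n then 1 else if a = c + n then - 1 else 0)" if "a < 2 * n" "c < 2 * n" for a c
    using that unfolding J_def std_form_def by simp
  have "J \<in> carrier_mat (2 * n) (2 * n)" unfolding J_def by simp
  then have "(J * J) $$ (i, j) = (\<Sum>k<2 * n. J $$ (i, k) * J $$ (k, j))"
    using ij by (simp add: scalar_prod_def atLeast0LessThan)
  also have "\<dots> = J $$ (i, if i < n then n + i else i - n) * J $$ (if i < n then n + i else i - n, j)"
    by (rule sum_single) (use ij J in auto)
  also have "\<dots> = (if i = j then - 1 else 0)"
    using ij by (auto simp: J)
  finally show "(std_form n * std_form n) $$ (i, j) = (- 1\<^sub>m (2 * n) :: 'a mat) $$ (i, j)"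
    using ij unfolding J_def by simp
qed (simp_all add: std_form_def)

lemma det_std_form: "det (std_form n :: 'a::field mat) \<noteq> 0"
proof (rule inverse_det_nz)
  have "(std_form n * - std_form n :: 'a mat) = - (std_form n * std_form n)"
    by (subst uminus_mult_right_mat) (simp_all add: std_form_def)
  then show "std_form n * - std_form n = (1\<^sub>m (2 * n) :: 'a mat)" by (simp add: std_form_square)
qed simp_all

context symplectic
begin

lemma gram_index:
  assumes S: "S \<in> carrier_mat (2 * n) (2 * n)" and ij: "i < 2 * n" "j < 2 * n"
  shows "(transpose_mat S * B * S) $$ (i, j) = form (col S i) (col S j)"
proof -
  have "transpose_mat S * B * S = transpose_mat S * (B * S)"
    using S B by (intro assoc_mult_mat[of _ "2 * n" "2 * n" _ "2 * n" _ "2 * n"]) auto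
  moreover have "(transpose_mat S * (B * S)) $$ (i, j) = row (transpose_mat S) i \<bullet> col (B * S) j"
    using S B ij by (intro index_mult_mat(1)) auto
  ultimately show ?thesis using S B ij by (simp only: col_mult2[OF B S] row_transpose carrier_matD)
qed

lemma det_of_gram:
  assumes S: "S \<in> carrier_mat (2 * n) (2 * n)" and gram: "transpose_mat S * B * S = std_form n"
  shows "det S \<noteq> 0"
proof
  assume "det S = 0"
  have "transpose_mat S * B \<in> carrier_mat (2 * n) (2 * n)" using S B by simp
  then have "det (std_form n :: 'f mat) = det (transpose_mat S * B) * det S"
    using S gram det_mult by metis
  then show False using \<open>det S = 0\<close> det_std_form[of n, where 'a = 'f] by simp
qed

lemma form_add_smult:
  assumes "w \<in> carrier_vec (2 * n)" "z \<in> carrier_vec (2 * n)" "x \<in> carrier_vec (2 * n)" "y \<in> carrier_vec (2 * n)"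
  shows "form w (z + (a \<cdot>\<^sub>v x + c \<cdot>\<^sub>v y)) = form w z + (a * form w x + c * form w y)"
proof -
  have cl: "B *\<^sub>v v \<in> carrier_vec (2 * n)" if "v \<in> carrier_vec (2 * n)" for v
    using that B by simp
  have "B *\<^sub>v (z + (a \<cdot>\<^sub>v x + c \<cdot>\<^sub>v y)) = B *\<^sub>v z + (a \<cdot>\<^sub>v (B *\<^sub>v x) + c \<cdot>\<^sub>v (B *\<^sub>v y))"
    using assms by (simp add: mult_add_distrib_mat_vec[OF B] mult_mat_smult_vec[OF B])
  then show ?thesis
    using assms cl by (simp add: scalar_prod_add_distrib[of _ "2 * n"])
qed

section \<open>Hyperbolic pairs and the existence of a symplectic basis\<close>

definition hyperbolic :: "nat \<Rightarrow> (nat \<Rightarrow> 'f vec) \<Rightarrow> (nat \<Rightarrow> 'f vec) \<Rightarrow> bool" where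
  "hyperbolic q e f \<longleftrightarrow> (\<forall>i. e i \<in> carrier_vec (2 * n) \<and> f i \<in> carrier_vec (2 * n)) \<and>
     (\<forall>i<q. \<forall>j<q. form (e i) (f j) = (if i = j then 1 else 0) \<and>
        form (e i) (e j) = 0 \<and> form (f i) (f j) = 0)"

text \<open>A count of equations in matrix form: the 2q conditions are padded with zero rows to a
  square matrix R. Its row of index 2q vanishes as q < n, so R B is singular.\<close>

lemma hyperbolic_orthogonal_vec:
  assumes hyp: "hyperbolic q e f" and q: "q < n"
  shows "\<exists>y\<in>carrier_vec (2 * n). y \<noteq> 0\<^sub>v (2 * n) \<and> (\<forall>i<q. form (e i) y = 0 \<and> form (f i) y = 0)"
proof -
  have ef: "e i \<in> carrier_vec (2 * n)" "f i \<in> carrier_vec (2 * n)" for i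
    using hyp unfolding hyperbolic_def by auto
  define g where "g i = (if i < q then e i else if i < 2 * q then f (i - q) else 0\<^sub>v (2 * n))" for i
  have g: "g i \<in> carrier_vec (2 * n)" for i unfolding g_def using ef by simp
  define R where "R = mat\<^sub>r (2 * n) (2 * n) g"
  have R: "R \<in> carrier_mat (2 * n) (2 * n)" unfolding R_def by simp
  have row: "row R i = g i" if "i < 2 * n" for i
    unfolding R_def using that g by simp
  have "transpose_mat R *\<^sub>v unit_vec (2 * n) (2 * q) = 0\<^sub>v (2 * n)"
  proof (rule eq_vecI)
    fix i assume "i < dim_vec (0\<^sub>v (2 * n) :: 'f vec)"
    then have i: "i < 2 * n" by simp
    have "(transpose_mat R *\<^sub>v unit_vec (2 * n) (2 * q)) $ i = R $$ (2 * q, i)"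
      using i q R by simp
    also have "\<dots> = row R (2 * q) $ i" using R i q by simp
    also have "\<dots> = 0" using row[of "2 * q"] q i unfolding g_def by simp
    finally show "(transpose_mat R *\<^sub>v unit_vec (2 * n) (2 * q)) $ i = 0\<^sub>v (2 * n) $ i" using i by simp
  qed (use R in simp)
  moreover have "unit_vec (2 * n) (2 * q) \<noteq> (0\<^sub>v (2 * n) :: 'f vec)" using q by simp
  ultimately have "\<exists>v. v \<in> carrier_vec (2 * n) \<and> v \<noteq> 0\<^sub>v (2 * n) \<and> transpose_mat R *\<^sub>v v = 0\<^sub>v (2 * n)"
    by (intro exI[of _ "unit_vec (2 * n) (2 * q)"] conjI) simp_all
  then have "det (transpose_mat R) = 0"
    using det_0_iff_vec_prod_zero[of "transpose_mat R" "2 * n"] R by simp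
  then have "det (R * B) = 0" using det_transpose[OF R] det_mult[OF R B] by simp
  then obtain y where y: "y \<in> carrier_vec (2 * n)" "y \<noteq> 0\<^sub>v (2 * n)" "R * B *\<^sub>v y = 0\<^sub>v (2 * n)"
    using det_0_iff_vec_prod_zero[of "R * B" "2 * n"] R B by auto
  have "R *\<^sub>v (B *\<^sub>v y) = 0\<^sub>v (2 * n)" using assoc_mult_mat_vec[OF R B y(1)] y(3) by simp
  then have gy: "form (g i) y = 0" if "i < 2 * n" for i
  proof -
    have "(R *\<^sub>v (B *\<^sub>v y)) $ i = 0"
      using that \<open>R *\<^sub>v (B *\<^sub>v y) = 0\<^sub>v (2 * n)\<close> by simp
    then show ?thesis using that row R by simp
  qed
  have "form (e i) y = 0 \<and> form (f i) y = 0" if "i < q" for i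
    using gy[of i] gy[of "q + i"] that q unfolding g_def by simp
  then show ?thesis using y by blast
qed

lemma hyperbolic_extend:
  assumes two: "(2 :: 'f) \<noteq> 0" and hyp: "hyperbolic q e f" and q: "q < n"
  shows "\<exists>e' f'. hyperbolic (Suc q) e' f'"
proof -
  have ef: "e i \<in> carrier_vec (2 * n)" "f i \<in> carrier_vec (2 * n)" for i
    using hyp unfolding hyperbolic_def by auto
  have hy: "\<And>i j. i < q \<Longrightarrow> j < q \<Longrightarrow> form (e i) (f j) = (if i = j then 1 else 0) \<and>
        form (e i) (e j) = 0 \<and> form (f i) (f j) = 0"
    using hyp unfolding hyperbolic_def by auto
  have hy': "form (f i) (e j) = (if i = j then - 1 else 0)" if "i < q" "j < q" for i j
    using form_skew[OF ef(2) ef(1)] hy[OF that(2,1)] by auto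
  obtain y where y: "y \<in> carrier_vec (2 * n)" "y \<noteq> 0\<^sub>v (2 * n)"
    and ey: "\<And>i. i < q \<Longrightarrow> form (e i) y = 0 \<and> form (f i) y = 0"
    using hyperbolic_orthogonal_vec[OF hyp q] by blast
  have ye: "form y (e i) = 0 \<and> form y (f i) = 0" if "i < q" for i
    using form_skew[OF y(1) ef(1)] form_skew[OF y(1) ef(2)] ey[OF that] by simp
  \<comment> \<open>Gram-Schmidt for hyperbolic pairs: any partner of y, scaled to <y, z> = 1, is
    corrected against one pair at a time.\<close>
  have "\<exists>z\<in>carrier_vec (2 * n). form y z = 1 \<and> (\<forall>i<l. form (e i) z = 0 \<and> form (f i) z = 0)"
    if "l \<le> q" for l
    using that
  proof (induction l)
    case 0
    obtain w where w: "w \<in> carrier_vec (2 * n)" "form y w \<noteq> 0"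
      using form_nondegenerate[OF y(1)] y(2) by blast
    have "form y (inverse (form y w) \<cdot>\<^sub>v w) = 1"
      using w y B by (simp add: mult_mat_smult_vec[OF B])
    then show ?case using w by (intro bexI[of _ "inverse (form y w) \<cdot>\<^sub>v w"]) auto
  next
    case (Suc l)
    then obtain z where z: "z \<in> carrier_vec (2 * n)" "form y z = 1"
      and ez: "\<And>i. i < l \<Longrightarrow> form (e i) z = 0 \<and> form (f i) z = 0" by auto
    \<comment> \<open>Among the added terms, e_l pairs only with f_l, and f_l only with e_l, there
      with value -1. As y is orthogonal to both, <y, z'> stays 1.\<close>
    define z' where "z' = z + (form (f l) z \<cdot>\<^sub>v e l + (- form (e l) z) \<cdot>\<^sub>v f l)"
    have "form (e i) z' = 0 \<and> form (f i) z' = 0" if "i < Suc l" for i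
      using that Suc(2) ez[of i] hy[of i l] hy[of l l] hy'[of i l] z ef
      unfolding z'_def by (cases "i = l") (simp_all add: form_add_smult)
    moreover have "form y z' = 1"
      unfolding z'_def using z ef y ye[of l] Suc(2) by (simp add: form_add_smult)
    moreover have "z' \<in> carrier_vec (2 * n)" unfolding z'_def using z ef by simp
    ultimately show ?case by blast
  qed
  then obtain z where z: "z \<in> carrier_vec (2 * n)" "form y z = 1"
    and ez: "\<And>i. i < q \<Longrightarrow> form (e i) z = 0 \<and> form (f i) z = 0" by blast
  have alt: "form v v = 0" if "v \<in> carrier_vec (2 * n)" for v
  proof -
    have "2 * form v v = 0" using form_skew[OF that that] by (metis add.right_inverse mult_2)
    then show ?thesis using two by simp
  qed
  have ze: "form z (e i) = 0 \<and> form z (f i) = 0" if "i < q" for i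
    using form_skew[OF z(1) ef(1)] form_skew[OF z(1) ef(2)] ez[OF that] by simp
  have "hyperbolic (Suc q) (e(q := y)) (f(q := z))"
    unfolding hyperbolic_def using ef y z hy ey ye ez ze alt by (auto simp: less_Suc_eq)
  then show ?thesis by blast
qed

text \<open>The given form is arbitrary; an auxiliary symplectic basis allows the standard matrix to
  be transported into its Lie algebra.\<close>

lemma darboux:
  assumes two: "(2 :: 'f) \<noteq> 0"
  shows "\<exists>S\<in>carrier_mat (2 * n) (2 * n). transpose_mat S * B * S = std_form n"
proof -
  have "\<exists>e f. hyperbolic q e f" if "q \<le> n" for q
    using that
  proof (induction q)
    case 0
    have "hyperbolic 0 (\<lambda>_. 0\<^sub>v (2 * n)) (\<lambda>_. 0\<^sub>v (2 * n))" unfolding hyperbolic_def by simp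
    then show ?case by blast
  next
    case (Suc q)
    then show ?case using hyperbolic_extend[OF two] by (metis Suc_leD Suc_le_lessD)
  qed
  then obtain e f where hyp: "hyperbolic n e f" by blast
  have ef: "e i \<in> carrier_vec (2 * n)" "f i \<in> carrier_vec (2 * n)" for i
    using hyp unfolding hyperbolic_def by auto
  have hy: "\<And>i j. i < n \<Longrightarrow> j < n \<Longrightarrow> form (e i) (f j) = (if i = j then 1 else 0) \<and>
        form (e i) (e j) = 0 \<and> form (f i) (f j) = 0"
    using hyp unfolding hyperbolic_def by auto
  have fe: "form (f i) (e j) = (if i = j then - 1 else 0)" if "i < n" "j < n" for i j
    using form_skew[OF ef(2) ef(1)] hy[OF that(2,1)] by auto
  define c where "c j = (if j < n then e j else f (j - n))" for j
  have c: "c j \<in> carrier_vec (2 * n)" for j unfolding c_def using ef by simp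
  define S where "S = Matrix.mat (2 * n) (2 * n) (\<lambda>(i, j). c j $ i)"
  have S: "S \<in> carrier_mat (2 * n) (2 * n)" unfolding S_def by simp
  have col: "col S j = c j" if "j < 2 * n" for j
    using that carrier_vecD[OF c] unfolding S_def by (intro eq_vecI) auto
  have "transpose_mat S * B * S = std_form n"
  proof (rule eq_matI)
    fix i j assume "i < dim_row (std_form n :: 'f mat)" "j < dim_col (std_form n :: 'f mat)"
    then have ij: "i < 2 * n" "j < 2 * n" by (auto simp: std_form_def)
    have "(transpose_mat S * B * S) $$ (i, j) = form (c i) (c j)"
      using gram_index[OF S ij] col ij by simp
    also have "\<dots> = (if j = i + n then 1 else if i = j + n then - 1 else 0)"
      using ij hy[of i "j - n"] hy[of i j] hy[of "i - n" "j - n"] fe[of "i - n" j]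
      unfolding c_def by (cases "i < n"; cases "j < n") auto
    finally show "(transpose_mat S * B * S) $$ (i, j) = std_form n $$ (i, j)"
      using ij by (simp add: std_form_def)
  qed (use S in \<open>auto simp: std_form_def\<close>)
  then show ?thesis using S by blast
qed

end

lemma congruence_cancel:
  fixes S :: "'a::field mat"
  assumes S: "S \<in> carrier_mat m m" "det S \<noteq> 0" and Y: "Y \<in> carrier_mat m m"
    and zero: "transpose_mat S * Y * S = 0\<^sub>m m m"
  shows "Y = 0\<^sub>m m m"
proof -
  obtain C where C: "C \<in> carrier_mat m m" "S * C = 1\<^sub>m m"
    using det_nz_inverse[OF S] by blast
  have tS: "transpose_mat S \<in> carrier_mat m m" "transpose_mat C \<in> carrier_mat m m" using S C by auto
  have tC: "transpose_mat C * transpose_mat S = 1\<^sub>m m"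
    using C transpose_mult[OF S(1) C(1)] by simp
  have "transpose_mat C * (transpose_mat S * Y * S) * C = (transpose_mat C * transpose_mat S) * Y * (S * C)"
    using C tS S Y by (simp add: assoc_mult_mat[of _ m m _ m _ m])
  also have "\<dots> = Y" using C tC Y by simp
  finally show ?thesis using zero C tS by simp
qed

section \<open>Integrality of the standard element and nilpotency modulo pi\<close>

lemma inj_comm_ring_hom_fps_to_fls: "inj_comm_ring_hom (fps_to_fls :: 'a::field fps \<Rightarrow> _)"
  by unfold_locales (auto simp: fps_to_fls_plus fls_times_fps_to_fls)

lemma comm_ring_hom_fps_nth_0: "comm_ring_hom (\<lambda>f :: 'a::field fps. fps_nth f 0)"
  by unfold_locales auto

lemma comm_ring_hom_fps_const: "comm_ring_hom (fps_const :: 'a::field \<Rightarrow> _)"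
  by unfold_locales auto

lemma special_h_degree:
  assumes "n \<ge> 1" and sp: "special_h n r d s b h"
  shows "Polynomial.degree h = n" "Polynomial.coeff h n = 1"
proof -
  have d: "d > 0" and rd: "r * d = n" using assms unfolding special_h_def by (auto intro: Nat.gr0I)
  have deg: "Polynomial.degree (Polynomial.monom 1 d - [:c:]) = d"
    and lc: "Polynomial.coeff (Polynomial.monom 1 d - [:c:]) d = 1" for c :: "'a fls"
  proof -
    show lc: "Polynomial.coeff (Polynomial.monom 1 d - [:c:]) d = 1"
      using d by (simp add: coeff_pCons split: nat.split)
    have "Polynomial.degree (Polynomial.monom 1 d - [:c:]) \<le> d"
      by (intro degree_diff_le) (auto simp: degree_monom_eq)
    moreover have "d \<le> Polynomial.degree (Polynomial.monom 1 d - [:c:])"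
      by (rule le_degree) (simp only: lc one_neq_zero not_False_eq_True)
    ultimately show "Polynomial.degree (Polynomial.monom 1 d - [:c:]) = d" by simp
  qed
  have nz: "Polynomial.monom 1 d - [:c:] \<noteq> 0" for c :: "'a fls" using deg[of c] d by auto
  have h: "h = (\<Prod>i=1..r. Polynomial.monom 1 d - [:fls_const (b i) * fls_X ^ s:])"
    using sp unfolding special_h_def by simp
  show dh: "Polynomial.degree h = n"
    unfolding h using nz rd by (subst degree_prod_eq_sum_degree) (simp_all add: deg)
  have "Polynomial.lead_coeff h = 1"
    unfolding h lead_coeff_prod deg by (intro prod.neutral ballI) (rule lc)
  then show "Polynomial.coeff h n = 1" unfolding dh .
qed

text \<open>Since s > 0, all constants b_i pi^s vanish at pi = 0, so h reduces to mu^n; the entries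
  of the standard matrix that involve h then reduce to 0.\<close>

lemma special_h_integral:
  assumes "n \<ge> 1" and sp: "special_h n r d s b h"
  shows "\<exists>g. h = map_poly fps_to_fls g \<and> map_poly (\<lambda>f. fps_nth f 0) g = Polynomial.monom 1 n"
proof -
  have rd: "r * d = n" and s: "s > 0"
    and h: "h = (\<Prod>i=1..r. Polynomial.monom 1 d - [:fls_const (b i) * fls_X ^ s:])"
    using sp unfolding special_h_def by auto
  interpret t: inj_comm_ring_hom "fps_to_fls :: 'a fps \<Rightarrow> _" by (rule inj_comm_ring_hom_fps_to_fls)
  interpret z: comm_ring_hom "\<lambda>f :: 'a fps. fps_nth f 0" by (rule comm_ring_hom_fps_nth_0)
  interpret tp: map_poly_comm_ring_hom "fps_to_fls :: 'a fps \<Rightarrow> _" ..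
  interpret zp: map_poly_comm_ring_hom "\<lambda>f :: 'a fps. fps_nth f 0" ..
  define g where "g = (\<Prod>i=1..r. Polynomial.monom 1 d - [:fps_const (b i) * fps_X ^ s:])"
  have "map_poly fps_to_fls g = h"
    unfolding g_def h tp.hom_prod
    by (intro prod.cong refl) (simp add: tp.hom_minus map_poly_monom t.map_poly_pCons_hom
        fls_times_fps_to_fls fps_to_fls_power)
  moreover have "map_poly (\<lambda>f. fps_nth f 0) g = (\<Prod>i=1..r. Polynomial.monom 1 d)"
    unfolding g_def zp.hom_prod
    using s by (intro prod.cong refl) (simp add: zp.hom_minus map_poly_monom z.map_poly_pCons_hom)
  then have "map_poly (\<lambda>f. fps_nth f 0) g = Polynomial.monom 1 n"
    using rd by (simp add: monom_power mult.commute)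
  ultimately show ?thesis by metis
qed

text \<open>Nonzero entries raise the weight by exactly one, so a nonzero entry of the m-th power
  would raise it by m, while all weights lie below m.\<close>

lemma nilpotent_by_weights:
  fixes A :: "'a::comm_ring_1 mat" and w :: "nat \<Rightarrow> nat"
  assumes A: "A \<in> carrier_mat m m"
    and step: "\<And>i j. i < m \<Longrightarrow> j < m \<Longrightarrow> A $$ (i, j) \<noteq> 0 \<Longrightarrow> w i = Suc (w j)"
    and bound: "\<And>i. i < m \<Longrightarrow> w i < m"
  shows "A ^\<^sub>m m = 0\<^sub>m m m"
proof -
  have pow: "w i = w j + l" if "i < m" "j < m" "(A ^\<^sub>m l) $$ (i, j) \<noteq> 0" for l i j
    using that
  proof (induction l arbitrary: j)
    case 0
    then show ?case using A by (auto split: if_splits)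
  next
    case (Suc l)
    have Al: "A ^\<^sub>m l \<in> carrier_mat m m" using A by simp
    then have "(A ^\<^sub>m Suc l) $$ (i, j) = (\<Sum>a<m. (A ^\<^sub>m l) $$ (i, a) * A $$ (a, j))"
      using A Suc(2,3) by (simp add: scalar_prod_def atLeast0LessThan)
    then have "(\<Sum>a<m. (A ^\<^sub>m l) $$ (i, a) * A $$ (a, j)) \<noteq> 0" using Suc(4) by simp
    then obtain a where a: "a < m" "(A ^\<^sub>m l) $$ (i, a) * A $$ (a, j) \<noteq> 0"
      by (rule sum.not_neutral_contains_not_neutral) auto
    then have "(A ^\<^sub>m l) $$ (i, a) \<noteq> 0" "A $$ (a, j) \<noteq> 0" by auto
    then have "w i = w a + l" "w a = Suc (w j)"
      using Suc.IH[OF Suc(2) a(1)] step[OF a(1) Suc(3)] by auto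
    then show ?case by simp
  qed
  show ?thesis
  proof (rule eq_matI)
    fix i j assume "i < dim_row (0\<^sub>m m m :: 'a mat)" "j < dim_col (0\<^sub>m m m :: 'a mat)"
    then show "(A ^\<^sub>m m) $$ (i, j) = 0\<^sub>m m m $$ (i, j)"
      using pow[of i j m] bound[of i] by auto
  qed (use A in auto)
qed

lemma std_mat_integral:
  assumes n: "n \<ge> 1" and g: "h = map_poly fps_to_fls g" "map_poly (\<lambda>f. fps_nth f 0) g = Polynomial.monom 1 n"
  shows "\<exists>A\<in>carrier_mat (2 * n) (2 * n). map_mat fps_to_fls A = std_mat n h \<and>
    map_mat (\<lambda>f. fps_nth f 0) A ^\<^sub>m (2 * n) = 0\<^sub>m (2 * n) (2 * n)"
proof -
  interpret z: comm_ring_hom "\<lambda>f :: 'a fps. fps_nth f 0" by (rule comm_ring_hom_fps_nth_0)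
  interpret t: inj_comm_ring_hom "fps_to_fls :: 'a fps \<Rightarrow> _" by (rule inj_comm_ring_hom_fps_to_fls)
  \<comment> \<open>Position, counted from 0, in the chain e_2n, ..., e_(n+1), e_1, ..., e_n along
    which the reduced standard matrix moves the basis.\<close>
  define w where "w i = (if i < n then n + i else 2 * n - 1 - i)" for i
  have coeff: "Polynomial.coeff h l = fps_to_fls (Polynomial.coeff g l)" for l
    unfolding g(1) by (simp add: coeff_map_poly)
  have c0: "fps_nth (Polynomial.coeff g l) 0 = 0" if "l < n" for l
    using arg_cong[OF g(2), of "\<lambda>p. Polynomial.coeff p l"] that by (simp add: coeff_map_poly)
  define en where "en i j = (if i < n then if j < n then if i = Suc j then 1 else 0
        else if i = 0 \<and> j = n then 1 else 0
      else if j < n then if i = n + j then (- 1) ^ Suc j * Polynomial.coeff g (n - Suc j) else 0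
        else if j = Suc i then - 1 else 0)" for i j
  have en: "standard_entry n h (Suc i) (Suc j) = fps_to_fls (en i j)" if ij: "i < 2 * n" "j < 2 * n" for i j
  proof -
    have m1: "fps_to_fls ((- 1) ^ l * f) = (- 1) ^ l * fps_to_fls f" for l and f :: "'a fps"
      by (simp add: t.hom_mult t.hom_power t.hom_uminus)
    have split: "i < n \<or> (\<exists>a<n. i = n + a)" if "i < 2 * n" for i
      using that by (metis add_less_cancel_left le_Suc_ex mult_2 not_less)
    show ?thesis
      using split[OF ij(1)] split[OF ij(2)]
      by (elim disjE exE conjE)
        (simp_all add: standard_entry_blocks en_def coeff m1 t.hom_uminus del: power_Suc)
  qed
  have en0: "w i = Suc (w j)" if "i < 2 * n" "j < 2 * n" "fps_nth (en i j) 0 \<noteq> 0" for i j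
  proof -
    have "fps_nth ((- 1) ^ l * f) 0 = 0" if "fps_nth f 0 = 0" for l and f :: "'a fps"
      using that by simp
    then show ?thesis using that c0 n unfolding en_def w_def by (auto split: if_splits)
  qed
  define A where "A = Matrix.mat (2 * n) (2 * n) (\<lambda>(i, j). en i j)"
  have A: "A \<in> carrier_mat (2 * n) (2 * n)" unfolding A_def by simp
  have "map_mat fps_to_fls A = std_mat n h"
    unfolding A_def std_mat_def by (intro eq_matI) (auto simp: en)
  moreover have "map_mat (\<lambda>f. fps_nth f 0) A ^\<^sub>m (2 * n) = 0\<^sub>m (2 * n) (2 * n)"
    by (rule nilpotent_by_weights[where w = w]) (use n en0 in \<open>auto simp: A_def w_def\<close>)
  ultimately show ?thesis using A by blast
qed

context symplectic
begin

lemma const_gram: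
  assumes S: "S \<in> carrier_mat (2 * n) (2 * n)" "transpose_mat S * B * S = std_form n"
  shows "transpose_mat (const_mat S) * const_mat B * const_mat S = std_form n"
proof -
  interpret c: inj_comm_ring_hom "fls_const :: 'f \<Rightarrow> 'f fls" by (rule inj_comm_ring_hom_fls_const)
  have tS: "transpose_mat S \<in> carrier_mat (2 * n) (2 * n)" using S by simp
  have "transpose_mat (const_mat S) * const_mat B * const_mat S = const_mat (transpose_mat S * B * S)"
  proof -
    have TB: "transpose_mat S * B \<in> carrier_mat (2 * n) (2 * n)" using tS B by simp
    show ?thesis
      unfolding map_mat_transpose c.mat_hom_mult[OF TB S(1)] c.mat_hom_mult[OF tS B] ..
  qed
  also have "\<dots> = std_form n"
    unfolding S(2) std_form_def by (intro eq_matI) (auto simp: c.hom_uminus)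
  finally show ?thesis .
qed

lemma standard_element:
  assumes S: "S \<in> carrier_mat (2 * n) (2 * n)" "transpose_mat S * B * S = std_form n"
    and N: "N \<in> carrier_mat (2 * n) (2 * n)" "N * const_mat S = const_mat S * std_mat n h"
  shows "N \<in> sp (const_mat B)"
    and "Polynomial.degree h = n \<Longrightarrow> Polynomial.coeff h n = 1 \<Longrightarrow> char_poly N = sq h"
proof -
  define T where "T = const_mat S"
  define E where "E = const_mat B"
  define A where "A = std_mat n h"
  have T: "T \<in> carrier_mat (2 * n) (2 * n)" "det T \<noteq> 0"
  proof -
    interpret c: inj_comm_ring_hom "fls_const :: 'f \<Rightarrow> 'f fls" by (rule inj_comm_ring_hom_fls_const)
    show "T \<in> carrier_mat (2 * n) (2 * n)" "det T \<noteq> 0"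
      using S det_of_gram[OF S] unfolding T_def by auto
  qed
  have E: "E \<in> carrier_mat (2 * n) (2 * n)" unfolding E_def using B by simp
  have A: "A \<in> carrier_mat (2 * n) (2 * n)" unfolding A_def by simp
  have NT: "N * T = T * A" using N unfolding T_def A_def by simp
  have gram: "transpose_mat T * E * T = std_form n" unfolding T_def E_def by (rule const_gram[OF S])
  have tr: "transpose_mat T \<in> carrier_mat (2 * n) (2 * n)" "transpose_mat N \<in> carrier_mat (2 * n) (2 * n)"
    "transpose_mat A \<in> carrier_mat (2 * n) (2 * n)" using T N A by auto
  note assoc = assoc_mult_mat[of _ "2 * n" "2 * n" _ "2 * n" _ "2 * n"]
  have "transpose_mat T * (transpose_mat N * E + E * N) * T =
      transpose_mat (N * T) * E * T + transpose_mat T * E * (N * T)"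
    using T E N tr by (simp add: transpose_mult[OF N(1) T(1)] assoc
        mult_add_distrib_mat[of _ "2 * n" "2 * n" _ "2 * n"] add_mult_distrib_mat[of _ "2 * n" "2 * n" _ _ "2 * n"])
  also have "\<dots> = transpose_mat A * (transpose_mat T * E * T) + transpose_mat T * E * T * A"
    unfolding NT using T E A tr by (simp add: transpose_mult[OF T(1) A] assoc)
  also have "\<dots> = 0\<^sub>m (2 * n) (2 * n)" unfolding gram A_def by (rule std_mat_sp)
  finally have zero: "transpose_mat T * (transpose_mat N * E + E * N) * T = 0\<^sub>m (2 * n) (2 * n)" .
  have "transpose_mat N * E + E * N \<in> carrier_mat (2 * n) (2 * n)"
    using E N tr by simp
  then have "transpose_mat N * E + E * N = 0\<^sub>m (2 * n) (2 * n)"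
    using zero by (rule congruence_cancel[OF T])
  then show "N \<in> sp (const_mat B)" using N B unfolding sp_def E_def by auto
  assume "Polynomial.degree h = n" "Polynomial.coeff h n = 1"
  then show "char_poly N = sq h"
    using char_poly_conjugate[OF T A N(1) NT] char_poly_std_mat[OF n_pos] unfolding A_def by simp
qed

text \<open>The basis matrix has entries in k, so conjugation by it preserves integrality and
  commutes with reduction modulo pi; nilpotency is then that of the reduced standard matrix.\<close>

lemma standard_element_nil:
  assumes S: "S \<in> carrier_mat (2 * n) (2 * n)" "transpose_mat S * B * S = std_form n"
    and N: "N \<in> carrier_mat (2 * n) (2 * n)" "N * const_mat S = const_mat S * std_mat n h"
    and h: "special_h n r d s b h"
  shows "\<exists>N' \<in> sp (map_mat fps_const B). map_mat fps_to_fls N' = N \<and>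
    map_mat (\<lambda>f. fps_nth f 0) N' ^\<^sub>m (2 * n) = 0\<^sub>m (2 * n) (2 * n)"
proof -
  interpret c: inj_comm_ring_hom "fls_const :: 'f \<Rightarrow> 'f fls" by (rule inj_comm_ring_hom_fls_const)
  interpret pc: comm_ring_hom "fps_const :: 'f \<Rightarrow> 'f fps" by (rule comm_ring_hom_fps_const)
  interpret z: comm_ring_hom "\<lambda>f :: 'f fps. fps_nth f 0" by (rule comm_ring_hom_fps_nth_0)
  interpret t: inj_comm_ring_hom "fps_to_fls :: 'f fps \<Rightarrow> _" by (rule inj_comm_ring_hom_fps_to_fls)
  obtain g where "h = map_poly fps_to_fls g" "map_poly (\<lambda>f. fps_nth f 0) g = Polynomial.monom 1 n"
    using special_h_integral[OF n_pos h] by blast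
  then obtain A where A: "A \<in> carrier_mat (2 * n) (2 * n)" "map_mat fps_to_fls A = std_mat n h"
    "map_mat (\<lambda>f. fps_nth f 0) A ^\<^sub>m (2 * n) = 0\<^sub>m (2 * n) (2 * n)"
    using std_mat_integral[OF n_pos] by blast
  obtain C where C: "C \<in> carrier_mat (2 * n) (2 * n)" "S * C = 1\<^sub>m (2 * n)" "C * S = 1\<^sub>m (2 * n)"
    using det_nz_inverse[OF S(1) det_of_gram[OF S]] by blast
  define N' where "N' = map_mat fps_const S * A * map_mat fps_const C"
  have N': "N' \<in> carrier_mat (2 * n) (2 * n)" unfolding N'_def using S A C by simp
  have tf: "map_mat fps_to_fls (map_mat fps_const Y) = const_mat Y" for Y :: "'f mat"
    by (intro eq_matI) auto
  have zf: "map_mat (\<lambda>f. fps_nth f 0) (map_mat fps_const Y) = Y" for Y :: "'f mat"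
    by (intro eq_matI) auto
  have car: "map_mat fps_const S \<in> carrier_mat (2 * n) (2 * n)" "map_mat fps_const C \<in> carrier_mat (2 * n) (2 * n)"
    "map_mat fps_const S * A \<in> carrier_mat (2 * n) (2 * n)"
    using S A C by auto
  have "map_mat fps_to_fls N' = const_mat S * std_mat n h * const_mat C"
    unfolding N'_def t.mat_hom_mult[OF car(3,2)] t.mat_hom_mult[OF car(1) A(1)] tf A(2) ..
  also have "\<dots> = N * (const_mat S * const_mat C)"
    using N S C by (simp flip: N(2) add: assoc_mult_mat[of _ "2 * n" "2 * n" _ "2 * n" _ "2 * n"])
  also have "const_mat S * const_mat C = 1\<^sub>m (2 * n)"
    using S C by (simp flip: c.mat_hom_mult add: c.mat_hom_one)
  finally have N'N: "map_mat fps_to_fls N' = N" using N by simp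
  have "map_mat (\<lambda>f. fps_nth f 0) N' = S * map_mat (\<lambda>f. fps_nth f 0) A * C"
    unfolding N'_def z.mat_hom_mult[OF car(3,2)] z.mat_hom_mult[OF car(1) A(1)] zf ..
  then have "similar_mat_wit (map_mat (\<lambda>f. fps_nth f 0) N') (map_mat (\<lambda>f. fps_nth f 0) A) S C"
    using S C A N' by (intro similar_mat_witI[of _ _ "2 * n"]) auto
  then have "map_mat (\<lambda>f. fps_nth f 0) N' ^\<^sub>m (2 * n) = S * map_mat (\<lambda>f. fps_nth f 0) A ^\<^sub>m (2 * n) * C"
    by (rule similar_mat_wit_pow_id)
  then have nilp: "map_mat (\<lambda>f. fps_nth f 0) N' ^\<^sub>m (2 * n) = 0\<^sub>m (2 * n) (2 * n)"
    using S C A by simp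
  define Bf where "Bf = map_mat fps_const B"
  have Bf: "Bf \<in> carrier_mat (2 * n) (2 * n)" "map_mat fps_to_fls Bf = const_mat B"
    unfolding Bf_def using B by (auto simp: tf)
  have tN': "transpose_mat N' \<in> carrier_mat (2 * n) (2 * n)" using N' by simp
  \<comment> \<open>Membership in the Lie algebra over A follows from that over F, as
    \<open>fps_to_fls\<close> is injective.\<close>
  have "map_mat fps_to_fls (transpose_mat N' * Bf + Bf * N') =
      map_mat fps_to_fls (transpose_mat N' * Bf) + map_mat fps_to_fls (Bf * N')"
    using N' tN' Bf by (intro eq_matI) (auto simp: t.hom_add simp del: index_mult_mat(1))
  also have "\<dots> = transpose_mat N * const_mat B + const_mat B * N"
    using N' tN' Bf N'N
    by (simp add: t.mat_hom_mult[of _ "2 * n" "2 * n" _ "2 * n"] map_mat_transpose[symmetric])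
  also have "\<dots> = 0\<^sub>m (2 * n) (2 * n)"
    using standard_element(1)[OF S N] B unfolding sp_def by simp
  also have "\<dots> = map_mat fps_to_fls (0\<^sub>m (2 * n) (2 * n))" by (intro eq_matI) auto
  finally have "transpose_mat N' * Bf + Bf * N' = 0\<^sub>m (2 * n) (2 * n)" by (rule t.mat_hom_inj)
  then have "N' \<in> sp Bf" unfolding sp_def using N' Bf by auto
  then show ?thesis using N'N nilp unfolding Bf_def by blast
qed

lemma standard_element_exists:
  assumes S: "S \<in> carrier_mat (2 * n) (2 * n)" "transpose_mat S * B * S = std_form n"
  shows "\<exists>N\<in>carrier_mat (2 * n) (2 * n). N * const_mat S = const_mat S * std_mat n h"
proof -
  interpret c: inj_comm_ring_hom "fls_const :: 'f \<Rightarrow> 'f fls" by (rule inj_comm_ring_hom_fls_const)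
  have T: "const_mat S \<in> carrier_mat (2 * n) (2 * n)" "det (const_mat S) \<noteq> 0"
    using S det_of_gram[OF S] by auto
  obtain C where C: "C \<in> carrier_mat (2 * n) (2 * n)" "C * const_mat S = 1\<^sub>m (2 * n)"
    using det_nz_inverse[OF T] by blast
  have car: "const_mat S * std_mat n h \<in> carrier_mat (2 * n) (2 * n)" using T by simp
  have "const_mat S * std_mat n h * C * const_mat S = const_mat S * std_mat n h * (C * const_mat S)"
    using T C by (intro assoc_mult_mat[of _ "2 * n" "2 * n" _ "2 * n" _ "2 * n"]) auto
  then show ?thesis
    using C car mult_carrier_mat[OF car C(1)]
    by (intro bexI[of _ "const_mat S * std_mat n h * C"]) (simp_all add: right_mult_one_mat[of _ "2 * n" "2 * n"])
qed

end

section \<open>Classes with special characteristic polynomial\<close>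

lemma pderiv_multiple_root:
  fixes p q :: "'a::idom poly"
  assumes "poly p x = 0"
  shows "poly (pderiv (p * (p * q))) x = 0"
  using assms by (simp add: pderiv_mult)

text \<open>Nonvanishing of the derivative at the roots can be read off linear factors as well as a
  product of binomials mu^d - c, so it translates between regular semisimplicity and the conditions
  on d and the b_i.\<close>

lemma distinct_factors_separable:
  fixes y :: "nat \<Rightarrow> 'a::idom"
  assumes fin: "finite I" and inj: "inj_on y I" and root: "poly (\<Prod>i\<in>I. [:- y i, 1:]) x = 0"
  shows "poly (pderiv (\<Prod>i\<in>I. [:- y i, 1:])) x \<noteq> 0"
proof -
  obtain i where i: "i \<in> I" "x = y i" using root fin by (auto simp: poly_prod)
  have "(\<Prod>i\<in>I. [:- y i, 1:]) = [:- y i, 1:] * (\<Prod>j\<in>I - {i}. [:- y j, 1:])"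
    using fin i by (simp add: prod.remove)
  then have "poly (pderiv (\<Prod>i\<in>I. [:- y i, 1:])) x = (\<Prod>j\<in>I - {i}. x - y j)"
    using i(2) by (simp only: pderiv_mult) (simp add: poly_prod pderiv_pCons)
  moreover have "x - y j \<noteq> 0" if "j \<in> I - {i}" for j
    using that i inj by (auto dest: inj_onD)
  ultimately show ?thesis using fin by simp
qed

lemma separable_factors_distinct:
  fixes y :: "nat \<Rightarrow> 'a::idom"
  assumes fin: "finite I"
    and sep: "\<And>x. poly (\<Prod>i\<in>I. [:- y i, 1:]) x = 0 \<Longrightarrow> poly (pderiv (\<Prod>i\<in>I. [:- y i, 1:])) x \<noteq> 0"
  shows "inj_on y I"
proof (rule inj_onI, rule ccontr)
  fix i j assume ij: "i \<in> I" "j \<in> I" "y i = y j" "i \<noteq> j"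
  have "(\<Prod>i\<in>I. [:- y i, 1:]) = [:- y i, 1:] * ([:- y i, 1:] * (\<Prod>l\<in>I - {i} - {j}. [:- y l, 1:]))"
    using fin ij by (simp add: prod.remove[of I i] prod.remove[of "I - {i}" j] del: mult_pCons_left)
  then show False
    using sep[of "y i"] pderiv_multiple_root[of "[:- y i, 1:]" "y i"] by (simp del: mult_pCons_left)
qed

text \<open>For d > 0 the condition means that d is nonzero in k. The second alternative records
  that in characteristic 0 the exponent is 1, which is coprime to d = 0 as well.\<close>

lemma char_exponent_coprime_iff:
  "coprime (char_exponent TYPE('k)) d \<longleftrightarrow> of_nat d \<noteq> (0 :: 'k::field) \<or> (CHAR('k) = 0 \<and> d = 0)"
proof (cases "CHAR('k) = 0")
  case True
  then show ?thesis unfolding char_exponent_def by (auto simp: of_nat_eq_0_iff_char_dvd)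
next
  case False
  then have "Factorial_Ring.prime CHAR('k)" using prime_CHAR_semidom by blast
  then show ?thesis
    using False unfolding char_exponent_def
    by (simp add: of_nat_eq_0_iff_char_dvd prime_imp_coprime_nat)
      (metis coprime_absorb_left not_prime_unit prime_imp_coprime_nat)
qed

lemma to_ac_of_nat_fls: "(of_nat d = (0 :: 'k::field fls alg_closure)) \<longleftrightarrow> of_nat d = (0 :: 'k)"
proof -
  have "of_nat d = (0 :: 'k fls alg_closure) \<longleftrightarrow> of_nat d = (0 :: 'k fls)"
    by (metis to_ac_eq_0_iff to_ac_of_nat)
  then show ?thesis by (simp add: of_nat_eq_0_iff_char_dvd)
qed

text \<open>At a root with x^d = c_i the derivative is d x^(d-1) times the product of the c_i - c_j.
  Here d is nonzero by the condition on char' k, x because b_i is nonzero, and the differences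
  because the b_i are distinct.\<close>

lemma special_h_separable:
  fixes h :: "'k::field fls poly"
  assumes n: "n \<ge> 1" and sp: "special_h n r d s b h" and root: "poly (map_poly to_ac h) x = 0"
  shows "x \<noteq> 0" "poly (pderiv (map_poly to_ac h)) x \<noteq> 0"
proof -
  interpret t: inj_comm_ring_hom "to_ac :: 'k fls \<Rightarrow> _" by (rule inj_comm_ring_hom_to_ac)
  interpret tp: map_poly_comm_ring_hom "to_ac :: 'k fls \<Rightarrow> _" ..
  have h: "h = (\<Prod>i=1..r. Polynomial.monom 1 d - [:fls_const (b i) * fls_X ^ s:])"
    and rd: "r * d = n" and cop: "coprime (char_exponent TYPE('k)) d"
    and inj: "inj_on b {1..r}" and b: "\<And>i. i \<in> {1..r} \<Longrightarrow> b i \<noteq> 0"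
    using sp unfolding special_h_def by auto
  have d: "d > 0" using rd n by (auto intro: Nat.gr0I)
  define c where "c i = to_ac (fls_const (b i) * fls_X ^ s)" for i
  have H: "map_poly to_ac h = (\<Prod>i=1..r. Polynomial.monom 1 d - [:c i:])"
    unfolding h tp.hom_prod c_def
    by (intro prod.cong refl) (simp add: tp.hom_minus map_poly_monom t.map_poly_pCons_hom)
  obtain i where i: "i \<in> {1..r}" "x ^ d = c i"
    using root unfolding H by (auto simp: poly_prod poly_monom)
  show x: "x \<noteq> 0"
  proof
    assume "x = 0"
    then have "c i = 0" using i d by (simp add: power_0_left)
    then show False using b[OF i(1)] unfolding c_def by (simp add: fls_const_nonzero)
  qed
  have "map_poly to_ac h = (Polynomial.monom 1 d - [:c i:]) * (\<Prod>j\<in>{1..r} - {i}. Polynomial.monom 1 d - [:c j:])"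
    unfolding H using i(1) by (simp add: prod.remove)
  then have "poly (pderiv (map_poly to_ac h)) x = of_nat d * x ^ (d - 1) * (\<Prod>j\<in>{1..r} - {i}. c i - c j)"
    using i(2) by (simp add: pderiv_mult pderiv_diff pderiv_monom poly_monom poly_prod pderiv_pCons mult_ac)
  moreover have "of_nat d \<noteq> (0 :: 'k fls alg_closure)"
    using cop d unfolding char_exponent_coprime_iff to_ac_of_nat_fls by simp
  moreover have "c i - c j \<noteq> 0" if j: "j \<in> {1..r} - {i}" for j
  proof
    assume "c i - c j = 0"
    then have "fls_const (b i) * fls_X ^ s = fls_const (b j) * fls_X ^ s" unfolding c_def by simp
    then have "fls_const (b i) = fls_const (b j)" by simp
    then have "fls_nth (fls_const (b i)) 0 = fls_nth (fls_const (b j)) 0" by (rule arg_cong)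
    then have "b i = b j" by simp
    then show False using inj i j by (auto dest: inj_onD)
  qed
  ultimately show "poly (pderiv (map_poly to_ac h)) x \<noteq> 0" using x by simp
qed

lemma linear_factorization:
  fixes p :: "'a::alg_closed_field poly"
  assumes deg: "Polynomial.degree p = n" and monic: "Polynomial.coeff p n = 1"
  shows "\<exists>y :: nat \<Rightarrow> 'a. p = (\<Prod>i=1..n. [:- y i, 1:])"
proof -
  have "p \<noteq> 0" using monic by auto
  then obtain A where A: "size A = n" "p = (\<Prod>x\<in>#A. [:- x, 1:])"
    using alg_closed_imp_factorization[of p] deg monic by auto
  obtain ys where ys: "mset ys = A" using ex_mset by blast
  have "p = prod_list (map (\<lambda>x. [:- x, 1:]) ys)"
    unfolding A(2) ys[symmetric] by (simp flip: prod_mset_prod_list)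
  also have "\<dots> = (\<Prod>i = 0..<n. [:- (ys ! i), 1:])"
    using A(1) ys by (subst prod.list_conv_set_nth) auto
  also have "\<dots> = (\<Prod>i=1..n. [:- (ys ! (i - 1)), 1:])"
    by (rule prod.reindex_bij_witness[of _ "\<lambda>i. i - 1" Suc]) auto
  finally show ?thesis by (rule exI[of _ "\<lambda>i. ys ! (i - 1)"])
qed

lemma sq_monom: "sq (Polynomial.monom a d) = Polynomial.monom a (2 * d)"
proof -
  have "Polynomial.coeff (sq (Polynomial.monom a d)) i = Polynomial.coeff (Polynomial.monom a (2 * d)) i" for i
    by (cases "Parity.even i") (auto simp: coeff_sq elim: evenE)
  then show ?thesis by (simp add: poly_eq_iff)
qed

lemma sq_linear: "sq [:- (a ^ 2), 1:] = [:- a, 1:] * [:a, 1:]"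
  by (simp add: pcompose_pCons monom_altdef power2_eq_square)

lemma map_poly_sq:
  assumes "comm_ring_hom f"
  shows "map_poly f (sq h) = sq (map_poly f h)"
proof -
  interpret comm_ring_hom f by fact
  show ?thesis by (simp add: map_poly_pcompose map_poly_monom)
qed

lemma special_regular_semisimple:
  assumes n: "n \<ge> 1" and sp: "special_h n r d s b h"
    and N: "N \<in> sp (const_mat B)" "char_poly N = sq h"
  shows "regular_semisimple n B N"
proof -
  interpret t: inj_comm_ring_hom "to_ac :: 'a fls \<Rightarrow> _" by (rule inj_comm_ring_hom_to_ac)
  note deg = special_h_degree[OF n sp]
  define H where "H = map_poly to_ac h"
  have "Polynomial.degree H = n" "Polynomial.coeff H n = 1"
    unfolding H_def using deg by (simp_all add: coeff_map_poly)
  then obtain y where y: "H = (\<Prod>i=1..n. [:- y i, 1:])" using linear_factorization by blast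
  \<comment> \<open>The a_i required by regular semisimplicity are square roots of the roots of
    h.\<close>
  have "\<forall>i. \<exists>z. z ^ 2 = y i" by (intro allI nth_root_exists) simp
  then obtain a where a: "\<And>i. a i ^ 2 = y i" by metis
  have "map_poly to_ac (char_poly N) = sq H"
    unfolding N(2) H_def by (rule map_poly_sq) unfold_locales
  also have "\<dots> = (\<Prod>i=1..n. [:- a i, 1:] * [:a i, 1:])"
    unfolding y pcompose_prod a[symmetric] by (simp only: sq_linear)
  finally have 1: "map_poly to_ac (char_poly N) = (\<Prod>i=1..n. [:- a i, 1:] * [:a i, 1:])" .
  have 2: "inj_on y {1..n}"
    by (rule separable_factors_distinct) (use special_h_separable(2)[OF n sp] y in \<open>auto simp: H_def\<close>)
  have 3: "y i \<noteq> 0" if "i \<in> {1..n}" for i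
  proof -
    have "poly H (y i) = 0" unfolding y poly_prod using that by (intro prod_zero) auto
    then show ?thesis using special_h_separable(1)[OF n sp] unfolding H_def by blast
  qed
  show ?thesis
    unfolding regular_semisimple_def
    using N(1) by (intro conjI exI[of _ a]) (use 1 2 3 in \<open>auto simp: a\<close>)
qed

text \<open>With \<beta>_i a 2d-th root of b_i, h(mu^2) is the product of the mu^(2d) -
  \<beta>_i^(2d) pi^s; coprimality of s with 2d makes each factor a Kummer polynomial with D =
  2d.\<close>

lemma special_symplectic_kummer:
  fixes B :: "'k::alg_closed_field mat"
  assumes ch: "CHAR('k) \<noteq> 2" and "symplectic n B"
    and N: "N \<in> sp (const_mat B)" "char_poly N = sq h" and sp: "special_h n r d s b h"
  shows "\<exists>\<beta>. symplectic_kummer n (const_mat B) (2 * d) s r \<beta> N"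
proof -
  interpret symplectic n B by fact
  interpret E: symplectic n "const_mat B" by (rule symplectic_const_mat) fact
  have h: "h = (\<Prod>i=1..r. Polynomial.monom 1 d - [:fls_const (b i) * fls_X ^ s:])"
    and rd: "r * d = n" and cop: "coprime s (2 * d)"
    and inj: "inj_on b {1..r}" and b: "\<And>i. i \<in> {1..r} \<Longrightarrow> b i \<noteq> 0"
    using sp unfolding special_h_def by auto
  have d: "2 * d > 0" using rd n_pos by (auto intro: Nat.gr0I)
  have "\<forall>i. \<exists>z. z ^ (2 * d) = b i" using nth_root_exists[OF d] by blast
  then obtain \<beta> where \<beta>: "\<And>i. \<beta> i ^ (2 * d) = b i" by metis
  have k: "kummer (2 * d) s (\<beta> i)" if "i \<in> {1..r}" for i
  proof
    show "\<beta> i \<noteq> 0" using b[OF that] \<beta>[of i] d by (metis power_0_left less_numeral_extra(3))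
  qed (use d cop in \<open>simp_all add: coprime_commute\<close>)
  interpret F: kummer_family "2 * d" s r \<beta>
    by (rule kummer_family.intro) (simp_all only: k \<beta> inj)
  have "F.\<chi> = sq h"
    unfolding F.\<chi>_def h pcompose_prod
    by (intro prod.cong refl) (simp add: F.Q_eq pcompose_diff sq_monom \<beta>)
  then show ?thesis
    using ch N by (intro exI[of _ \<beta>]) (unfold_locales, auto)
qed

lemma special_conjugate:
  fixes B :: "'k::alg_closed_field mat"
  assumes "CHAR('k) \<noteq> 2" "symplectic n B" "special_h n r d s b h"
    and "N \<in> sp (const_mat B)" "char_poly N = sq h" "N' \<in> sp (const_mat B)" "char_poly N' = sq h"
  shows "sp_conj B N N'"
proof -
  interpret E: symplectic n "const_mat B" by (rule symplectic_const_mat) fact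
  obtain v where "E.normal_vec N v"
    using special_symplectic_kummer[OF assms(1,2,4,5,3)] symplectic_kummer.normal_vec_exists by blast
  moreover obtain v' where "E.normal_vec N' v'"
    using special_symplectic_kummer[OF assms(1,2,6,7,3)] symplectic_kummer.normal_vec_exists by blast
  ultimately show ?thesis
    using E.normal_vec_conjugate[OF assms(4,6)] assms(5,7) unfolding sp_conj_def by simp
qed

text \<open>Nilness depends only on the conjugacy class, so it is checked on the standard element
  for a basis supplied by \<open>darboux\<close>.\<close>

lemma special_nil_elliptic:
  fixes B :: "'k::alg_closed_field mat"
  assumes ch: "CHAR('k) \<noteq> 2" and "symplectic n B" and sp: "special_h n r d s b h"
    and N: "N \<in> sp (const_mat B)" "char_poly N = sq h"
  shows "nil_elliptic n B N"
proof -
  interpret symplectic n B by fact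
  obtain S where S: "S \<in> carrier_mat (2 * n) (2 * n)" "transpose_mat S * B * S = std_form n"
    using darboux two_neq_zero[OF ch] by blast
  obtain N' where N': "N' \<in> carrier_mat (2 * n) (2 * n)" "N' * const_mat S = const_mat S * std_mat n h"
    using standard_element_exists[OF S] by blast
  have "sp_conj B N N'"
    using special_conjugate[OF ch assms(2) sp N] standard_element[OF S N'] special_h_degree[OF n_pos sp]
    by blast
  then have "nil B N"
    using standard_element_nil[OF S N' sp] N(1) unfolding nil_def by auto
  moreover have rs: "regular_semisimple n B N" by (rule special_regular_semisimple[OF n_pos sp N])
  moreover have "\<chi> t = 1\<^sub>m (2 * n)" if "centralizer_cocharacter B N \<chi>" "t \<noteq> 0" for \<chi> t
  proof -
    obtain \<beta> where "symplectic_kummer n (const_mat B) (2 * d) s r \<beta> N"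
      using special_symplectic_kummer[OF ch assms(2) N sp] by blast
    then show ?thesis
      using that unfolding centralizer_cocharacter_def
      by (intro symplectic_kummer.cocharacter_trivial) auto
  qed
  ultimately show ?thesis unfolding nil_elliptic_def elliptic_def by simp
qed

section \<open>Torus actions\<close>

lemma mat_regular_const: "mat_regular_on_Gm m (\<lambda>l. M)"
  unfolding mat_regular_on_Gm_def by (simp add: regular_on_Gm_const)

lemma mat_regular_mult:
  assumes "mat_regular_on_Gm m \<phi>" "mat_regular_on_Gm m \<psi>"
    and "\<And>l. \<phi> l \<in> carrier_mat m m" "\<And>l. \<psi> l \<in> carrier_mat m m"
  shows "mat_regular_on_Gm m (\<lambda>l. \<phi> l * \<psi> l)"
proof -
  have "(\<phi> l * \<psi> l) $$ (i, j) = (\<Sum>a<m. \<phi> l $$ (i, a) * \<psi> l $$ (a, j))" if "i < m" "j < m" for l i j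
    using assms(3,4)[of l] that by (simp add: scalar_prod_def atLeast0LessThan)
  then show ?thesis
    using assms(1,2) unfolding mat_regular_on_Gm_def
    by (auto intro!: regular_on_Gm_sum regular_on_Gm_mult)
qed

lemma mat_regular_cong:
  assumes "\<And>l. l \<noteq> 0 \<Longrightarrow> \<phi> l = \<psi> l" "mat_regular_on_Gm m \<psi>"
  shows "mat_regular_on_Gm m \<phi>"
  unfolding mat_regular_on_Gm_def
proof (intro allI impI)
  fix i j assume "i < m" "j < m"
  then show "regular_on_Gm (\<lambda>l. \<phi> l $$ (i, j))"
    using assms regular_on_Gm_cong[of "\<lambda>l. \<phi> l $$ (i, j)" "\<lambda>l. \<psi> l $$ (i, j)"]
    unfolding mat_regular_on_Gm_def by simp
qed

lemma mat_regular_diag: "mat_regular_on_Gm m (\<lambda>l. mat_diag m (\<lambda>i. l powi w i))"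
  unfolding mat_regular_on_Gm_def
proof (intro allI impI)
  fix i j assume ij: "i < m" "j < m"
  show "regular_on_Gm (\<lambda>l :: 'a. mat_diag m (\<lambda>i. l powi w i) $$ (i, j))"
    using ij by (cases "i = j") (simp_all add: mat_diag_def regular_on_Gm_powi regular_on_Gm_const)
qed

section \<open>Cosets of the scalars in the group of similitudes\<close>

lemma scalars_coset:
  assumes a: "a \<in> carrier_mat (dim_row B) (dim_row B)"
  shows "scalars B #>\<^bsub>GSp B\<^esub> a = {c \<cdot>\<^sub>m a | c. c \<noteq> 0}"
proof -
  have "(c \<cdot>\<^sub>m 1\<^sub>m (dim_row B)) * a = c \<cdot>\<^sub>m a" for c
    using a by (simp add: mult_smult_assoc_mat[of _ "dim_row B" "dim_row B"])
  then show ?thesis unfolding r_coset_def scalars_def GSp_def by auto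
qed

text \<open>The action on matrices goes through a chosen element of a coset. All that is known of
  the choice is that it is a nonzero multiple of a given representative, and \<open>Ad\<close> does
  not see the multiple.\<close>

lemma some_in_coset:
  assumes a: "a \<in> carrier_mat (dim_row B) (dim_row B)"
  shows "\<exists>c. c \<noteq> 0 \<and> (SOME g. g \<in> scalars B #>\<^bsub>GSp B\<^esub> a) = c \<cdot>\<^sub>m a"
proof -
  have "1 \<cdot>\<^sub>m a \<in> scalars B #>\<^bsub>GSp B\<^esub> a"
    unfolding scalars_coset[OF a] by (rule CollectI, rule exI[of _ 1]) simp
  then have "(SOME g. g \<in> scalars B #>\<^bsub>GSp B\<^esub> a) \<in> scalars B #>\<^bsub>GSp B\<^esub> a" by (rule someI)
  then show ?thesis unfolding scalars_coset[OF a] by blast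
qed

lemma UN_setcompr_image2:
  "(\<Union>x\<in>{f c | c. P c}. \<Union>y\<in>{g c | c. P c}. {m x y}) = {m (f c) (g c') | c c'. P c \<and> P c'}"
  by blast

text \<open>Scalars pull out of both factors, and the products of two nonzero scalars are exactly
  the nonzero scalars.\<close>

lemma scalars_coset_mult:
  fixes a :: "'k::field mat"
  assumes a: "a \<in> carrier_mat (dim_row B) (dim_row B)" and b: "b \<in> carrier_mat (dim_row B) (dim_row B)"
  shows "(scalars B #>\<^bsub>GSp B\<^esub> a) <#>\<^bsub>GSp B\<^esub> (scalars B #>\<^bsub>GSp B\<^esub> b) = scalars B #>\<^bsub>GSp B\<^esub> (a * b)"
proof -
  have ab: "a * b \<in> carrier_mat (dim_row B) (dim_row B)" using a b by simp
  have "(c \<cdot>\<^sub>m a) * (c' \<cdot>\<^sub>m b) = (c * c') \<cdot>\<^sub>m (a * b)" for c c'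
  proof -
    have "c' \<cdot>\<^sub>m b \<in> carrier_mat (dim_row B) (dim_row B)" using b by simp
    then have "(c \<cdot>\<^sub>m a) * (c' \<cdot>\<^sub>m b) = c \<cdot>\<^sub>m (c' \<cdot>\<^sub>m (a * b))"
      by (simp only: mult_smult_assoc_mat[OF a] mult_smult_distrib[OF a b])
    also have "\<dots> = (c * c') \<cdot>\<^sub>m (a * b)"
      by (intro eq_matI) (simp_all del: index_mult_mat(1))
    finally show ?thesis .
  qed
  then have "(scalars B #>\<^bsub>GSp B\<^esub> a) <#>\<^bsub>GSp B\<^esub> (scalars B #>\<^bsub>GSp B\<^esub> b) =
      {(c * c') \<cdot>\<^sub>m (a * b) | c c'. c \<noteq> 0 \<and> c' \<noteq> 0}"
    unfolding scalars_coset[OF a] scalars_coset[OF b] set_mult_def UN_setcompr_image2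
    by (simp add: GSp_def)
  also have "\<dots> = {c \<cdot>\<^sub>m (a * b) | c. c \<noteq> 0}"
  proof -
    have "(\<exists>c c'. x = m (c * c') \<and> c \<noteq> 0 \<and> c' \<noteq> 0) \<longleftrightarrow> (\<exists>c. x = m c \<and> c \<noteq> 0)"
      for x and m :: "'k \<Rightarrow> 'k mat"
      by (metis mult.right_neutral no_zero_divisors one_neq_zero)
    from this[of _ "\<lambda>c. c \<cdot>\<^sub>m (a * b)"] show ?thesis by (rule Collect_cong)
  qed
  finally show ?thesis unfolding scalars_coset[OF ab] .
qed

lemma coeff_pcompose_scale:
  fixes p :: "'a::comm_ring_1 poly"
  shows "Polynomial.coeff (p \<circ>\<^sub>p [:0, a:]) j = a ^ j * Polynomial.coeff p j"
proof (induction p arbitrary: j)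
  case (pCons c p)
  show ?case
    by (cases j) (simp_all add: pcompose_pCons pCons coeff_pCons mult_ac)
qed simp

text \<open>Replacing pi by l^(2d) pi and mu by l^(2s) mu multiplies every factor mu^d - b pi^s by
  l^(2ds). Comparing coefficients of mu^j and cancelling l^(2sj) leaves the exponent 2s(n -
  j).\<close>

lemma rescale_special_h:
  fixes h :: "'k::field fls poly"
  assumes sp: "special_h n r d s b h" and l: "l \<noteq> 0" and j: "j \<le> n"
  shows "rescale (l ^ (2 * d)) (Polynomial.coeff h j) = fls_const (l ^ (2 * s * (n - j))) * Polynomial.coeff h j"
proof -
  define t where "t = fls_const (l ^ (2 * s))"
  interpret c: inj_comm_ring_hom "fls_const :: 'k \<Rightarrow> 'k fls" by (rule inj_comm_ring_hom_fls_const)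
  interpret e: inj_comm_ring_hom "rescale (l ^ (2 * d)) :: 'k fls \<Rightarrow> _"
    by (rule inj_comm_ring_hom_rescale) (use l in simp)
  interpret ep: map_poly_comm_ring_hom "rescale (l ^ (2 * d)) :: 'k fls \<Rightarrow> _" ..
  have h: "h = (\<Prod>i=1..r. Polynomial.monom 1 d - [:fls_const (b i) * fls_X ^ s:])" and rd: "r * d = n"
    using sp unfolding special_h_def by auto
  have rX: "rescale (l ^ (2 * d)) (fls_X ^ s) = t ^ d * fls_X ^ s"
  proof -
    have "rescale (l ^ (2 * d)) (fls_X_intpow (int s)) = fls_const ((l ^ (2 * d)) ^ s) * fls_X_intpow (int s)"
      using rescale_X_intpow[of "l ^ (2 * d)" "int s"] by simp
    moreover have "(l ^ (2 * d)) ^ s = (l ^ (2 * s)) ^ d"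
      by (simp add: mult_ac flip: power_mult)
    ultimately show ?thesis unfolding t_def fls_X_power_conv_shift_1 by (simp add: c.hom_power)
  qed
  have "(map_poly (rescale (l ^ (2 * d))) (Polynomial.monom 1 d - [:fls_const c * fls_X ^ s:])) \<circ>\<^sub>p [:0, t:] =
      Polynomial.smult (t ^ d) (Polynomial.monom 1 d - [:fls_const c * fls_X ^ s:])" for c
  proof -
    have "Polynomial.monom (1 :: 'k fls) d \<circ>\<^sub>p [:0, t:] = Polynomial.smult (t ^ d) (Polynomial.monom 1 d)"
      by (rule poly_eqI) (simp add: coeff_pcompose_scale)
    then show ?thesis
      by (simp add: ep.hom_minus map_poly_monom e.map_poly_pCons_hom e.hom_mult rX pcompose_diff
          smult_diff_right mult.left_commute)
  qed
  then have "map_poly (rescale (l ^ (2 * d))) h \<circ>\<^sub>p [:0, t:] =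
      (\<Prod>i=1..r. Polynomial.smult (t ^ d) (Polynomial.monom 1 d - [:fls_const (b i) * fls_X ^ s:]))"
    unfolding h ep.hom_prod pcompose_prod by simp
  also have "\<dots> = Polynomial.smult (t ^ n) h"
    unfolding h prod_smult using rd by (simp add: mult.commute flip: power_mult)
  finally have "t ^ j * rescale (l ^ (2 * d)) (Polynomial.coeff h j) = t ^ n * Polynomial.coeff h j"
    by (metis coeff_map_poly coeff_pcompose_scale coeff_smult e.hom_zero)
  also have "t ^ n = t ^ j * t ^ (n - j)" using j by (simp flip: power_add)
  finally have "t ^ j * rescale (l ^ (2 * d)) (Polynomial.coeff h j) = t ^ j * (t ^ (n - j) * Polynomial.coeff h j)"
    by (simp only: mult.assoc)
  moreover have "t ^ j \<noteq> 0" unfolding t_def using l by (simp add: fls_const_nonzero)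
  ultimately have "rescale (l ^ (2 * d)) (Polynomial.coeff h j) = t ^ (n - j) * Polynomial.coeff h j"
    by (metis mult_left_cancel)
  then show ?thesis unfolding t_def by (simp add: c.hom_power power_mult)
qed

text \<open>The part of \<open>nu\<close> that does not depend on m, at an index counted from 0: the
  weights are s, 2s, ..., ns followed by 0, -s, ..., (1 - n)s.\<close>

definition torus_weight :: "nat \<Rightarrow> nat \<Rightarrow> nat \<Rightarrow> int" where
  "torus_weight n s j = (if j < n then (int j + 1) * int s else (int n - int j) * int s)"

lemma nu_eq: "1 \<le> j \<Longrightarrow> nu n d s m j = 2 * int d * m + torus_weight n s (j - 1)"
  unfolding nu_def torus_weight_def by (auto simp: algebra_simps of_nat_diff)

section \<open>The diagonal action in a symplectic basis\<close>

locale standard_torus = symplectic n B for n and B :: "'k::alg_closed_field mat" +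
  fixes S :: "'k mat" and r d s :: nat and b :: "nat \<Rightarrow> 'k" and h :: "'k fls poly"
  assumes S: "S \<in> carrier_mat (2 * n) (2 * n)" and gram: "transpose_mat S * B * S = std_form n"
    and special: "special_h n r d s b h"
begin

definition S_inv :: "'k mat" where
  "S_inv = (SOME C. C \<in> carrier_mat (2 * n) (2 * n) \<and> S * C = 1\<^sub>m (2 * n) \<and> C * S = 1\<^sub>m (2 * n))"

lemma S_inv: "S_inv \<in> carrier_mat (2 * n) (2 * n)" "S * S_inv = 1\<^sub>m (2 * n)" "S_inv * S = 1\<^sub>m (2 * n)"
proof -
  have "\<exists>C. C \<in> carrier_mat (2 * n) (2 * n) \<and> S * C = 1\<^sub>m (2 * n) \<and> C * S = 1\<^sub>m (2 * n)"
    using det_nz_inverse[OF S det_of_gram[OF S gram]] by blast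
  then have "S_inv \<in> carrier_mat (2 * n) (2 * n) \<and> S * S_inv = 1\<^sub>m (2 * n) \<and> S_inv * S = 1\<^sub>m (2 * n)"
    unfolding S_inv_def by (rule someI_ex)
  then show "S_inv \<in> carrier_mat (2 * n) (2 * n)" "S * S_inv = 1\<^sub>m (2 * n)" "S_inv * S = 1\<^sub>m (2 * n)" by auto
qed

definition diag :: "'k \<Rightarrow> 'k mat" where
  "diag l = mat_diag (2 * n) (\<lambda>j. l powi torus_weight n s j)"

definition tor :: "'k \<Rightarrow> 'k mat" where
  "tor l = S * diag l * S_inv"

text \<open>The second component l^(2d) acts on pi^m by l^(2dm), the summand of \<open>nu\<close>
  that depends on m.\<close>

definition act :: "'k \<Rightarrow> 'k mat \<times> 'k" where
  "act l = (tor l, l ^ (2 * d))"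

lemma diag_carrier: "diag l \<in> carrier_mat (2 * n) (2 * n)"
  unfolding diag_def by simp

lemma tor_carrier: "tor l \<in> carrier_mat (2 * n) (2 * n)"
  unfolding tor_def using S S_inv diag_carrier[of l]
  by (auto intro!: mult_carrier_mat[of _ "2 * n" "2 * n" _ "2 * n"])

lemmas assoc = assoc_mult_mat[of _ "2 * n" "2 * n" _ "2 * n" _ "2 * n"]

lemma cancel:
  assumes "Y \<in> carrier_mat (2 * n) (2 * n)"
  shows "S_inv * (S * Y) = Y" "S * (S_inv * Y) = Y"
  using assms S S_inv by (simp_all flip: assoc_mult_mat[of _ "2 * n" "2 * n" _ "2 * n"])

lemma diag_mult: "l \<noteq> 0 \<Longrightarrow> l' \<noteq> 0 \<Longrightarrow> diag l * diag l' = diag (l * l')"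
  unfolding diag_def by (simp add: power_int_mult_distrib)

lemma tor_mult:
  assumes "l \<noteq> 0" "l' \<noteq> 0"
  shows "tor l * tor l' = tor (l * l')"
proof -
  have "tor l * tor l' = S * (diag l * diag l') * S_inv"
    unfolding tor_def using S S_inv diag_carrier[of l] diag_carrier[of l'] by (simp add: assoc cancel)
  then show ?thesis unfolding diag_mult[OF assms] tor_def .
qed

text \<open>Counted from 1, the weights of e_i and e_(n+i) are i s and (1 - i) s. Their sum s is
  independent of i, so the torus acts by similitudes with multiplier l^s.\<close>

lemma diag_form:
  assumes l: "l \<noteq> 0"
  shows "diag l * std_form n * diag l = (l powi int s) \<cdot>\<^sub>m std_form n"
proof (rule eq_matI)
  fix i j assume "i < dim_row ((l powi int s) \<cdot>\<^sub>m std_form n)" "j < dim_col ((l powi int s) \<cdot>\<^sub>m std_form n)"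
  then have ij: "i < 2 * n" "j < 2 * n" by (auto simp: std_form_def)
  have "diag l * std_form n * diag l = Matrix.mat (2 * n) (2 * n)
     (\<lambda>(i, j). std_form n $$ (i, j) * (l powi torus_weight n s i * l powi torus_weight n s j))"
    unfolding diag_def
    by (subst mat_diag_mult_left[OF std_form_carrier], subst mat_diag_mult_right[of _ "2 * n"]) (auto simp: mult_ac)
  moreover have "l powi torus_weight n s i * l powi torus_weight n s j = l powi int s"
    if "j = i + n \<or> i = j + n"
  proof -
    have "torus_weight n s i + torus_weight n s j = int s"
      using that ij unfolding torus_weight_def by (auto simp: algebra_simps)
    then show ?thesis using l by (metis power_int_add)
  qed
  then have "std_form n $$ (i, j) * (l powi torus_weight n s i * l powi torus_weight n s j) =
      l powi int s * std_form n $$ (i, j)"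
    using ij by (cases "j = i + n \<or> i = j + n") (simp_all add: std_form_def del: power_int_of_nat)
  ultimately show "(diag l * std_form n * diag l) $$ (i, j) = ((l powi int s) \<cdot>\<^sub>m std_form n) $$ (i, j)"
    using ij by (simp add: std_form_def del: power_int_of_nat)
qed (simp_all add: std_form_def diag_def mat_diag_def)

lemma tor_similitude:
  assumes l: "l \<noteq> 0"
  shows "transpose_mat (tor l) * B * tor l = (l powi int s) \<cdot>\<^sub>m B"
proof -
  have tr: "transpose_mat S \<in> carrier_mat (2 * n) (2 * n)" "transpose_mat S_inv \<in> carrier_mat (2 * n) (2 * n)"
    using S S_inv by auto
  have td: "transpose_mat (diag l) = diag l"
    unfolding diag_def mat_diag_def by (intro eq_matI) auto
  have cc: "transpose_mat S_inv * transpose_mat S = 1\<^sub>m (2 * n)"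
    using transpose_mult[OF S S_inv(1)] S_inv(2) by simp
  have "transpose_mat (tor l) = transpose_mat S_inv * (diag l * transpose_mat S)"
    unfolding tor_def using S S_inv tr diag_carrier[of l]
    by (simp add: transpose_mult[of _ "2 * n" "2 * n" _ "2 * n"] td)
  then have "transpose_mat (tor l) * B * tor l =
      transpose_mat S_inv * (diag l * (transpose_mat S * B * S) * diag l) * S_inv"
    unfolding tor_def using S S_inv tr B diag_carrier[of l] by (simp add: assoc)
  also have "\<dots> = (l powi int s) \<cdot>\<^sub>m (transpose_mat S_inv * (transpose_mat S * B * S) * S_inv)"
    unfolding gram diag_form[OF l] using S S_inv tr
    by (simp add: mult_smult_distrib[of _ "2 * n" "2 * n" _ "2 * n"] mult_smult_assoc_mat[of _ "2 * n" "2 * n" _ "2 * n"])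
  also have "transpose_mat S_inv * (transpose_mat S * B * S) * S_inv =
      (transpose_mat S_inv * transpose_mat S) * B * (S * S_inv)"
    using S S_inv tr B by (simp add: assoc)
  also have "\<dots> = B" unfolding cc S_inv(2) using B by simp
  finally show ?thesis .
qed

lemma act_hom: "GSp_Gm_hom B act"
  unfolding GSp_Gm_hom_def
proof (intro conjI)
  show "act \<in> hom Gm (GSp B \<times>\<times> Gm)"
  proof (rule homI)
    fix l :: 'k assume "l \<in> carrier Gm"
    then have l: "l \<noteq> 0" unfolding Gm_def by simp
    have "\<exists>c. c \<noteq> 0 \<and> transpose_mat (tor l) * B * tor l = c \<cdot>\<^sub>m B"
      using tor_similitude[OF l] l by (intro exI[of _ "l powi int s"]) simp
    then show "act l \<in> carrier (GSp B \<times>\<times> Gm)"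
      unfolding act_def GSp_def Gm_def using l tor_carrier[of l] by simp
  next
    fix l l' :: 'k assume "l \<in> carrier Gm" "l' \<in> carrier Gm"
    then have "l \<noteq> 0" "l' \<noteq> 0" unfolding Gm_def by auto
    then show "act (l \<otimes>\<^bsub>Gm\<^esub> l') = act l \<otimes>\<^bsub>GSp B \<times>\<times> Gm\<^esub> act l'"
      using tor_mult[of l l'] unfolding act_def GSp_def Gm_def by (simp add: power_mult_distrib)
  qed
  have "mat_regular_on_Gm (2 * n) diag" unfolding diag_def[abs_def] by (rule mat_regular_diag)
  then show "mat_regular_on_Gm (dim_row B) (\<lambda>l. fst (act l))"
    unfolding act_def tor_def using S S_inv
    by (auto intro!: mat_regular_mult mat_regular_const diag_carrier mult_carrier_mat[of _ "2 * n" "2 * n" _ "2 * n"])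
  show "regular_on_Gm (\<lambda>l. snd (act l))"
    unfolding act_def using regular_on_Gm_powi[of "int (2 * d)"] by (simp del: of_nat_mult)
qed

lemma tor_col:
  assumes "j < 2 * n"
  shows "tor l *\<^sub>v col S j = l powi torus_weight n s j \<cdot>\<^sub>v col S j"
proof -
  have Sj: "col S j = S *\<^sub>v unit_vec (2 * n) j" using S assms by (intro eq_vecI) auto
  have "S_inv *\<^sub>v (S *\<^sub>v unit_vec (2 * n) j) = unit_vec (2 * n) j"
    using assoc_mult_mat_vec[OF S_inv(1) S, of "unit_vec (2 * n) j"] S_inv(3) by simp
  then have "tor l *\<^sub>v col S j = S *\<^sub>v (diag l *\<^sub>v unit_vec (2 * n) j)"
    unfolding Sj tor_def using S S_inv diag_carrier[of l]
    by (simp add: assoc_mult_mat_vec[of _ "2 * n" "2 * n" _ "2 * n"])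
  also have "diag l *\<^sub>v unit_vec (2 * n) j = l powi torus_weight n s j \<cdot>\<^sub>v unit_vec (2 * n) j"
    using assms unfolding diag_def mat_diag_def by (intro eq_vecI) auto
  finally show ?thesis unfolding Sj by (simp add: mult_mat_smult_vec[OF S])
qed

lemma act_basis:
  assumes l: "l \<noteq> 0" and j: "j \<in> {1..2 * n}" and e: "e j = col S (j - 1)"
  shows "GSp_Gm_act (act l) (fls_X_intpow m \<cdot>\<^sub>v const_vec (e j)) =
    fls_const (l powi nu n d s m j) \<cdot>\<^sub>v (fls_X_intpow m \<cdot>\<^sub>v const_vec (e j))"
proof -
  interpret c: inj_comm_ring_hom "fls_const :: 'k \<Rightarrow> 'k fls" by (rule inj_comm_ring_hom_fls_const)
  have L: "l ^ (2 * d) \<noteq> 0" using l by simp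
  interpret e: inj_comm_ring_hom "rescale (l ^ (2 * d)) :: 'k fls \<Rightarrow> _" by (rule inj_comm_ring_hom_rescale[OF L])
  have j1: "j - 1 < 2 * n" using j by auto
  have ec: "e j \<in> carrier_vec (2 * n)" unfolding e using S by (simp add: carrier_vecI)
  define q where "q = l powi torus_weight n s (j - 1)"
  have "map_vec (rescale (l ^ (2 * d))) (fls_X_intpow m \<cdot>\<^sub>v const_vec (e j)) =
      (fls_const ((l ^ (2 * d)) powi m) * fls_X_intpow m) \<cdot>\<^sub>v const_vec (e j)"
    by (intro eq_vecI) (simp_all only: index_map_vec index_smult_vec e.hom_mult rescale_X_intpow rescale_const)
  moreover have "const_mat (tor l) *\<^sub>v const_vec (e j) = fls_const q \<cdot>\<^sub>v const_vec (e j)"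
    using c.mult_mat_vec_hom[OF tor_carrier ec, of l] tor_col[OF j1] unfolding e q_def
    by (simp add: c.vec_hom_smult)
  ultimately have "GSp_Gm_act (act l) (fls_X_intpow m \<cdot>\<^sub>v const_vec (e j)) =
     (fls_const ((l ^ (2 * d)) powi m) * fls_X_intpow m) \<cdot>\<^sub>v (fls_const q \<cdot>\<^sub>v const_vec (e j))"
    unfolding GSp_Gm_act_def act_def fst_conv snd_conv
    using mult_mat_smult_vec[of "const_mat (tor l)" "2 * n" "2 * n" "const_vec (e j)"] ec tor_carrier[of l] by simp
  also have "\<dots> = fls_const ((l ^ (2 * d)) powi m * q) \<cdot>\<^sub>v (fls_X_intpow m \<cdot>\<^sub>v const_vec (e j))"
    by (intro eq_vecI) (simp_all only: index_smult_vec fls_const_mult_const[symmetric] mult_ac)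
  also have "(l ^ (2 * d)) powi m * q = l powi nu n d s m j"
  proof -
    have "(l ^ (2 * d)) powi m = l powi (2 * int d * m)"
      by (metis power_int_mult power_int_of_nat of_nat_mult of_nat_numeral)
    then show ?thesis unfolding q_def using j l by (simp add: nu_eq power_int_add)
  qed
  finally show ?thesis .
qed

text \<open>For each nonzero entry (i, j) the weight of e_i plus the scaling exponent of the entry
  must equal s plus the weight of e_j. The entries 1 and -1 join basis vectors whose weights differ
  by s; the entry containing the coefficient of mu^(n-j) scales with exponent 2 s j, and (1 - j) s +
  2 s j = s + j s.\<close>

lemma diag_std_mat:
  assumes l: "l \<noteq> 0"
  shows "const_mat (diag l) * map_mat (rescale (l ^ (2 * d))) (std_mat n h) =
    fls_const (l powi int s) \<cdot>\<^sub>m (std_mat n h * const_mat (diag l))"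
proof (rule eq_matI)
  interpret c: inj_comm_ring_hom "fls_const :: 'k \<Rightarrow> 'k fls" by (rule inj_comm_ring_hom_fls_const)
  interpret e: inj_comm_ring_hom "rescale (l ^ (2 * d)) :: 'k fls \<Rightarrow> _"
    by (rule inj_comm_ring_hom_rescale) (use l in simp)
  fix i j assume "i < dim_row (fls_const (l powi int s) \<cdot>\<^sub>m (std_mat n h * const_mat (diag l)))"
    "j < dim_col (fls_const (l powi int s) \<cdot>\<^sub>m (std_mat n h * const_mat (diag l)))"
  then have ij: "i < 2 * n" "j < 2 * n" by (auto simp: std_mat_def diag_def mat_diag_def)
  have D: "const_mat (diag l) = mat_diag (2 * n) (\<lambda>j. fls_const (l powi torus_weight n s j))"
    unfolding diag_def mat_diag_def by (intro eq_matI) auto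
  define w where "w = torus_weight n s"
  have pw: "fls_const (l powi a) * fls_const (l powi c) = fls_const (l powi (a + c))" for a c
    using l by (simp add: fls_const_mult_const power_int_add)
  have split: "i < n \<or> (\<exists>a<n. i = n + a)" if "i < 2 * n" for i
    using that by (metis add_less_cancel_left le_Suc_ex mult_2 not_less)
  have coeff: "rescale (l ^ (2 * d)) (Polynomial.coeff h (n - Suc a)) =
      fls_const (l powi (2 * int s * (int a + 1))) * Polynomial.coeff h (n - Suc a)" if "a < n" for a
  proof -
    have "rescale (l ^ (2 * d)) (Polynomial.coeff h (n - Suc a)) =
        fls_const (l ^ (2 * s * (n - (n - Suc a)))) * Polynomial.coeff h (n - Suc a)"
      by (rule rescale_special_h[OF special l]) simp
    moreover have "l ^ (2 * s * (n - (n - Suc a))) = l powi (2 * int s * (int a + 1))"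
    proof -
      have "int (2 * s * (n - (n - Suc a))) = 2 * int s * (int a + 1)" using that by (simp add: algebra_simps)
      then show ?thesis by (metis power_int_of_nat)
    qed
    ultimately show ?thesis by simp
  qed
  have main: "fls_const (l powi w i) * rescale (l ^ (2 * d)) (standard_entry n h (Suc i) (Suc j)) =
      fls_const (l powi (int s + w j)) * standard_entry n h (Suc i) (Suc j)"
    using split[OF ij(1)] split[OF ij(2)]
  proof (elim disjE exE conjE)
    fix a c assume a: "a < n" "i = n + a" and c: "j < n"
    show ?thesis
    proof (cases "a = j")
      case True
      have wt: "w i + 2 * int s * (int j + 1) = int s + w j"
        using a c True unfolding w_def torus_weight_def by (simp add: algebra_simps)
      have m1: "rescale (l ^ (2 * d)) ((- 1) ^ Suc j) = (- 1) ^ Suc j"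
        by (simp add: e.hom_mult e.hom_power e.hom_uminus)
      have ent: "standard_entry n h (Suc i) (Suc j) = (- 1) ^ Suc j * Polynomial.coeff h (n - Suc j)"
        using a c True by (simp add: standard_entry_blocks del: power_Suc)
      have "rescale (l ^ (2 * d)) (standard_entry n h (Suc i) (Suc j)) =
          fls_const (l powi (2 * int s * (int j + 1))) * standard_entry n h (Suc i) (Suc j)"
        unfolding ent e.hom_mult m1 coeff[OF c] by (rule mult.left_commute)
      then show ?thesis by (simp only: mult.assoc[symmetric] pw wt)
    next
      case False
      then show ?thesis using a c by (simp add: standard_entry_blocks)
    qed
  next
    fix a c assume "i < n" and c: "c < n" "j = n + c"
    then show ?thesis unfolding w_def torus_weight_def by (simp add: standard_entry_blocks)
  next
    fix a c assume a: "a < n" "i = n + a" and c: "c < n" "j = n + c"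
    show ?thesis
    proof (cases "c = Suc a")
      case True
      then have "w i = int s + w j" using a c unfolding w_def torus_weight_def by (simp add: algebra_simps)
      moreover have "standard_entry n h (Suc i) (Suc j) = - 1"
        using standard_entry_blocks(4)[OF a(1) c(1), of h] a(2) c(2) True by simp
      ultimately show ?thesis by (simp add: e.hom_uminus)
    next
      case False
      then show ?thesis using a c by (simp add: standard_entry_blocks)
    qed
  next
    assume ij: "i < n" "j < n"
    show ?thesis
    proof (cases "i = Suc j")
      case True
      then have "w i = int s + w j" using ij unfolding w_def torus_weight_def by (simp add: algebra_simps)
      moreover have "standard_entry n h (Suc i) (Suc j) = 1"
        using standard_entry_blocks(1)[OF ij, of h] True by simp
      ultimately show ?thesis by simp
    next
      case False
      then show ?thesis using ij by (simp add: standard_entry_blocks)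
    qed
  qed
  have "(const_mat (diag l) * map_mat (rescale (l ^ (2 * d))) (std_mat n h)) $$ (i, j) =
      fls_const (l powi w i) * rescale (l ^ (2 * d)) (standard_entry n h (Suc i) (Suc j))"
    unfolding D w_def
    by (subst mat_diag_mult_left[of _ "2 * n" "2 * n"]) (use ij in \<open>auto simp: std_mat_def\<close>)
  also have "\<dots> = fls_const (l powi int s) * (std_mat n h * const_mat (diag l)) $$ (i, j)"
    unfolding main unfolding D w_def
    by (subst mat_diag_mult_right[of _ "2 * n" "2 * n"]) (use ij in \<open>auto simp: std_mat_def pw[symmetric] mult_ac\<close>)
  finally show "(const_mat (diag l) * map_mat (rescale (l ^ (2 * d))) (std_mat n h)) $$ (i, j) =
      (fls_const (l powi int s) \<cdot>\<^sub>m (std_mat n h * const_mat (diag l))) $$ (i, j)"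
    using ij by (simp add: std_mat_def diag_def mat_diag_def del: index_mult_mat(1))
qed (simp_all add: std_mat_def diag_def mat_diag_def)

lemma tor_commutes:
  assumes l: "l \<noteq> 0" and N: "N \<in> carrier_mat (2 * n) (2 * n)" "N * const_mat S = const_mat S * std_mat n h"
  shows "const_mat (tor l) * map_mat (rescale (l ^ (2 * d))) N = fls_const (l powi int s) \<cdot>\<^sub>m (N * const_mat (tor l))"
proof -
  interpret c: inj_comm_ring_hom "fls_const :: 'k \<Rightarrow> 'k fls" by (rule inj_comm_ring_hom_fls_const)
  interpret e: inj_comm_ring_hom "rescale (l ^ (2 * d)) :: 'k fls \<Rightarrow> _"
    by (rule inj_comm_ring_hom_rescale) (use l in simp)
  define T where "T = const_mat S"
  define U where "U = const_mat S_inv"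
  define A where "A = std_mat n h"
  define A' where "A' = map_mat (rescale (l ^ (2 * d))) A"
  define E where "E = const_mat (diag l)"
  define q where "q = fls_const (l powi int s)"
  have car: "T \<in> carrier_mat (2 * n) (2 * n)" "U \<in> carrier_mat (2 * n) (2 * n)"
    "A \<in> carrier_mat (2 * n) (2 * n)" "A' \<in> carrier_mat (2 * n) (2 * n)" "E \<in> carrier_mat (2 * n) (2 * n)"
    unfolding T_def U_def A_def A'_def E_def using S S_inv diag_carrier by auto
  have SD: "S * diag l \<in> carrier_mat (2 * n) (2 * n)" using S diag_carrier[of l] by simp
  have tor: "const_mat (tor l) = T * E * U"
    unfolding tor_def T_def E_def U_def c.mat_hom_mult[OF SD S_inv(1)] c.mat_hom_mult[OF S diag_carrier] ..
  have TU: "T * U = 1\<^sub>m (2 * n)" "U * T = 1\<^sub>m (2 * n)"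
    unfolding T_def U_def using S_inv
    by (simp_all flip: c.mat_hom_mult[OF S S_inv(1)] c.mat_hom_mult[OF S_inv(1) S] add: c.mat_hom_one)
  have canc: "U * (T * Y) = Y" if "Y \<in> carrier_mat (2 * n) (2 * n)" for Y
    using assoc_mult_mat[OF car(2,1) that] TU that by simp
  have "N = N * (T * U)" using N TU by simp
  also have "\<dots> = T * A * U" using N(2) assoc_mult_mat[OF N(1) car(1,2)] unfolding T_def A_def by simp
  finally have NT: "N = T * A * U" .
  \<comment> \<open>The basis matrices have entries in k, which rescaling fixes, so only the
    standard matrix is affected.\<close>
  have constr: "map_mat (rescale (l ^ (2 * d))) (const_mat Y) = const_mat Y" for Y :: "'k mat"
    by (intro eq_matI) auto
  have TA: "T * A \<in> carrier_mat (2 * n) (2 * n)" using car by simp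
  have "map_mat (rescale (l ^ (2 * d))) N = T * A' * U"
    unfolding NT e.mat_hom_mult[OF TA car(2)] e.mat_hom_mult[OF car(1,3)] A'_def
    unfolding T_def U_def constr ..
  then have "const_mat (tor l) * map_mat (rescale (l ^ (2 * d))) N = T * (E * A') * U"
    unfolding tor using car by (simp add: assoc canc)
  also have "E * A' = q \<cdot>\<^sub>m (A * E)"
    unfolding E_def A'_def A_def q_def by (rule diag_std_mat[OF l])
  also have "T * (q \<cdot>\<^sub>m (A * E)) * U = q \<cdot>\<^sub>m (T * (A * E) * U)"
    using car by (simp add: mult_smult_distrib[of _ "2 * n" "2 * n" _ "2 * n"]
        mult_smult_assoc_mat[of _ "2 * n" "2 * n" _ "2 * n"])
  also have "T * (A * E) * U = N * const_mat (tor l)"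
    unfolding tor NT using car by (simp add: assoc canc)
  finally show ?thesis unfolding q_def .
qed

lemma act_commutes:
  assumes l: "l \<noteq> 0" and N: "N \<in> carrier_mat (2 * n) (2 * n)" "N * const_mat S = const_mat S * std_mat n h"
    and x: "x \<in> carrier_vec (2 * n)"
  shows "GSp_Gm_act (act l) (N *\<^sub>v x) = fls_const (l powi int s) \<cdot>\<^sub>v (N *\<^sub>v GSp_Gm_act (act l) x)"
proof -
  interpret e: inj_comm_ring_hom "rescale (l ^ (2 * d)) :: 'k fls \<Rightarrow> _"
    by (rule inj_comm_ring_hom_rescale) (use l in simp)
  define G where "G = const_mat (tor l)"
  define N' where "N' = map_mat (rescale (l ^ (2 * d))) N"
  define x' where "x' = map_vec (rescale (l ^ (2 * d))) x"
  have car: "G \<in> carrier_mat (2 * n) (2 * n)" "N' \<in> carrier_mat (2 * n) (2 * n)" "x' \<in> carrier_vec (2 * n)"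
    unfolding G_def N'_def x'_def using tor_carrier N x by auto
  have "GSp_Gm_act (act l) (N *\<^sub>v x) = G *\<^sub>v (N' *\<^sub>v x')"
    unfolding GSp_Gm_act_def act_def fst_conv snd_conv e.mult_mat_vec_hom[OF N(1) x] G_def N'_def x'_def ..
  also have "\<dots> = G * N' *\<^sub>v x'" using car by (simp add: assoc_mult_mat_vec[of _ "2 * n" "2 * n" _ "2 * n"])
  also have "G * N' = fls_const (l powi int s) \<cdot>\<^sub>m (N * G)"
    unfolding G_def N'_def by (rule tor_commutes[OF l N])
  also have "(fls_const (l powi int s) \<cdot>\<^sub>m (N * G)) *\<^sub>v x' = fls_const (l powi int s) \<cdot>\<^sub>v (N * G *\<^sub>v x')"
    using car by (intro eq_vecI) (simp_all del: index_mult_mat(1))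
  also have "N * G *\<^sub>v x' = N *\<^sub>v (G *\<^sub>v x')"
    using car N by (simp add: assoc_mult_mat_vec[of _ "2 * n" "2 * n" _ "2 * n"])
  finally show ?thesis unfolding GSp_Gm_act_def act_def fst_conv snd_conv G_def x'_def .
qed

lemma tor_inverse:
  assumes "l \<noteq> 0"
  shows "tor l * tor (inverse l) = 1\<^sub>m (2 * n)"
proof -
  have "diag 1 = 1\<^sub>m (2 * n)" unfolding diag_def by simp
  then show ?thesis using tor_mult[of l "inverse l"] assms S_inv S unfolding tor_def by simp
qed

lemma Q_Sp_action_act: "Q_Sp_action B (induced_Q_Sp B act)"
  unfolding Q_Sp_action_def
proof (intro conjI ballI)
  have torB: "tor l \<in> carrier_mat (dim_row B) (dim_row B)" for l using tor_carrier by simp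
  have hom: "act \<in> hom Gm (GSp B \<times>\<times> Gm)" using act_hom unfolding GSp_Gm_hom_def by simp
  show "induced_Q_Sp B act \<in> hom Gm (Q_Sp B)"
  proof (rule homI)
    fix l :: 'k assume l: "l \<in> carrier Gm"
    have "act l \<in> carrier (GSp B \<times>\<times> Gm)" by (rule hom_in_carrier[OF hom l])
    then show "induced_Q_Sp B act l \<in> carrier (Q_Sp B)"
      unfolding induced_Q_Sp_def Q_Sp_def PGSp_def FactGroup_def RCOSETS_def DirProd_def by auto
  next
    fix l l' :: 'k assume "l \<in> carrier Gm" "l' \<in> carrier Gm"
    then have "l \<noteq> 0" "l' \<noteq> 0" unfolding Gm_def by auto
    then show "induced_Q_Sp B act (l \<otimes>\<^bsub>Gm\<^esub> l') =
        induced_Q_Sp B act l \<otimes>\<^bsub>Q_Sp B\<^esub> induced_Q_Sp B act l'"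
      unfolding induced_Q_Sp_def Q_Sp_def PGSp_def FactGroup_def act_def
      by (simp add: Gm_def scalars_coset_mult[OF torB torB] tor_mult power_mult_distrib)
  qed
  show "regular_on_Gm (\<lambda>l. snd (induced_Q_Sp B act l))"
    using act_hom unfolding GSp_Gm_hom_def induced_Q_Sp_def by simp
  fix M :: "'k mat" assume "M \<in> carrier_mat (dim_row B) (dim_row B)"
  then have M: "M \<in> carrier_mat (2 * n) (2 * n)" by simp
  \<comment> \<open>The chosen coset representative is an arbitrary multiple of
    \<open>tor l\<close>, so its entries need not be regular in l; in this expression the multiple
    has cancelled.\<close>
  have "mat_regular_on_Gm (2 * n) (\<lambda>l. tor l * M * tor (inverse l))"
  proof -
    have reg: "mat_regular_on_Gm (2 * n) tor"
      using act_hom unfolding GSp_Gm_hom_def act_def[abs_def] by simp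
    have "mat_regular_on_Gm (2 * n) (\<lambda>l. mat_diag (2 * n) (\<lambda>j. l powi (- torus_weight n s j)) :: 'k mat)"
      by (rule mat_regular_diag)
    then have "mat_regular_on_Gm (2 * n) (\<lambda>l. diag (inverse l))"
      unfolding diag_def by (simp add: power_int_minus power_int_inverse)
    then have "mat_regular_on_Gm (2 * n) (\<lambda>l. tor (inverse l))"
      unfolding tor_def using S S_inv
      by (auto intro!: mat_regular_mult mat_regular_const diag_carrier mult_carrier_mat[of _ "2 * n" "2 * n" _ "2 * n"])
    then show ?thesis
      using M reg by (auto intro!: mat_regular_mult mat_regular_const tor_carrier mult_carrier_mat[of _ "2 * n" "2 * n" _ "2 * n"])
  qed
  then show "mat_regular_on_Gm (dim_row B) (\<lambda>l. Ad (SOME g. g \<in> fst (induced_Q_Sp B act l)) M)"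
    unfolding dim_B
  proof (rule mat_regular_cong[rotated])
    fix l :: 'k assume l: "l \<noteq> 0"
    obtain c where c: "c \<noteq> 0" "(SOME g. g \<in> fst (induced_Q_Sp B act l)) = c \<cdot>\<^sub>m tor l"
      using some_in_coset[OF torB, of l] unfolding induced_Q_Sp_def act_def by auto
    have g: "c \<cdot>\<^sub>m tor l \<in> carrier_mat (2 * n) (2 * n)" using tor_carrier[of l] by simp
    have det: "det (c \<cdot>\<^sub>m tor l) \<noteq> 0"
      using c(1) inverse_det_nz[OF tor_carrier tor_carrier tor_inverse[OF l]] by simp
    have X: "tor l * M * tor (inverse l) \<in> carrier_mat (2 * n) (2 * n)"
      using tor_carrier M by (auto intro!: mult_carrier_mat[of _ "2 * n" "2 * n" _ "2 * n"])
    have ti: "tor (inverse l) * tor l = 1\<^sub>m (2 * n)" using tor_inverse[of "inverse l"] l by simp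
    have "tor l * M * tor (inverse l) * (c \<cdot>\<^sub>m tor l) = c \<cdot>\<^sub>m (tor l * M * tor (inverse l) * tor l)"
      by (rule mult_smult_distrib[OF X tor_carrier])
    also have "tor l * M * tor (inverse l) * tor l = tor l * M * (tor (inverse l) * tor l)"
      using tor_carrier M by (intro assoc) (auto intro!: mult_carrier_mat[of _ "2 * n" "2 * n" _ "2 * n"])
    also have "\<dots> = tor l * M"
      unfolding ti by (rule right_mult_one_mat[OF mult_carrier_mat[OF tor_carrier M]])
    also have "c \<cdot>\<^sub>m (tor l * M) = (c \<cdot>\<^sub>m tor l) * M"
      by (rule mult_smult_assoc_mat[OF tor_carrier M, symmetric])
    finally have "tor l * M * tor (inverse l) = Ad (c \<cdot>\<^sub>m tor l) M"
      by (rule Ad_eq_iff[OF g det M X, THEN iffD2])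
    then show "Ad (SOME g. g \<in> fst (induced_Q_Sp B act l)) M = tor l * M * tor (inverse l)"
      unfolding c(2) by simp
  qed
qed

lemma act_almost_commutes:
  assumes N: "N \<in> carrier_mat (2 * n) (2 * n)" "N * const_mat S = const_mat S * std_mat n h"
  shows "almost_commutes (induced_Q_Sp B act) N (int s)"
  unfolding almost_commutes_def
proof (intro conjI allI impI)
  have torB: "tor l \<in> carrier_mat (dim_row B) (dim_row B)" for l using tor_carrier by simp
  show "int s \<noteq> 0" using special unfolding special_h_def by simp
  fix l :: 'k assume l: "l \<noteq> 0"
  interpret c: inj_comm_ring_hom "fls_const :: 'k \<Rightarrow> 'k fls" by (rule inj_comm_ring_hom_fls_const)
  obtain c where c: "c \<noteq> 0" "(SOME g. g \<in> fst (induced_Q_Sp B act l)) = c \<cdot>\<^sub>m tor l"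
    using some_in_coset[OF torB, of l] unfolding induced_Q_Sp_def act_def by auto
  define q where "q = fls_const (l powi int s)"
  define G where "G = const_mat (tor l)"
  define N' where "N' = map_mat (rescale (l ^ (2 * d))) N"
  have car: "G \<in> carrier_mat (2 * n) (2 * n)" "N' \<in> carrier_mat (2 * n) (2 * n)"
    "fls_const c \<cdot>\<^sub>m G \<in> carrier_mat (2 * n) (2 * n)" "q \<cdot>\<^sub>m N \<in> carrier_mat (2 * n) (2 * n)"
    unfolding G_def N'_def using tor_carrier N by auto
  have cg: "const_mat (c \<cdot>\<^sub>m tor l) = fls_const c \<cdot>\<^sub>m G"
    unfolding G_def by (rule eq_matI) (simp_all add: fls_const_mult_const)
  have "det G \<noteq> 0"
    unfolding G_def using inverse_det_nz[OF tor_carrier tor_carrier tor_inverse[OF l]] by simp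
  then have det: "det (fls_const c \<cdot>\<^sub>m G) \<noteq> 0" using c(1) by (simp add: fls_const_nonzero)
  have "(q \<cdot>\<^sub>m N) * (fls_const c \<cdot>\<^sub>m G) = fls_const c \<cdot>\<^sub>m ((q \<cdot>\<^sub>m N) * G)"
    by (rule mult_smult_distrib[OF car(4,1)])
  also have "(q \<cdot>\<^sub>m N) * G = q \<cdot>\<^sub>m (N * G)" by (rule mult_smult_assoc_mat[OF N(1) car(1)])
  also have "\<dots> = G * N'"
    unfolding q_def G_def N'_def by (rule tor_commutes[OF l N, symmetric])
  also have "fls_const c \<cdot>\<^sub>m (G * N') = (fls_const c \<cdot>\<^sub>m G) * N'"
    by (rule mult_smult_assoc_mat[OF car(1,2), symmetric])
  finally have "q \<cdot>\<^sub>m N = Ad (fls_const c \<cdot>\<^sub>m G) N'"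
    by (rule Ad_eq_iff[OF car(3) det car(2,4), THEN iffD2])
  then show "Q_act (induced_Q_Sp B act l) N = fls_const (l powi int s) \<cdot>\<^sub>m N"
    unfolding Q_act_def c(2) cg q_def N'_def by (simp add: induced_Q_Sp_def act_def)
qed

end

section \<open>Elements almost commuting with an action\<close>

lemma coeff_pcompose_monom:
  fixes p :: "'a::comm_ring_1 poly"
  assumes d: "d > 0"
  shows "Polynomial.coeff (p \<circ>\<^sub>p Polynomial.monom 1 d) i = (if d dvd i then Polynomial.coeff p (i div d) else 0)"
proof (induction p arbitrary: i)
  case (pCons a p)
  show ?case
  proof (cases "d \<le> i")
    case True
    then obtain j where j: "i = d + j" by (metis le_Suc_ex)
    then show ?thesis using d by (simp add: pcompose_pCons coeff_monom_mult pCons coeff_pCons split: nat.split)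
  next
    case False
    then have "d dvd i \<longleftrightarrow> i = 0" by (auto dest: dvd_imp_le)
    then show ?thesis using False d by (auto simp: pcompose_pCons coeff_monom_mult coeff_pCons split: nat.split)
  qed
qed simp

text \<open>Different exponents would give a Laurent polynomial with coefficients 1 and -1 that
  vanishes on an infinite set.\<close>

lemma powi_inject:
  assumes inf: "infinite (UNIV :: 'a::field set)" and eq: "\<And>l :: 'a. l \<noteq> 0 \<Longrightarrow> l powi a = l powi c"
  shows "a = c"
proof (rule ccontr)
  assume ac: "a \<noteq> c"
  define w :: "int \<Rightarrow> 'a" where "w m = (if m = a then 1 else - 1)" for m
  have "w a = 0"
  proof (rule laurent_polynomial_zero[of "UNIV - {0}" "{a, c}"])
    show "infinite (UNIV - {0 :: 'a})" using inf by simp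
    fix z :: 'a assume "z \<in> UNIV - {0}"
    then show "z \<noteq> 0 \<and> (\<Sum>m\<in>{a, c}. w m * z powi m) = 0"
      using ac eq[of z] by (simp add: w_def)
  qed auto
  then show False by (simp add: w_def)
qed

text \<open>
  If \<open>\<mu>\<^bsup>2d\<^esup> - b \<pi>\<^bsup>2s\<^esup>\<close> divides the characteristic polynomial of \<open>N\<close>, with \<open>d\<close> odd, then its factors
  \<open>\<mu>\<^sup>d \<plusminus> \<beta> \<pi>\<^sup>s\<close> give a pair of dual isotropic subspaces, on which \<open>t\<close> can act by \<open>t\<close> and \<open>t\<^sup>-\<^sup>1\<close>.
\<close>

lemma split_factor_not_elliptic:
  fixes B :: "'k::field mat"
  assumes "symplectic n B" and k: "kummer d s \<gamma>" and odd: "Parity.odd d" and two: "(2 :: 'k) \<noteq> 0"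
    and N: "N \<in> sp (const_mat B)"
    and chi: "char_poly N = kummer.P d s \<gamma> * (neg_arg (kummer.P d s \<gamma>) * R)"
    and R: "neg_arg R = R" "\<not> kummer.P d s \<gamma> dvd R"
  shows "\<not> elliptic n B N"
proof
  assume ell: "elliptic n B N"
  interpret kummer d s \<gamma> by (rule k)
  interpret E: symplectic n "const_mat B" by (rule symplectic_const_mat) fact
  have Nc: "N \<in> carrier_mat (2 * n) (2 * n)" using N E.sp_iff by simp
  have dimB: "dim_row B = 2 * n" using E.B by simp
  \<comment> \<open>As d is odd, P(-mu) + P is the constant -2 \<gamma>^d pi^s, which is nonzero
    because 2 is.\<close>
  have "\<not> P dvd neg_arg P"
  proof
    assume "P dvd neg_arg P"
    then have dvd: "P dvd neg_arg P + P" by (simp add: dvd_add)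
    define c where "c = fls_const (\<gamma> ^ d) * fls_X ^ s"
    have P: "P = Polynomial.monom 1 d - [:c:]" unfolding P_def c_def ..
    have "neg_arg P = Polynomial.monom (- 1) d - [:c:]"
      using odd unfolding P by (simp add: pcompose_diff neg_arg_monom)
    then have "neg_arg P + P = (Polynomial.monom (- 1) d - [:c:]) + (Polynomial.monom 1 d - [:c:])"
      using P by (rule arg_cong2)
    also have "\<dots> = (Polynomial.monom (- 1) d + Polynomial.monom 1 d) - ([:c:] + [:c:])"
      by (simp only: diff_conv_add_uminus minus_add_distrib ac_simps)
    finally have "neg_arg P + P = (Polynomial.monom (- 1) d + Polynomial.monom 1 d) - ([:c:] + [:c:])" .
    then have eq: "neg_arg P + P = [:- (c + c):]"
      by (simp only: add_monom add.left_inverse monom_eq_0 add_pCons add_0_left diff_0 minus_pCons minus_zero)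
    have "(2 :: 'k fls) \<noteq> 0" using two by (metis fls_const_nonzero fls_const_numeral)
    then have "- (c + c) \<noteq> 0" using b_nz by (simp add: c_def fls_const_nonzero flip: mult_2)
    then have "Polynomial.degree P \<le> 0" using dvd_imp_degree_le[OF dvd] unfolding eq by simp
    then show False using degree_P D_pos by simp
  qed
  then have nd: "\<not> P dvd neg_arg P * R" using R(2) by (simp add: P_dvd_mult)
  define Q where "Q = neg_arg P * R"
  have chiQ: "char_poly N = P * Q" unfolding chi Q_def ..
  obtain q where q: "P dvd 1 - q * Q" using inverse_mod_P nd unfolding Q_def by blast
  \<comment> \<open>Modulo the characteristic polynomial e is the idempotent that is 1 modulo P and
    0 modulo the other factors; \<open>ne\<close> is its adjoint, the idempotent belonging to
    P(-mu).\<close>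
  define e where "e = q * Q"
  define ne where "ne = neg_arg e"
  have chi_even: "neg_arg (char_poly N) = char_poly N" by (rule E.char_poly_sp_even[OF N])
  have d1: "char_poly N dvd e * e - e"
  proof -
    have "P * Q dvd (1 - q * Q) * (q * Q)" using q by (intro mult_dvd_mono) auto
    moreover have "e * e - e = - ((1 - q * Q) * (q * Q))" unfolding e_def by (simp add: algebra_simps)
    ultimately show ?thesis unfolding chiQ by (simp only: dvd_minus_iff)
  qed
  have d2: "char_poly N dvd e * ne"
  proof -
    have "neg_arg Q = P * R" unfolding Q_def pcompose_mult by (simp add: R(1))
    then have "P dvd ne" unfolding ne_def e_def pcompose_mult by simp
    moreover have "Q dvd e" unfolding e_def by simp
    ultimately show ?thesis unfolding chiQ by (subst mult.commute) (rule mult_dvd_mono)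
  qed
  have d3: "char_poly N dvd ne * ne - ne"
  proof -
    obtain c where c: "e * e - e = char_poly N * c" using d1 by (elim dvdE)
    have "ne * ne - ne = neg_arg (e * e - e)" unfolding ne_def by (simp add: pcompose_mult pcompose_diff)
    also have "\<dots> = char_poly N * neg_arg c" unfolding c by (simp only: pcompose_mult chi_even)
    finally show ?thesis by simp
  qed
  \<comment> \<open>x_t acts by t on the image of e, by 1/t on that of \<open>ne\<close>, and
    trivially on the rest. The adjoint exchanges e and \<open>ne\<close>, hence sends x_t to its
    inverse, so x_t(N) preserves the form.\<close>
  define x where "x t = 1 + [:t - 1:] * e + [:inverse t - 1:] * ne" for t
  have eqI: "poly_mat N p = poly_mat N p'" if "char_poly N dvd p - p'" for p p'
    using E.poly_mat_mod_char_poly(1)[OF Nc] that by (metis mod_eq_dvd_iff)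
  have x_mult: "poly_mat N (x t * x u) = poly_mat N (x (t * u))" for t u
  proof (rule eqI)
    have "x t * x u - x (t * u) =
        [:t - 1:] * [:u - 1:] * (e * e - e) + [:inverse t - 1:] * [:inverse u - 1:] * (ne * ne - ne) +
        ([:t - 1:] * [:inverse u - 1:] + [:inverse t - 1:] * [:u - 1:]) * (e * ne)"
    proof -
      have 1: "[:t * u - 1:] = [:t - 1:] * [:u - 1:] + [:t - 1:] + [:u - 1:]"
        by (simp add: algebra_simps)
      have 2: "[:inverse (t * u) - 1:] = [:inverse t - 1:] * [:inverse u - 1:] + [:inverse t - 1:] + [:inverse u - 1:]"
        by (simp add: algebra_simps)
      have gen: "(1 + a * e + c * ne) * (1 + a' * e + c' * ne) - (1 + (a * a' + a + a') * e + (c * c' + c + c') * ne) =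
          a * a' * (e * e - e) + c * c' * (ne * ne - ne) + (a * c' + c * a') * (e * ne)" for a a' c c'
        by (simp only: algebra_simps) (simp add: algebra_simps)
      show ?thesis unfolding x_def 1 2 by (rule gen)
    qed
    then show "char_poly N dvd x t * x u - x (t * u)"
      using d1 d2 d3 by (simp only: dvd_add dvd_mult)
  qed
  have x1: "x 1 = 1" unfolding x_def by simp
  have neg_x: "neg_arg (x t) = x (inverse t)" for t
    unfolding x_def ne_def by (simp add: pcompose_add pcompose_mult pcompose_1 pcompose_smult)
  define \<psi> where "\<psi> t = poly_mat N (x t)" for t
  have psi_c: "\<psi> t \<in> carrier_mat (2 * n) (2 * n)" for t unfolding \<psi>_def using Nc by simp
  have "centralizer_cocharacter B N \<psi>"
    unfolding centralizer_cocharacter_def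
  proof (intro conjI allI impI)
    have ent: "\<psi> t $$ (i, j) = (poly_mat N 1 - poly_mat N e - poly_mat N ne) $$ (i, j) +
        poly_mat N e $$ (i, j) * t + poly_mat N ne $$ (i, j) * inverse t" if "i < 2 * n" "j < 2 * n" for t i j
    proof -
      have "x t = 1 + Polynomial.smult (t - 1) e + Polynomial.smult (inverse t - 1) ne" unfolding x_def by simp
      then have "\<psi> t = poly_mat N 1 + (t - 1) \<cdot>\<^sub>m poly_mat N e + (inverse t - 1) \<cdot>\<^sub>m poly_mat N ne"
        unfolding \<psi>_def by (simp only: poly_mat_add[OF Nc] poly_mat_smult[OF Nc])
      then show ?thesis using that Nc by (simp add: algebra_simps)
    qed
    show "mat_regular_on_Gm (dim_row B) \<psi>"
      unfolding mat_regular_on_Gm_def dimB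
    proof (intro allI impI)
      fix i j assume ij: "i < 2 * n" "j < 2 * n"
      have "regular_on_Gm (\<lambda>t. t :: 'k fls)" "regular_on_Gm (\<lambda>t. inverse t :: 'k fls)"
        using regular_on_Gm_powi[of 1] regular_on_Gm_powi[of "- 1"] by (simp_all add: power_int_minus)
      then show "regular_on_Gm (\<lambda>t. \<psi> t $$ (i, j))"
        unfolding ent[OF ij] by (intro regular_on_Gm_add regular_on_Gm_mult regular_on_Gm_const)
    qed
    show "\<psi> (t * u) = \<psi> t * \<psi> u" for t u
      unfolding \<psi>_def x_mult[symmetric] by (rule poly_mat_mult[OF Nc])
    show "\<psi> t * N = N * \<psi> t" for t
      using poly_mat_commute[OF Nc, of "x t" "[:0, 1:]"] unfolding \<psi>_def by (simp only: poly_mat_X[OF Nc])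
    show "\<psi> t \<in> Sp (const_mat B)" if t: "t \<noteq> 0" for t
    proof -
      have "transpose_mat (\<psi> t) * const_mat B * \<psi> t = const_mat B * (poly_mat N (x (inverse t)) * poly_mat N (x t))"
        unfolding \<psi>_def E.poly_mat_sp[OF N] neg_x
        using Nc by (intro assoc_mult_mat[OF E.B]) auto
      also have "poly_mat N (x (inverse t)) * poly_mat N (x t) = 1\<^sub>m (2 * n)"
        using x_mult[of "inverse t" t] t Nc by (simp add: poly_mat_mult[OF Nc] x1)
      finally show ?thesis unfolding Sp_def using psi_c[of t] E.B by simp
    qed
  qed
  then have triv: "\<psi> t = 1\<^sub>m (2 * n)" if "t \<noteq> 0" for t
    using ell that dimB unfolding elliptic_def by auto
  \<comment> \<open>Any value other than 0 and 1 detects nontriviality.\<close>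
  define t :: "'k fls" where "t = fls_X"
  have "t \<noteq> 0" "t - 1 \<noteq> 0"
  proof -
    show "t \<noteq> 0" unfolding t_def by simp
    have "fls_nth (t - 1) 0 \<noteq> 0" unfolding t_def by simp
    then show "t - 1 \<noteq> 0" by auto
  qed
  \<comment> \<open>Multiplying x_t - 1 by e isolates (t - 1) e, so triviality at t forces e(N) =
    0.\<close>
  have "poly_mat N (Polynomial.smult (t - 1) e) = poly_mat N (e * (x t - 1))"
  proof (rule eqI)
    have "Polynomial.smult (t - 1) e - e * (x t - 1) = - ([:t - 1:] * (e * e - e) + [:inverse t - 1:] * (e * ne))"
    proof -
      have "a * e - e * (1 + a * e + c * ne - 1) = - (a * (e * e - e) + c * (e * ne))" for a c
        by (simp add: algebra_simps)
      moreover have "Polynomial.smult (t - 1) e = [:t - 1:] * e" by simp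
      ultimately show ?thesis unfolding x_def by (simp only:)
    qed
    then show "char_poly N dvd Polynomial.smult (t - 1) e - e * (x t - 1)"
      using d1 d2 by (simp only: dvd_minus_iff dvd_add dvd_mult)
  qed
  also have "\<dots> = poly_mat N e * (\<psi> t - 1\<^sub>m (2 * n))"
    unfolding poly_mat_mult[OF Nc] poly_mat_diff[OF Nc] \<psi>_def poly_mat_1[OF Nc] ..
  also have "\<dots> = 0\<^sub>m (2 * n) (2 * n)"
    unfolding triv[OF \<open>t \<noteq> 0\<close>] using Nc by (simp add: minus_r_inv_mat[of _ "2 * n" "2 * n"])
  finally have tE: "(t - 1) \<cdot>\<^sub>m poly_mat N e = 0\<^sub>m (2 * n) (2 * n)" by (simp only: poly_mat_smult[OF Nc])
  have "(t - 1) * poly_mat N e $$ (i, j) = 0" if "i < 2 * n" "j < 2 * n" for i j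
    using arg_cong[OF tE, of "\<lambda>M. M $$ (i, j)"] that Nc by simp
  then have e0: "poly_mat N e = 0\<^sub>m (2 * n) (2 * n)"
    using \<open>t - 1 \<noteq> 0\<close> Nc by (intro eq_matI) auto
  \<comment> \<open>The contradiction: P(N) has a nonzero kernel vector, and e(N) fixes it because P
    divides 1 - e.\<close>
  have "P dvd char_poly N" unfolding chiQ by simp
  then have "\<phi> (char_poly N) = 0" using \<phi>_eq_0_iff by simp
  then have "det (poly_mat N P) = 0"
    using det_poly_mat_eq_0[OF Nc cp.inj_comm_ring_hom_axioms, of root P] \<phi>_P unfolding \<phi>_def by simp
  then obtain v where v: "v \<in> carrier_vec (2 * n)" "v \<noteq> 0\<^sub>v (2 * n)" "poly_mat N P *\<^sub>v v = 0\<^sub>v (2 * n)"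
    using det_0_iff_vec_prod_zero[of "poly_mat N P" "2 * n"] Nc by auto
  have "poly_mat N (1 - e) *\<^sub>v v = 0\<^sub>v (2 * n)"
    by (rule poly_mat_dvd_vec[OF Nc v(1) _ v(3)]) (use q in \<open>simp add: e_def\<close>)
  then have "v - 0\<^sub>m (2 * n) (2 * n) *\<^sub>v v = 0\<^sub>v (2 * n)"
    using v Nc by (simp add: poly_mat_diff_vec[OF Nc v(1)] e0)
  then show False using v by (simp add: zero_mat_mult_vec)
qed

text \<open>The Newton polygon of \<open>h\<close> has a single slope, and its coefficients are monomials.\<close>

lemma homogeneous_factorization:
  fixes h :: "'k::alg_closed_field fls poly"
  assumes d: "d > 0" and n: "n = d * r" and cop: "Rings.coprime d s"
    and deg: "Polynomial.degree h = n" and monic: "Polynomial.coeff h n = 1"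
    and shape: "\<And>j m. fls_nth (Polynomial.coeff h j) m \<noteq> 0 \<Longrightarrow> j \<le> n \<Longrightarrow> int s * int (n - j) = int d * m"
  shows "\<exists>b. h = (\<Prod>i=1..r. Polynomial.monom 1 d - [:fls_const (b i) * fls_X ^ s:])"
proof -
  \<comment> \<open>In the coefficient of mu^(d u) the shape hypothesis allows only the exponent s
    (r - u) of pi.\<close>
  define c where "c u = (if u \<le> r then fls_nth (Polynomial.coeff h (d * u)) (int (s * (r - u))) else 0)" for u
  define g where "g = (\<Sum>u\<le>r. Polynomial.monom (c u) u)"
  have coeff_g: "Polynomial.coeff g u = c u" for u
    unfolding g_def coeff_sum by (simp add: c_def)
  have "c r = 1" unfolding c_def using monic n by simp
  have "Polynomial.degree g \<le> r" unfolding g_def by (intro degree_sum_le) (auto intro: order.trans[OF degree_monom_le])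
  moreover have "r \<le> Polynomial.degree g" by (rule le_degree) (simp add: coeff_g \<open>c r = 1\<close>)
  ultimately have "Polynomial.degree g = r" by simp
  then obtain b where b: "g = (\<Prod>i=1..r. [:- b i, 1:])"
    using linear_factorization[of g r] \<open>c r = 1\<close> by (auto simp: coeff_g)
  interpret k: inj_comm_ring_hom "fls_const :: 'k \<Rightarrow> 'k fls" by (rule inj_comm_ring_hom_fls_const)
  interpret kp: map_poly_comm_ring_hom "fls_const :: 'k \<Rightarrow> 'k fls" ..
  define t :: "'k fls" where "t = fls_X ^ s"
  have t: "t \<noteq> 0" unfolding t_def by simp
  \<comment> \<open>p homogenizes g by t = pi^s, so that h = p(mu^d); substituting t mu for mu gives
    back t^r g, whose roots b_i lie in k.\<close>
  define p where "p = (\<Prod>i=1..r. [:- (fls_const (b i) * t), 1:])"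
  have "p \<circ>\<^sub>p [:0, t:] = (\<Prod>i=1..r. Polynomial.smult t (map_poly fls_const [:- b i, 1:]))"
    unfolding p_def pcompose_prod
    by (intro prod.cong refl) (simp add: pcompose_pCons k.map_poly_pCons_hom k.hom_uminus mult.commute)
  also have "\<dots> = Polynomial.smult (t ^ r) (map_poly fls_const g)"
    unfolding prod_smult b kp.hom_prod by simp
  finally have "p \<circ>\<^sub>p [:0, t:] = Polynomial.smult (t ^ r) (map_poly fls_const g)" .
  from arg_cong[OF this, of "\<lambda>p. Polynomial.coeff p u" for u]
  have tp: "t ^ u * Polynomial.coeff p u = t ^ r * fls_const (c u)" for u
    by (simp only: coeff_pcompose_scale coeff_smult k.coeff_map_poly_hom coeff_g)
  have coeff_p: "Polynomial.coeff p u = (if u \<le> r then fls_const (c u) * t ^ (r - u) else 0)" for u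
  proof (cases "u \<le> r")
    case True
    then have "t ^ u * Polynomial.coeff p u = t ^ u * (fls_const (c u) * t ^ (r - u))"
      unfolding tp by (simp add: mult_ac flip: power_add)
    then show ?thesis using t True by simp
  next
    case False
    then have "t ^ u * Polynomial.coeff p u = 0" unfolding tp by (simp add: c_def)
    then show ?thesis using t False by simp
  qed
  have "h = p \<circ>\<^sub>p Polynomial.monom 1 d"
  proof (rule poly_eqI)
    fix j
    show "Polynomial.coeff h j = Polynomial.coeff (p \<circ>\<^sub>p Polynomial.monom 1 d) j"
    proof (cases "j \<le> n")
      case j: True
      show ?thesis
      proof (cases "d dvd j")
        case True
        then obtain u where u: "j = d * u" by auto
        have ur: "u \<le> r" using j d unfolding u n by simp
        have "fls_nth (Polynomial.coeff h j) m = fls_nth (fls_const (c u) * t ^ (r - u)) m" for m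
        proof -
          have rhs: "fls_nth (fls_const (c u) * t ^ (r - u)) m = (if m = int (s * (r - u)) then c u else 0)"
            unfolding t_def power_mult[symmetric] by simp
          have mm: "m = int (s * (r - u))" if "fls_nth (Polynomial.coeff h j) m \<noteq> 0"
          proof -
            have "int d * m = int s * int (n - j)" using shape[OF that j] by simp
            also have "n - j = d * (r - u)" unfolding n u by (simp add: right_diff_distrib')
            finally have "int d * m = int d * int (s * (r - u))" by (simp add: mult_ac)
            then show ?thesis using d by simp
          qed
          show ?thesis
          proof (cases "m = int (s * (r - u))")
            case True
            then show ?thesis unfolding rhs using ur by (simp only: c_def u if_True refl)
          next
            case False
            then show ?thesis unfolding rhs using mm by (simp only: if_False) blast
          qed
        qed
        then have "Polynomial.coeff h j = fls_const (c u) * t ^ (r - u)" by (rule fls_eqI)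
        then show ?thesis using d ur u by (simp add: coeff_pcompose_monom coeff_p)
      next
        case False
        have "fls_nth (Polynomial.coeff h j) m = 0" for m
        proof (rule ccontr)
          assume "fls_nth (Polynomial.coeff h j) m \<noteq> 0"
          \<comment> \<open>Then d divides s (n - j), hence n - j by coprimality, hence j, as d
            divides n.\<close>
          from shape[OF this j] have "int d dvd int s * int (n - j)" by simp
          then have "d dvd s * (n - j)" by (metis int_dvd_int_iff of_nat_mult)
          then have "d dvd n - j" using cop by (simp add: coprime_dvd_mult_right_iff)
          then show False using False j n by (metis dvd_diffD1 dvd_triv_left)
        qed
        then have "Polynomial.coeff h j = 0" by (intro fls_eqI) simp
        then show ?thesis using False d by (simp add: coeff_pcompose_monom)
      qed
    next
      case False
      then have "Polynomial.coeff h j = 0" using deg by (simp add: coeff_eq_0)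
      moreover have "Polynomial.coeff (p \<circ>\<^sub>p Polynomial.monom 1 d) j = 0"
        using False d n by (auto simp: coeff_pcompose_monom coeff_p elim!: dvdE)
      ultimately show ?thesis by simp
    qed
  qed
  also have "\<dots> = (\<Prod>i=1..r. Polynomial.monom 1 d - [:fls_const (b i) * fls_X ^ s:])"
    unfolding p_def pcompose_prod t_def by (intro prod.cong refl) (simp add: pcompose_pCons)
  finally show ?thesis by blast
qed

text \<open>The second component is a multiplicative Laurent polynomial on an infinite field, hence
  a power.\<close>

lemma action_weight:
  fixes f :: "'k::alg_closed_field \<Rightarrow> 'k mat set \<times> 'k"
  assumes "f \<in> hom Gm (Q_Sp B)" and reg: "regular_on_Gm (\<lambda>l. snd (f l))"
  shows "\<exists>w. \<forall>l. l \<noteq> 0 \<longrightarrow> snd (f l) = l powi w"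
proof -
  have snd: "snd (f (l * l')) = snd (f l) * snd (f l')" if "l \<noteq> 0" "l' \<noteq> 0" for l l'
  proof -
    have "f (l \<otimes>\<^bsub>Gm\<^esub> l') = f l \<otimes>\<^bsub>Q_Sp B\<^esub> f l'"
      using that by (intro hom_mult[OF assms(1)]) (auto simp: Gm_def)
    then show ?thesis unfolding Q_Sp_def by (cases "f l"; cases "f l'") (simp add: Gm_def)
  qed
  have "f 1 \<in> carrier (Q_Sp B)"
    using assms(1) by (rule hom_in_carrier) (simp add: Gm_def)
  then have nz: "snd (f 1) \<noteq> 0" unfolding Q_Sp_def by (auto simp: Gm_def DirProd_def)
  obtain S c where S: "finite S" "\<And>t. t \<noteq> 0 \<Longrightarrow> snd (f t) = (\<Sum>m\<in>S. c m * t powi m)"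
    using reg unfolding regular_on_Gm_def by blast
  have id: "inj_comm_ring_hom (\<lambda>x :: 'k. x)" by unfold_locales auto
  show ?thesis
    by (rule multiplicative_laurent_polynomial[OF infinite_alg_closed id snd S nz])
qed

context symplectic
begin

text \<open>Conjugation leaves the characteristic polynomial unchanged, so l^s N and the rescaled N
  have the same one. The coefficient is kept as a factor on both sides because it may be
  zero.\<close>

lemma action_char_poly:
  assumes f: "f \<in> hom Gm (Q_Sp B)" and w: "snd (f l) = l powi w" and l: "l \<noteq> 0"
    and N: "N \<in> carrier_mat (2 * n) (2 * n)" and ac: "almost_commutes f N s"
  shows "l powi (s * int i + w * m) * fls_nth (Polynomial.coeff (char_poly N) i) m =
    l powi (s * int (2 * n)) * fls_nth (Polynomial.coeff (char_poly N) i) m"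
proof -
  interpret c: inj_comm_ring_hom "fls_const :: 'f \<Rightarrow> 'f fls" by (rule inj_comm_ring_hom_fls_const)
  interpret e: inj_comm_ring_hom "rescale (l powi w) :: 'f fls \<Rightarrow> _"
    by (rule inj_comm_ring_hom_rescale) (use l in simp)
  have "f l \<in> carrier (Q_Sp B)" using f by (rule hom_in_carrier) (use l in \<open>simp add: Gm_def\<close>)
  then have "fst (f l) \<in> rcosets\<^bsub>GSp B\<^esub> (scalars B)"
    unfolding Q_Sp_def PGSp_def FactGroup_def DirProd_def by auto
  then obtain a where a: "a \<in> carrier (GSp B)" "fst (f l) = scalars B #>\<^bsub>GSp B\<^esub> a"
    unfolding RCOSETS_def by auto
  obtain c where ac': "a \<in> carrier_mat (2 * n) (2 * n)" "c \<noteq> 0" "transpose_mat a * B * a = c \<cdot>\<^sub>m B"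
    using a(1) unfolding GSp_def by auto
  have "det a \<noteq> 0"
  proof
    assume "det a = 0"
    have "transpose_mat a * B \<in> carrier_mat (2 * n) (2 * n)" using ac' B by simp
    then have "det (c \<cdot>\<^sub>m B) = det (transpose_mat a * B) * det a" using ac' det_mult by metis
    then show False using \<open>det a = 0\<close> ac'(2) det_B by simp
  qed
  moreover obtain k where k: "k \<noteq> 0" "(SOME g. g \<in> fst (f l)) = k \<cdot>\<^sub>m a"
    using some_in_coset[of a B] ac' unfolding a(2) by auto
  ultimately have g: "const_mat (k \<cdot>\<^sub>m a) \<in> carrier_mat (2 * n) (2 * n)" "det (const_mat (k \<cdot>\<^sub>m a)) \<noteq> 0"
    using ac' by auto
  define q where "q = fls_const (l powi s)"
  define N' where "N' = map_mat (rescale (l powi w)) N"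
  have N': "N' \<in> carrier_mat (2 * n) (2 * n)" "q \<cdot>\<^sub>m N \<in> carrier_mat (2 * n) (2 * n)"
    unfolding N'_def using N by auto
  have "q \<cdot>\<^sub>m N = Ad (const_mat (k \<cdot>\<^sub>m a)) N'"
  proof -
    have "Q_act (f l) N = q \<cdot>\<^sub>m N" using ac l unfolding almost_commutes_def q_def by blast
    moreover have "Q_act (f l) N = Ad (const_mat (k \<cdot>\<^sub>m a)) N'"
      unfolding Q_act_def k(2) w N'_def ..
    ultimately show ?thesis by simp
  qed
  then have "q \<cdot>\<^sub>m N * const_mat (k \<cdot>\<^sub>m a) = const_mat (k \<cdot>\<^sub>m a) * N'"
    by (rule Ad_eq_iff[OF g N', THEN iffD1])
  then have "char_poly (q \<cdot>\<^sub>m N) = char_poly N'" by (rule char_poly_conjugate[OF g N'])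
  also have "\<dots> = map_poly (rescale (l powi w)) (char_poly N)"
    unfolding N'_def by (rule e.char_poly_hom[OF N])
  finally have "map_poly (rescale (l powi w)) (char_poly N) \<circ>\<^sub>p [:0, q:] = Polynomial.smult (q ^ (2 * n)) (char_poly N)"
    using char_poly_smult[OF N, of q] by simp
  from arg_cong[OF this, of "\<lambda>p. fls_nth (Polynomial.coeff p i) m"]
  have "fls_nth (q ^ i * rescale (l powi w) (Polynomial.coeff (char_poly N) i)) m =
      fls_nth (q ^ (2 * n) * Polynomial.coeff (char_poly N) i) m"
    by (simp only: coeff_pcompose_scale coeff_smult e.coeff_map_poly_hom)
  then have "(l powi s) ^ i * ((l powi w) powi m * fls_nth (Polynomial.coeff (char_poly N) i) m) =
      (l powi s) ^ (2 * n) * fls_nth (Polynomial.coeff (char_poly N) i) m"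
    unfolding q_def by (simp flip: fls_const_power)
  moreover have "(l powi s) ^ j = l powi (s * int j)" for j
    by (metis power_int_mult power_int_of_nat)
  moreover have "(l powi w) powi m = l powi (w * m)" by (simp add: power_int_mult)
  moreover have "l powi (s * int i + w * m) = l powi (s * int i) * l powi (w * m)"
    by (rule power_int_add) (use l in simp)
  ultimately show ?thesis by (simp only: mult.assoc)
qed

text \<open>Up to conjugacy N is integral with singular reduction, so 0 is a root of the reduced
  characteristic polynomial and the constant coefficient is divisible by pi.\<close>

lemma nil_char_poly:
  assumes nil: "nil B N" and m: "m \<le> 0"
  shows "fls_nth (Polynomial.coeff (char_poly N) 0) m = 0"
proof -
  interpret E: symplectic n "const_mat B" by (rule symplectic_const_mat) unfold_locales
  interpret t: inj_comm_ring_hom "fps_to_fls :: 'f fps \<Rightarrow> _" by (rule inj_comm_ring_hom_fps_to_fls)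
  interpret z: comm_ring_hom "\<lambda>f :: 'f fps. fps_nth f 0" by (rule comm_ring_hom_fps_nth_0)
  obtain N' k where N: "N \<in> sp (const_mat B)" and N': "N' \<in> sp (map_mat fps_const B)"
    and conj: "sp_conj B N (map_mat fps_to_fls N')"
    and nilp: "map_mat (\<lambda>a. fps_nth a 0) N' ^\<^sub>m k = 0\<^sub>m (2 * n) (2 * n)"
    using nil unfolding nil_def by auto
  have N'c: "N' \<in> carrier_mat (2 * n) (2 * n)" using N' unfolding sp_def by auto
  define N0 where "N0 = map_mat (\<lambda>a. fps_nth a 0) N'"
  have N0: "N0 \<in> carrier_mat (2 * n) (2 * n)" unfolding N0_def using N'c by simp
  have pow: "det (N0 ^\<^sub>m j) = det N0 ^ j" for j
    by (induction j) (use N0 in \<open>simp_all add: det_mult[of _ "2 * n"]\<close>)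
  have "det (0\<^sub>m (2 * n) (2 * n) :: 'f mat) = 0"
    using m_pos by (intro det_0_iff_vec_prod_zero[THEN iffD2, of _ "2 * n"])
      (auto intro!: exI[of _ "unit_vec (2 * n) 0"] simp: zero_mat_mult_vec)
  then have "det N0 ^ k = 0" using pow[of k] nilp unfolding N0_def by simp
  then have "det N0 = 0" by simp
  then obtain v where v: "v \<in> carrier_vec (2 * n)" "v \<noteq> 0\<^sub>v (2 * n)" "N0 *\<^sub>v v = 0\<^sub>v (2 * n)"
    using det_0_iff_vec_prod_zero[OF N0] by blast
  then have "eigenvalue N0 0"
    unfolding eigenvalue_def eigenvector_def using N0 by (auto simp: zero_smult_vec intro!: exI[of _ v])
  then have "poly (char_poly N0) 0 = 0" using eigenvalue_root_char_poly[OF N0] by simp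
  then have "Polynomial.coeff (char_poly N0) 0 = 0" by (simp add: poly_0_coeff_0)
  then have c0: "fps_nth (Polynomial.coeff (char_poly N') 0) 0 = 0"
    unfolding N0_def z.char_poly_hom[OF N'c] by (simp add: coeff_map_poly)
  have "char_poly N = char_poly (map_mat fps_to_fls N')"
    using conj E.Ad_in_sp(2)[OF _ N] unfolding sp_conj_def by auto
  then have "Polynomial.coeff (char_poly N) 0 = fps_to_fls (Polynomial.coeff (char_poly N') 0)"
    unfolding t.char_poly_hom[OF N'c] by (simp add: coeff_map_poly)
  then show ?thesis using c0 m by (cases "m = 0") auto
qed

end

lemma almost_commuting_nil_elliptic_special:
  fixes B :: "'k::alg_closed_field mat"
  assumes ch: "CHAR('k) \<noteq> 2" and "symplectic n B" and ne: "nil_elliptic n B N"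
    and f: "Q_Sp_action B f" and ac: "almost_commutes f N s0"
    and h: "sq h = char_poly N"
  shows "\<exists>r d s b. special_h n r d s b h"
proof -
  interpret symplectic n B by fact
  interpret E: symplectic n "const_mat B" by (rule symplectic_const_mat) fact
  interpret t: inj_comm_ring_hom "to_ac :: 'k fls \<Rightarrow> _" by (rule inj_comm_ring_hom_to_ac)
  interpret tp: map_poly_comm_ring_hom "to_ac :: 'k fls \<Rightarrow> _" ..
  have rs: "regular_semisimple n B N" and nilN: "nil B N" and ell: "elliptic n B N"
    using ne unfolding nil_elliptic_def by auto
  have N: "N \<in> sp (const_mat B)" using rs unfolding regular_semisimple_def by simp
  have Nc: "N \<in> carrier_mat (2 * n) (2 * n)" using N E.sp_iff by simp
  define H where "H = map_poly to_ac h"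
  obtain a where a: "map_poly to_ac (char_poly N) = (\<Prod>i=1..n. [:- a i, 1:] * [:a i, 1:])"
    "inj_on (\<lambda>i. a i ^ 2) {1..n}" "\<And>i. i \<in> {1..n} \<Longrightarrow> a i ^ 2 \<noteq> 0"
    using rs unfolding regular_semisimple_def by blast
  \<comment> \<open>Over the algebraic closure h has the distinct nonzero roots a_i^2; separability
    derived from this later yields the conditions on the b_i and on d.\<close>
  have "sq H = sq (\<Prod>i=1..n. [:- (a i ^ 2), 1:])"
    unfolding pcompose_prod sq_linear H_def using a(1) unfolding h[symmetric]
    by (subst map_poly_sq[symmetric]) (unfold_locales, simp)
  then have H: "H = (\<Prod>i=1..n. [:- (a i ^ 2), 1:])" by (simp only: sq_inject)
  have sep: "poly (pderiv H) x \<noteq> 0" if "poly H x = 0" for x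
    using distinct_factors_separable[OF _ a(2)] that unfolding H by blast
  have degree_h: "Polynomial.degree h = n" and monic: "Polynomial.coeff h n = 1"
  proof -
    have lc: "Polynomial.coeff (sq h) (2 * n) = 1" "Polynomial.degree (sq h) = 2 * n"
      using degree_monic_char_poly[OF Nc] unfolding h by auto
    show "Polynomial.coeff h n = 1" using lc(1) by (simp add: coeff_sq)
    show "Polynomial.degree h = n" using lc(2) by (simp add: degree_pcompose degree_monom_eq)
  qed
  have "poly H 0 \<noteq> 0" unfolding H poly_prod using a(3) by simp
  moreover have "poly H 0 = to_ac (Polynomial.coeff h 0)"
    unfolding H_def by (rule trans[OF poly_0_coeff_0 t.coeff_map_poly_hom])
  ultimately have h0: "Polynomial.coeff h 0 \<noteq> 0" by auto
  obtain w where w: "\<And>l. l \<noteq> 0 \<Longrightarrow> snd (f l) = l powi w"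
    using action_weight f unfolding Q_Sp_action_def by blast
  have s0: "s0 \<noteq> 0" using ac unfolding almost_commutes_def by simp
  \<comment> \<open>Comparing powers of l gives 2 j s0 + w m = 2 n s0 for every exponent m occurring
    in the coefficient of mu^j.\<close>
  have weights: "w * m = 2 * s0 * int (n - j)"
    if nz: "fls_nth (Polynomial.coeff h j) m \<noteq> 0" and j: "j \<le> n" for j m
  proof -
    have coeff: "Polynomial.coeff (char_poly N) (2 * j) = Polynomial.coeff h j"
      unfolding h[symmetric] by (simp add: coeff_sq)
    have "l powi (s0 * int (2 * j) + w * m) = l powi (s0 * int (2 * n))" if "l \<noteq> 0" for l :: 'k
      using action_char_poly[OF _ w[OF that] that Nc ac, of "2 * j" m] f nz
      unfolding coeff Q_Sp_action_def by simp
    then have "s0 * int (2 * j) + w * m = s0 * int (2 * n)"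
      by (rule powi_inject[OF infinite_alg_closed])
    then show ?thesis using j by (simp add: of_nat_diff algebra_simps)
  qed
  \<comment> \<open>The nonzero constant coefficient fixes the slope: its exponent satisfies w m0 =
    2 s0 n, and m0 > 0 because N is nil.\<close>
  obtain m0 where m0: "fls_nth (Polynomial.coeff h 0) m0 \<noteq> 0"
    using h0 by (metis fls_eqI fls_zero_nth)
  have "m0 > 0"
  proof (rule ccontr)
    assume "\<not> m0 > 0"
    moreover have "Polynomial.coeff (char_poly N) 0 = Polynomial.coeff h 0"
      unfolding h[symmetric] coeff_sq by simp
    ultimately show False using nil_char_poly[OF nilN, of m0] m0 by simp
  qed
  then obtain m1 where m1: "m0 = int m1" "m1 > 0" by (metis zero_less_imp_eq_int)
  have wm: "w * int m1 = 2 * s0 * int n" using weights[OF m0] m1 by simp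
  then have "w \<noteq> 0" using s0 n_pos by auto
  \<comment> \<open>The slope m1 / n in lowest terms is s / d, and r becomes the number of
    factors.\<close>
  define r where "r = gcd n m1"
  define d where "d = n div r"
  define s where "s = m1 div r"
  have r: "r > 0" unfolding r_def using n_pos by (simp add: gcd_pos_nat)
  have nd: "n = d * r" and ms: "m1 = s * r" unfolding d_def s_def r_def by simp_all
  have d: "d > 0" using nd n_pos by (auto intro: Nat.gr0I)
  have s: "s > 0" using ms m1 by (auto intro: Nat.gr0I)
  have cop: "Rings.coprime d s"
    unfolding d_def s_def r_def using n_pos by (intro div_gcd_coprime) simp
  have shape: "int s * int (n - j) = int d * m"
    if "fls_nth (Polynomial.coeff h j) m \<noteq> 0" "j \<le> n" for j m
  proof -
    have "w * int m1 * int (n - j) = w * m * int n"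
      using weights[OF that] wm by (simp add: algebra_simps)
    then have "int m1 * int (n - j) = m * int n" using \<open>w \<noteq> 0\<close> by (simp add: mult.assoc)
    then have "int r * (int s * int (n - j)) = int r * (int d * m)"
      unfolding nd[symmetric] by (metis (no_types) mult.assoc mult.commute ms nd of_nat_mult)
    then show ?thesis using r by simp
  qed
  obtain b where b: "h = (\<Prod>i=1..r. Polynomial.monom 1 d - [:fls_const (b i) * fls_X ^ s:])"
    using homogeneous_factorization[OF d nd cop degree_h monic shape] by blast
  define c where "c i = to_ac (fls_const (b i) * fls_X ^ s)" for i
  have Hc: "H = (\<Prod>i=1..r. Polynomial.monom 1 d - [:c i:])"
    unfolding H_def b tp.hom_prod c_def
    by (intro prod.cong refl) (simp add: tp.hom_minus map_poly_monom t.map_poly_pCons_hom)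
  have Hsplit: "H = (Polynomial.monom 1 d - [:c i:]) * (\<Prod>j\<in>{1..r} - {i}. Polynomial.monom 1 d - [:c j:])"
    if "i \<in> {1..r}" for i
    unfolding Hc using that by (simp add: prod.remove)
  have root: "\<exists>x. poly (Polynomial.monom 1 d - [:c i:]) x = 0" for i
    using nth_root_exists[OF d, of "c i"] by (auto simp: poly_monom)
  \<comment> \<open>Equal b_i would make a factor occur twice, hence give H a multiple root.\<close>
  have b_inj: "inj_on b {1..r}"
  proof (rule inj_onI, rule ccontr)
    fix i j assume ij: "i \<in> {1..r}" "j \<in> {1..r}" "b i = b j" "i \<noteq> j"
    then have cij: "c i = c j" unfolding c_def by simp
    have "H = (Polynomial.monom 1 d - [:c i:]) * ((Polynomial.monom 1 d - [:c i:]) *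
        (\<Prod>l\<in>{1..r} - {i} - {j}. Polynomial.monom 1 d - [:c l:]))"
    proof -
      have "(\<Prod>l\<in>{1..r} - {i}. Polynomial.monom 1 d - [:c l:]) =
          (Polynomial.monom 1 d - [:c j:]) * (\<Prod>l\<in>{1..r} - {i} - {j}. Polynomial.monom 1 d - [:c l:])"
        using ij by (intro prod.remove) auto
      then show ?thesis unfolding Hsplit[OF ij(1)] cij by (simp only:)
    qed
    moreover obtain x where x: "poly (Polynomial.monom 1 d - [:c i:]) x = 0" using root by blast
    ultimately have "poly H x = 0" "poly (pderiv H) x = 0"
      using pderiv_multiple_root[OF x] by (simp_all only: poly_mult x mult_zero_left)
    then show False using sep by simp
  qed
  have b_nz: "b i \<noteq> 0" if i: "i \<in> {1..r}" for i
  proof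
    assume "b i = 0"
    then have "poly (Polynomial.monom 1 d - [:c i:]) 0 = 0" using d by (simp add: c_def poly_monom power_0_left)
    then show False using \<open>poly H 0 \<noteq> 0\<close> unfolding Hsplit[OF i] by (simp only: poly_mult mult_zero_left simp_thms)
  qed
  \<comment> \<open>If d were 0 in k, the derivative of mu^d - c_1 would vanish identically and each
    root of this factor would be a multiple root of H.\<close>
  have char: "coprime (char_exponent TYPE('k)) d"
  proof (rule ccontr)
    assume "\<not> coprime (char_exponent TYPE('k)) d"
    then have "of_nat d = (0 :: 'k fls alg_closure)"
      unfolding char_exponent_coprime_iff to_ac_of_nat_fls by simp
    moreover have 1: "1 \<in> {1..r}" using r by simp
    moreover obtain x where x: "poly (Polynomial.monom 1 d - [:c 1:]) x = 0" using root by blast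
    ultimately have "poly (pderiv H) x = 0"
      unfolding Hsplit[OF 1] by (simp add: pderiv_mult pderiv_diff pderiv_monom pderiv_pCons)
    moreover have "poly H x = 0" unfolding Hsplit[OF 1] using x by (simp only: poly_mult mult_zero_left)
    ultimately show False using sep by simp
  qed
  have "odd s"
  proof
    assume "Parity.even s"
    then obtain s' where s': "s = 2 * s'" by auto
    have odd_d: "Parity.odd d" using cop s' by (metis coprime_common_divisor dvd_triv_left odd_one)
    have cop': "Rings.coprime d s'" using cop unfolding s' by simp
    have 1: "1 \<in> {1..r}" using r by simp
    have "2 * d > 0" using d by simp
    \<comment> \<open>With \<gamma>^(2d) = b_1 and s = 2 s' the first factor of h(mu^2) splits as
      (mu^d - \<gamma>^d pi^s') (mu^d + \<gamma>^d pi^s').\<close>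
    then obtain \<gamma> where \<gamma>: "\<gamma> ^ (2 * d) = b 1" using nth_root_exists by blast
    have k: "kummer d s' \<gamma>"
    proof
      show "\<gamma> \<noteq> 0" using b_nz[OF 1] \<gamma> d by (metis power_0_left mult_eq_0_iff not_gr_zero zero_neq_numeral)
    qed (use d cop' in auto)
    interpret kummer d s' \<gamma> by (rule k)
    define Z where "Z i = Polynomial.monom 1 (2 * d) - [:fls_const (b i) * fls_X ^ s:]" for i
    have sq_h: "sq h = (\<Prod>i=1..r. Z i)"
      unfolding b pcompose_prod Z_def by (simp add: pcompose_diff sq_monom)
    define R where "R = (\<Prod>i\<in>{1..r} - {1}. Z i)"
    define u where "u = fls_const (\<gamma> ^ d) * fls_X ^ s'"
    have P: "P = Polynomial.monom 1 d - [:u:]" unfolding P_def u_def ..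
    have neg_P: "neg_arg P = - (Polynomial.monom 1 d + [:u:])"
      unfolding P using odd_d by (simp add: pcompose_diff neg_arg_monom flip: minus_monom)
    have "u * u = fls_const (b 1) * fls_X ^ s"
    proof -
      have "\<gamma> ^ d * \<gamma> ^ d = b 1" using \<gamma> by (simp add: mult_2 power_add)
      moreover have "u * u = (fls_const (\<gamma> ^ d) * fls_const (\<gamma> ^ d)) * (fls_X ^ s' * fls_X ^ s')"
        unfolding u_def by (simp only: mult_ac)
      ultimately show ?thesis unfolding s' by (simp only: fls_const_mult_const mult_2 power_add)
    qed
    then have Z1: "Z 1 = P * - neg_arg P"
    proof -
      have "P * - neg_arg P = P * (Polynomial.monom 1 d + [:u:])" unfolding neg_P minus_minus ..
      also have "\<dots> = (Polynomial.monom 1 d - [:u:]) * (Polynomial.monom 1 d + [:u:])" unfolding P ..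
      also have "\<dots> = Polynomial.monom 1 d * Polynomial.monom 1 d - [:u:] * [:u:]"
        by (rule square_diff_square_factored[symmetric, THEN trans[OF mult.commute]])
      also have "\<dots> = Polynomial.monom 1 (2 * d) - [:u * u:]" by (simp add: mult_monom mult_2)
      finally show ?thesis unfolding Z_def \<open>u * u = _\<close> by simp
    qed
    have neg_Z: "neg_arg (Z i) = Z i" for i
      unfolding Z_def by (simp add: pcompose_diff neg_arg_monom)
    have "\<not> P dvd Z i" if i: "i \<in> {1..r} - {1}" for i
    proof
      assume "P dvd Z i"
      moreover have "P dvd Z 1" unfolding Z1 by simp
      ultimately have dvd: "P dvd Z i - Z 1" by (rule dvd_diff)
      have "Z i - Z 1 = [:(fls_const (b 1) - fls_const (b i)) * fls_X ^ s:]"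
        unfolding Z_def by (simp add: algebra_simps)
      moreover have "fls_const (b 1) - fls_const (b i) \<noteq> 0"
        using i 1 b_inj by (auto simp: fls_const_nonzero fls_minus_const dest: inj_onD)
      ultimately have "Z i - Z 1 \<noteq> 0" "Polynomial.degree (Z i - Z 1) = 0" by auto
      then show False using dvd_imp_degree_le[OF dvd] degree_P D_pos by simp
    qed
    then have "\<not> P dvd R" unfolding R_def by (subst P_dvd_prod) auto
    \<comment> \<open>The cofactor is -R because d is odd: P(-mu) is minus the second half of the
      split factor.\<close>
    then have R2: "\<not> P dvd - R" by simp
    have R1: "neg_arg (- R) = - R" unfolding R_def pcompose_uminus pcompose_prod neg_Z ..
    have "char_poly N = Z 1 * R" unfolding h[symmetric] sq_h R_def using 1 by (simp add: prod.remove)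
    then have "char_poly N = P * (neg_arg P * - R)" unfolding Z1 by simp
    then have "\<not> elliptic n B N"
      by (intro split_factor_not_elliptic[OF assms(2) k odd_d two_neq_zero[OF ch] N _ R1 R2])
    then show False using ell by simp
  qed
  then have "coprime s (2 * d)" using cop by (simp add: coprime_commute)
  then have "special_h n r d s b h"
    unfolding special_h_def using b s nd char b_inj b_nz by (simp add: mult.commute)
  then show ?thesis by blast
qed

section \<open>Conjugacy classes\<close>

text \<open>Gives meaning to the definite descriptions in \<open>h_elt\<close> and
  \<open>h_class\<close>: the characteristic polynomial is even and constant on the class, and h is
  determined by h(mu^2).\<close>

lemma sp_class_h:
  fixes B :: "'k::field mat"
  assumes ch: "CHAR('k) \<noteq> 2" and sy: "symplectic n B" and C: "C \<in> sp_classes B"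
  shows "\<exists>N0\<in>C. C = {N'. sp_conj B N0 N'} \<and>
    (\<forall>N\<in>C. N \<in> sp (const_mat B) \<and> char_poly N = sq (h_class C))"
proof -
  interpret E: symplectic n "const_mat B" by (rule symplectic_const_mat[OF sy])
  obtain N0 where N0: "N0 \<in> sp (const_mat B)" "C = {N'. sp_conj B N0 N'}"
    using C unfolding sp_classes_def by auto
  have N0c: "N0 \<in> carrier_mat (2 * n) (2 * n)" using N0 E.sp_iff by simp
  have "N0 = Ad (1\<^sub>m (2 * n)) N0"
    by (rule Ad_eq_iff[THEN iffD2, of _ "2 * n"]) (use N0c in auto)
  then have mem: "N0 \<in> C" using E.one_in_Sp unfolding N0(2) sp_conj_def by blast
  have sp: "N \<in> sp (const_mat B) \<and> char_poly N = char_poly N0" if "N \<in> C" for N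
  proof -
    have "sp_conj B N0 N" using that N0(2) by simp
    then obtain g where "g \<in> Sp (const_mat B)" "N = Ad g N0"
      unfolding sp_conj_def by blast
    then show ?thesis using E.Ad_in_sp[of g, OF _ N0(1)] by simp
  qed
  have "(2 :: 'k fls) \<noteq> 0" using ch by (intro two_neq_zero) simp
  then obtain h where h: "sq h = char_poly N0"
    using even_poly_is_sq E.char_poly_sp_even[OF N0(1)] by blast
  have elt: "h_elt N = h" if "N \<in> C" for N
    using sp[OF that] h by (intro h_elt_eqI) simp
  have "h_class C = h"
    unfolding h_class_def
  proof (rule the_equality)
    show "h' = h" if "\<forall>N\<in>C. h_elt N = h'" for h'
      using bspec[OF that mem] elt[OF mem] by simp
  qed (simp add: elt)
  then have "\<forall>N\<in>C. N \<in> sp (const_mat B) \<and> char_poly N = sq (h_class C)"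
    using sp h by simp
  then show ?thesis by (intro bexI[of _ N0] conjI N0(2) mem)
qed

lemma symplectic_basis_matrix:
  fixes B :: "'k::field mat"
  assumes "symplectic n B" and e: "symplectic_basis n B e"
  defines "S \<equiv> mat_of_cols (2 * n) (map e [1..<2 * n + 1])"
  shows "S \<in> carrier_mat (2 * n) (2 * n)"
    and "\<And>j. j \<in> {1..2 * n} \<Longrightarrow> e j = col S (j - 1)"
    and "transpose_mat S * B * S = std_form n"
proof -
  interpret symplectic n B by fact
  interpret V: vec_space "TYPE('k)" "2 * n" .
  have "V.basis (e ` {1..2 * n})" using e unfolding symplectic_basis_def by simp
  then have car: "e j \<in> carrier_vec (2 * n)" if "j \<in> {1..2 * n}" for j
    using that unfolding V.basis_def by auto
  have iso: "form (e i) (e j) = 0" if I: "I = {1..n} \<or> I = {n + 1..2 * n}" and ij: "i \<in> I" "j \<in> I" for I i j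
  proof -
    have "e ` I \<subseteq> carrier_vec (2 * n)" using I car by auto
    then have "e ` I \<subseteq> V.span (e ` I)" by (intro V.in_own_span) simp
    then have "e i \<in> V.span (e ` I)" "e j \<in> V.span (e ` I)" using ij by auto
    then show ?thesis using e I unfolding symplectic_basis_def by blast
  qed
  have dual: "form (e i) (e (n + j)) = (if i = j then 1 else 0)" if "i \<in> {1..n}" "j \<in> {1..n}" for i j
    using e that unfolding symplectic_basis_def by blast
  have dual': "form (e (n + i)) (e j) = (if i = j then - 1 else 0)" if "i \<in> {1..n}" "j \<in> {1..n}" for i j
    using form_skew[of "e (n + i)" "e j"] dual[OF that(2,1)] car that by auto
  show S: "S \<in> carrier_mat (2 * n) (2 * n)"
    unfolding S_def using mat_of_cols_carrier(1)[of "2 * n" "map e [1..<2 * n + 1]"]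
    by (simp del: upt_Suc)
  have col: "col S j = e (Suc j)" if "j < 2 * n" for j
    unfolding S_def using that car[of "Suc j"] by (subst col_mat_of_cols) (auto simp del: upt_Suc)
  show "e j = col S (j - 1)" if "j \<in> {1..2 * n}" for j
    using col[of "j - 1"] that by auto
  show "transpose_mat S * B * S = std_form n"
  proof (rule eq_matI)
    fix i j assume "i < dim_row (std_form n :: 'k mat)" "j < dim_col (std_form n :: 'k mat)"
    then have ij: "i < 2 * n" "j < 2 * n" by (auto simp: std_form_def)
    have split: "i < n \<or> (\<exists>a<n. i = n + a)" if "i < 2 * n" for i
      using that by (metis add_less_cancel_left le_Suc_ex mult_2 not_less)
    have "(transpose_mat S * B * S) $$ (i, j) = form (e (Suc i)) (e (Suc j))"
      using gram_index[OF S ij] col ij by simp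
    also have "\<dots> = (if j = i + n then 1 else if i = j + n then - 1 else 0)"
      using split[OF ij(1)] split[OF ij(2)]
    proof (elim disjE exE conjE)
      assume ij: "i < n" "j < n"
      then have "form (e (Suc i)) (e (Suc j)) = 0" by (intro iso[of "{1..n}"]) auto
      then show ?thesis using ij by simp
    next
      fix a c assume ij: "a < n" "i = n + a" "c < n" "j = n + c"
      then have "form (e (Suc i)) (e (Suc j)) = 0" by (intro iso[of "{n + 1..2 * n}"]) auto
      then show ?thesis using ij by simp
    next
      fix a assume ij: "i < n" "a < n" "j = n + a"
      then show ?thesis using dual[of "Suc i" "Suc a"] by auto
    next
      fix a assume ij: "a < n" "i = n + a" "j < n"
      then show ?thesis using dual'[of "Suc a" "Suc j"] by auto
    qed
    finally show "(transpose_mat S * B * S) $$ (i, j) = std_form n $$ (i, j)"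
      using ij by (simp add: std_form_def)
  qed (use S in \<open>auto simp: std_form_def\<close>)
qed

theorem proposition4p5:
  fixes n :: nat and B :: "'k::alg_closed_field mat"
  assumes "CHAR('k) \<noteq> 2" and "n \<ge> 1" and "symplectic_form n B"
  shows
    "{C \<in> nil_elliptic_classes n B. from_almost_commuting_pair B C} =
       {C \<in> sp_classes B. \<exists>r d s b. special_h n r d s b (h_class C)}
     \<and>
     (\<forall>C \<in> sp_classes B. \<forall>r d s b e N.
        special_h n r d s b (h_class C) \<longrightarrow> symplectic_basis n B e \<longrightarrow>
        standard_representative n e (h_class C) N \<longrightarrow>
          N \<in> C \<and>
          (\<exists>f. GSp_Gm_hom B f \<and>
               (\<forall>l m. \<forall>j\<in>{1..2 * n}. l \<noteq> 0 \<longrightarrow>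
                  GSp_Gm_act (f l) (fls_X_intpow m \<cdot>\<^sub>v const_vec (e j)) =
                    fls_const (l powi nu n d s m j) \<cdot>\<^sub>v (fls_X_intpow m \<cdot>\<^sub>v const_vec (e j))) \<and>
               Q_Sp_action B (induced_Q_Sp B f) \<and>
               almost_commutes (induced_Q_Sp B f) N (int s) \<and>
               (\<forall>l. l \<noteq> 0 \<longrightarrow> (\<forall>x \<in> carrier_vec (2 * n).
                  GSp_Gm_act (f l) (N *\<^sub>v x) =
                    fls_const (l powi int s) \<cdot>\<^sub>v (N *\<^sub>v GSp_Gm_act (f l) x)))))"
proof -
  have sy: "symplectic n B" using assms by (intro symplectic_of_form)
  interpret symplectic n B by (rule sy)
  have cls: "N \<in> sp (const_mat B) \<and> char_poly N = sq (h_class C)"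
    if "C \<in> sp_classes B" "N \<in> C" for C N
    using sp_class_h[OF assms(1) sy that(1)] that(2) by blast
  \<comment> \<open>A class with special h contains the standard element for any symplectic basis:
    for an auxiliary one in the first assertion, for the given one in the second.\<close>
  have in_class: "N \<in> C"
    if C: "C \<in> sp_classes B" and h: "special_h n r d s b (h_class C)"
      and S: "S \<in> carrier_mat (2 * n) (2 * n)" "transpose_mat S * B * S = std_form n"
      and N: "N \<in> carrier_mat (2 * n) (2 * n)" "N * const_mat S = const_mat S * std_mat n (h_class C)"
    for C r d s b S N
  proof -
    obtain N0 where N0: "N0 \<in> C" "C = {N'. sp_conj B N0 N'}"
      using sp_class_h[OF assms(1) sy C] by blast
    have "sp_conj B N0 N"
      using special_conjugate[OF assms(1) sy h] cls[OF C N0(1)] standard_element[OF S N]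
        special_h_degree[OF assms(2) h] by blast
    then show ?thesis using N0(2) by blast
  qed
  have eq: "C \<in> nil_elliptic_classes n B \<and> from_almost_commuting_pair B C \<longleftrightarrow>
      (\<exists>r d s b. special_h n r d s b (h_class C))" if C: "C \<in> sp_classes B" for C
  proof
    assume ne: "C \<in> nil_elliptic_classes n B \<and> from_almost_commuting_pair B C"
    then obtain N f s where "N \<in> C" "Q_Sp_action B f" "almost_commutes f N s"
      unfolding from_almost_commuting_pair_def by blast
    moreover from this ne have "nil_elliptic n B N" unfolding nil_elliptic_classes_def by blast
    ultimately show "\<exists>r d s b. special_h n r d s b (h_class C)"
      using cls[OF C] almost_commuting_nil_elliptic_special[OF assms(1) sy] by metis
  next
    assume "\<exists>r d s b. special_h n r d s b (h_class C)"
    then obtain r d s b where h: "special_h n r d s b (h_class C)" by blast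
    have ne: "C \<in> nil_elliptic_classes n B"
      unfolding nil_elliptic_classes_def
      using C cls[OF C] special_nil_elliptic[OF assms(1) sy h] by blast
    \<comment> \<open>The first assertion mentions no basis, so one is supplied.\<close>
    obtain S where S: "S \<in> carrier_mat (2 * n) (2 * n)" "transpose_mat S * B * S = std_form n"
      using darboux two_neq_zero[OF assms(1)] by blast
    obtain N where N: "N \<in> carrier_mat (2 * n) (2 * n)" "N * const_mat S = const_mat S * std_mat n (h_class C)"
      using standard_element_exists[OF S] by blast
    interpret T: standard_torus n B S r d s b "h_class C"
      by unfold_locales (rule S h)+
    have "from_almost_commuting_pair B C"
      unfolding from_almost_commuting_pair_def
      using in_class[OF C h S N] T.Q_Sp_action_act T.act_almost_commutes[OF N] by blast
    then show "C \<in> nil_elliptic_classes n B \<and> from_almost_commuting_pair B C" using ne by blast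
  qed
  show ?thesis
  proof (intro conjI ballI allI impI)
    show "{C \<in> nil_elliptic_classes n B. from_almost_commuting_pair B C} =
       {C \<in> sp_classes B. \<exists>r d s b. special_h n r d s b (h_class C)}"
      using eq unfolding nil_elliptic_classes_def by blast
  next
    fix C r d s b e N
    assume C: "C \<in> sp_classes B" and h: "special_h n r d s b (h_class C)"
      and e: "symplectic_basis n B e" and std: "standard_representative n e (h_class C) N"
    define S where "S = mat_of_cols (2 * n) (map e [1..<2 * n + 1])"
    note S = symplectic_basis_matrix[OF sy e, folded S_def]
    have N: "N \<in> carrier_mat (2 * n) (2 * n)" "N * const_mat S = const_mat S * std_mat n (h_class C)"
      using std unfolding standard_representative_def Let_def S_def std_mat_def by auto
    interpret T: standard_torus n B S r d s b "h_class C"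
      by unfold_locales (rule S h)+
    show "N \<in> C" by (rule in_class[OF C h S(1,3) N])
    show "\<exists>f. GSp_Gm_hom B f \<and>
               (\<forall>l m. \<forall>j\<in>{1..2 * n}. l \<noteq> 0 \<longrightarrow>
                  GSp_Gm_act (f l) (fls_X_intpow m \<cdot>\<^sub>v const_vec (e j)) =
                    fls_const (l powi nu n d s m j) \<cdot>\<^sub>v (fls_X_intpow m \<cdot>\<^sub>v const_vec (e j))) \<and>
               Q_Sp_action B (induced_Q_Sp B f) \<and>
               almost_commutes (induced_Q_Sp B f) N (int s) \<and>
               (\<forall>l. l \<noteq> 0 \<longrightarrow> (\<forall>x \<in> carrier_vec (2 * n).
                  GSp_Gm_act (f l) (N *\<^sub>v x) =
                    fls_const (l powi int s) \<cdot>\<^sub>v (N *\<^sub>v GSp_Gm_act (f l) x)))"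
    proof (intro exI[of _ T.act] conjI allI ballI impI)
      show "GSp_Gm_hom B T.act" by (rule T.act_hom)
      show "Q_Sp_action B (induced_Q_Sp B T.act)" by (rule T.Q_Sp_action_act)
      show "almost_commutes (induced_Q_Sp B T.act) N (int s)" by (rule T.act_almost_commutes[OF N])
      show "GSp_Gm_act (T.act l) (fls_X_intpow m \<cdot>\<^sub>v const_vec (e j)) =
          fls_const (l powi nu n d s m j) \<cdot>\<^sub>v (fls_X_intpow m \<cdot>\<^sub>v const_vec (e j))"
        if "j \<in> {1..2 * n}" "l \<noteq> 0" for l m j
        using T.act_basis[of l j e, OF that(2,1) S(2)[OF that(1)]] .
      show "GSp_Gm_act (T.act l) (N *\<^sub>v x) = fls_const (l powi int s) \<cdot>\<^sub>v (N *\<^sub>v GSp_Gm_act (T.act l) x)"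
        if "l \<noteq> 0" "x \<in> carrier_vec (2 * n)" for l x
        by (rule T.act_commutes[OF that(1) N that(2)])
    qed
  qed
qed

end
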